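(* Let $n,t$ be integers with $t\ge 3$ and $n\ge 9$. Let $\Gamma$ be a $t\mathcal{C}_3^-$-free unbalanced signed graph of order $n$ that is not switching isomorphic to $\Gamma_{n,t+1}$ (if $3\le t\le n-2$), respectively not switching isomorphic to $\Gamma_{n,n}$ (if $t\ge n-1$), and suppose that $\Gamma$ has maximum index among all signed graphs with these properties. Then, up to switching isomorphism: (i) if $3\le t\le \lfloor n/2\rfloor$, then $\Gamma\cong\Gamma_{n,t}$; (ii) if $\lfloor n/2\rfloor+1\le t\le n-3$, then $\Gamma\cong\Sigma_{1,t-1,n-t-2}$; (iii) if $t=n-2$, then $\Gamma\cong\Gamma_{n,n-2}$; (iv) if $t\ge n-1$, then $\Gamma\cong\Gamma_{n,n-1}$.
   Context: A signed graph $\Gamma=(G,\sigma)$ consists of a finite simple graph $G$ (its underlying graph) and a signature $\sigma:E(G)\to\{-1,+1\}$; its order is $|V(G)|$. Its adjacency matrix $A(\Gamma)$ has $(i,j)$ entry $\sigma(v_iv_j)$ if $v_i\sim v_j$ in $G$ and $0$ otherwise. The index of $\Gamma$ is the largest eigenvalue $\lambda_1(A(\Gamma))$. A cycle of $\Gamma$ is positive if it contains an even number of negative edges, and negative (unbalanced) otherwise. $\Gamma$ is balanced if it has no negative cycle, and unbalanced otherwise. Switching with respect to $U\subset V(G)$ reverses the signs of all edges between $U$ and $V(G)\setminus U$. Two signed graphs are switching isomorphic if one can be obtained from a signed graph isomorphic to the other (isomorphism preserving edge signs) by finitely many switchings. For an integer $t\ge 1$, $\Gamma$ is $t\mathcal{C}_3^-$-free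 if it does not contain $t$ distinct unbalanced triangles (signed subgraphs with underlying graph $C_3$ that are negative cycles). The triangles are not required to be vertex-disjoint or edge-disjoint; so $t\mathcal{C}_3^-$-free means at most $t-1$ distinct unbalanced triangles. For $3\le t\le n$, $\Gamma_{n,t}$ is the signed graph of order $n$ obtained from the complete graph $K_{n-1}$ on $\{v_1,\dots,v_{n-1}\}$ with all edges positive by adding a new vertex $u$ and joining $u$ to the $t-1$ vertices $v_1,\dots,v_{t-1}$, where $uv_1$ is the unique negative edge of $\Gamma_{n,t}$. For nonnegative integers $s,t,r$ with $s+t+r=n-2$, $\Sigma_{s,t,r}$ is the signed graph of order $n$ obtained from an all-positive complete graph $K_{n-2}$, whose vertex set is partitioned into sets $S,T,R$ of sizes $s,t,r$, by adding two vertices $v_1,v_2$ joined to each other by a negative edge (the unique negative edge), joining $v_1$ by positive edges to all vertices of $S\cup T$ and joining $v_2$ by positive edges to all vertices of $T\cup R$ (no other edges). *)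

theory Defs
  imports "Jordan_Normal_Form.Spectral_Radius"
begin

record 'a sgraph =
  verts :: "'a set"
  edges :: "'a set set"
  sign :: "'a set \<Rightarrow> int"

text \<open>
  Edges are two-element sets of vertices. The values of \<open>sign\<close> outside \<open>edges\<close> carry no
  information; no notion below other than record equality looks at them.
\<close>

definition signed_graph :: "'a sgraph \<Rightarrow> bool" where
  "signed_graph \<Gamma> \<longleftrightarrow>
     finite (verts \<Gamma>) \<and>
     (\<forall>e\<in>edges \<Gamma>. e \<subseteq> verts \<Gamma> \<and> card e = 2) \<and>
     (\<forall>e\<in>edges \<Gamma>. sign \<Gamma> e \<in> {-1, 1})"

definition adj_entry :: "'a sgraph \<Rightarrow> 'a \<Rightarrow> 'a \<Rightarrow> real" where
  "adj_entry \<Gamma> v w = (if {v, w} \<in> edges \<Gamma> then of_int (sign \<Gamma> {v, w}) else 0)"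

definition vertex_enumeration :: "'a sgraph \<Rightarrow> 'a list \<Rightarrow> bool" where
  "vertex_enumeration \<Gamma> vs \<longleftrightarrow> distinct vs \<and> set vs = verts \<Gamma>"

definition adj_matrix :: "'a sgraph \<Rightarrow> 'a list \<Rightarrow> real mat" where
  "adj_matrix \<Gamma> vs = mat (length vs) (length vs) (\<lambda>(i, j). adj_entry \<Gamma> (vs ! i) (vs ! j))"

text \<open>
  The eigenvalues of the adjacency matrix do not depend on the enumeration of the vertices
  (lemma \<open>spectrum_adj_matrix_unique\<close> below), so the choice made in the definition of the
  index is immaterial.
\<close>

definition index :: "'a sgraph \<Rightarrow> real" where
  "index \<Gamma> = Max (spectrum (adj_matrix \<Gamma> (SOME vs. vertex_enumeration \<Gamma> vs)))"

text \<open>A cycle is given by the list of its vertices in cyclic order.\<close>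

definition cycle_edges :: "'a list \<Rightarrow> 'a set set" where
  "cycle_edges vs = {{vs ! i, vs ! (Suc i mod length vs)} | i. i < length vs}"

definition is_cycle :: "'a sgraph \<Rightarrow> 'a list \<Rightarrow> bool" where
  "is_cycle \<Gamma> vs \<longleftrightarrow> 3 \<le> length vs \<and> distinct vs \<and> cycle_edges vs \<subseteq> edges \<Gamma>"

definition negative_cycle :: "'a sgraph \<Rightarrow> 'a list \<Rightarrow> bool" where
  "negative_cycle \<Gamma> vs \<longleftrightarrow> is_cycle \<Gamma> vs \<and> odd (card {e \<in> cycle_edges vs. sign \<Gamma> e = -1})"

definition balanced :: "'a sgraph \<Rightarrow> bool" where
  "balanced \<Gamma> \<longleftrightarrow> (\<nexists>vs. negative_cycle \<Gamma> vs)"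

text \<open>
  A triangle, as a subgraph, is identified with its set of edges: different vertex lists
  describing the same triangle are counted once.
\<close>

definition unbalanced_triangles :: "'a sgraph \<Rightarrow> 'a set set set" where
  "unbalanced_triangles \<Gamma> = {cycle_edges vs | vs. negative_cycle \<Gamma> vs \<and> length vs = 3}"

definition tC3_free :: "nat \<Rightarrow> 'a sgraph \<Rightarrow> bool" where
  "tC3_free t \<Gamma> \<longleftrightarrow> (\<nexists>\<T>. \<T> \<subseteq> unbalanced_triangles \<Gamma> \<and> card \<T> = t)"

definition switch :: "'a set \<Rightarrow> 'a sgraph \<Rightarrow> 'a sgraph" where
  "switch U \<Gamma> = \<Gamma>\<lparr>sign := \<lambda>e.
     if e \<in> edges \<Gamma> \<and> e \<inter> U \<noteq> {} \<and> e \<inter> (verts \<Gamma> - U) \<noteq> {}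
     then - sign \<Gamma> e else sign \<Gamma> e\<rparr>"

definition sg_isomorphic :: "'a sgraph \<Rightarrow> 'b sgraph \<Rightarrow> bool" where
  "sg_isomorphic \<Gamma> \<Delta> \<longleftrightarrow>
     (\<exists>f. bij_betw f (verts \<Gamma>) (verts \<Delta>) \<and>
          (\<forall>v\<in>verts \<Gamma>. \<forall>w\<in>verts \<Gamma>. {v, w} \<in> edges \<Gamma> \<longleftrightarrow> {f v, f w} \<in> edges \<Delta>) \<and>
          (\<forall>v\<in>verts \<Gamma>. \<forall>w\<in>verts \<Gamma>. {v, w} \<in> edges \<Gamma> \<longrightarrow> sign \<Delta> {f v, f w} = sign \<Gamma> {v, w}))"

definition switching_step :: "'a sgraph \<Rightarrow> 'a sgraph \<Rightarrow> bool" where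
  "switching_step \<Gamma> \<Gamma>' \<longleftrightarrow> (\<exists>U\<subseteq>verts \<Gamma>. \<Gamma>' = switch U \<Gamma>)"

definition switching_isomorphic :: "'a sgraph \<Rightarrow> 'b sgraph \<Rightarrow> bool" where
  "switching_isomorphic \<Gamma> \<Delta> \<longleftrightarrow>
     (\<exists>\<Delta>'. sg_isomorphic \<Delta> \<Delta>' \<and> switching_step\<^sup>*\<^sup>* \<Delta>' \<Gamma>)"

text \<open>
  In \<open>Gamma_graph n t\<close> (meant for \<open>3 \<le> t \<le> n\<close>) the vertex \<open>u\<close> is \<open>0\<close> and \<open>v\<^sub>i\<close> is \<open>i\<close>.
\<close>

definition Gamma_graph :: "nat \<Rightarrow> nat \<Rightarrow> nat sgraph" where
  "Gamma_graph n t =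
     \<lparr>verts = {0..n - 1},
      edges = {{i, j} | i j. 1 \<le> i \<and> i < j \<and> j \<le> n - 1} \<union> {{0, i} | i. 1 \<le> i \<and> i \<le> t - 1},
      sign = (\<lambda>e. if e = {0, 1} then -1 else 1)\<rparr>"

text \<open>
  In \<open>Sigma_graph s t r\<close> the vertices \<open>v\<^sub>1\<close> and \<open>v\<^sub>2\<close> are \<open>0\<close> and \<open>1\<close>, and the sets \<open>S\<close>, \<open>T\<close>, \<open>R\<close>
  are consecutive intervals starting at \<open>2\<close>.
\<close>

definition Sigma_graph :: "nat \<Rightarrow> nat \<Rightarrow> nat \<Rightarrow> nat sgraph" where
  "Sigma_graph s t r =
     (let S = {2..<2 + s}; T = {2 + s..<2 + s + t}; R = {2 + s + t..<2 + s + t + r} in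
     \<lparr>verts = {0, 1} \<union> S \<union> T \<union> R,
      edges = {{i, j} | i j. i \<in> S \<union> T \<union> R \<and> j \<in> S \<union> T \<union> R \<and> i \<noteq> j} \<union>
              {{0, 1}} \<union> {{0, i} | i. i \<in> S \<union> T} \<union> {{1, i} | i. i \<in> T \<union> R},
      sign = (\<lambda>e. if e = {0, 1} then -1 else 1)\<rparr>)"

definition admissible :: "nat \<Rightarrow> nat \<Rightarrow> 'a sgraph \<Rightarrow> bool" where
  "admissible n t \<Gamma> \<longleftrightarrow>
     signed_graph \<Gamma> \<and> card (verts \<Gamma>) = n \<and> \<not> balanced \<Gamma> \<and> tC3_free t \<Gamma> \<and>
     (3 \<le> t \<and> t \<le> n - 2 \<longrightarrow> \<not> switching_isomorphic \<Gamma> (Gamma_graph n (t + 1))) \<and>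
     (t \<ge> n - 1 \<longrightarrow> \<not> switching_isomorphic \<Gamma> (Gamma_graph n n))"

lemma eigenvalue_adj_matrix_iff:
  assumes "vertex_enumeration \<Gamma> vs"
  shows "eigenvalue (adj_matrix \<Gamma> vs) k \<longleftrightarrow>
    (\<exists>x. (\<exists>v\<in>verts \<Gamma>. x v \<noteq> 0) \<and> (\<forall>v\<in>verts \<Gamma>. (\<Sum>w\<in>verts \<Gamma>. adj_entry \<Gamma> v w * x w) = k * x v))"
    (is "?L \<longleftrightarrow> ?R")
proof
  let ?n = "length vs"
  have d: "distinct vs" and s: "set vs = verts \<Gamma>"
    using assms by (auto simp: vertex_enumeration_def)
  have bij: "bij_betw (\<lambda>i. vs ! i) {0..<?n} (verts \<Gamma>)"
    using bij_betw_nth[OF d refl s[symmetric]] by (simp add: atLeast0LessThan)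
  have mv: "(adj_matrix \<Gamma> vs *\<^sub>v y) $ i = (\<Sum>j = 0..<?n. adj_entry \<Gamma> (vs ! i) (vs ! j) * y $ j)"
    if "y \<in> carrier_vec ?n" "i < ?n" for y i
    using that by (auto simp: adj_matrix_def scalar_prod_def)
  have re: "(\<Sum>w\<in>verts \<Gamma>. adj_entry \<Gamma> v w * x w)
      = (\<Sum>j = 0..<?n. adj_entry \<Gamma> v (vs ! j) * x (vs ! j))" for v x
    using sum.reindex_bij_betw[OF bij, of "\<lambda>w. adj_entry \<Gamma> v w * x w"] by simp
  {
    assume ?L
    then obtain y where y: "y \<in> carrier_vec ?n" "y \<noteq> 0\<^sub>v ?n" "adj_matrix \<Gamma> vs *\<^sub>v y = k \<cdot>\<^sub>v y"
      by (auto simp: eigenvalue_def eigenvector_def adj_matrix_def)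
    define x where "x v = y $ (the_inv_into {0..<?n} (\<lambda>i. vs ! i) v)" for v
    have x: "x (vs ! i) = y $ i" if "i < ?n" for i
      using the_inv_into_f_f[OF bij_betw_imp_inj_on[OF bij]] that by (simp add: x_def)
    have "\<exists>i<?n. y $ i \<noteq> 0"
      using y(1,2) by (auto simp: vec_eq_iff)
    then have "\<exists>v\<in>verts \<Gamma>. x v \<noteq> 0"
      using x s by (metis nth_mem)
    moreover have "(\<Sum>w\<in>verts \<Gamma>. adj_entry \<Gamma> v w * x w) = k * x v" if v: "v \<in> verts \<Gamma>" for v
    proof -
      obtain i where i: "i < ?n" "v = vs ! i"
        using v s by (metis in_set_conv_nth)
      have "(\<Sum>w\<in>verts \<Gamma>. adj_entry \<Gamma> v w * x w) = (adj_matrix \<Gamma> vs *\<^sub>v y) $ i"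
        using i x by (simp add: re mv[OF y(1)])
      then show ?thesis
        using i x y by simp
    qed
    ultimately show ?R by blast
  next
    assume ?R
    then obtain x where x: "\<exists>v\<in>verts \<Gamma>. x v \<noteq> 0"
      "\<And>v. v \<in> verts \<Gamma> \<Longrightarrow> (\<Sum>w\<in>verts \<Gamma>. adj_entry \<Gamma> v w * x w) = k * x v" by blast
    define y where "y = vec ?n (\<lambda>i. x (vs ! i))"
    have yc: "y \<in> carrier_vec ?n" by (simp add: y_def)
    have "y \<noteq> 0\<^sub>v ?n"
      using x(1) unfolding s[symmetric] by (auto simp: y_def vec_eq_iff in_set_conv_nth)
    moreover have "adj_matrix \<Gamma> vs *\<^sub>v y = k \<cdot>\<^sub>v y"
    proof (rule eq_vecI)
      show "dim_vec (adj_matrix \<Gamma> vs *\<^sub>v y) = dim_vec (k \<cdot>\<^sub>v y)"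
        by (simp add: adj_matrix_def y_def)
      fix i assume "i < dim_vec (k \<cdot>\<^sub>v y)"
      then have i: "i < ?n" by (simp add: y_def)
      then have "(adj_matrix \<Gamma> vs *\<^sub>v y) $ i = (\<Sum>w\<in>verts \<Gamma>. adj_entry \<Gamma> (vs ! i) w * x w)"
        by (simp add: re mv[OF yc]) (simp add: y_def)
      also have "\<dots> = k * x (vs ! i)"
        using x(2) i s by (metis nth_mem)
      finally show "(adj_matrix \<Gamma> vs *\<^sub>v y) $ i = (k \<cdot>\<^sub>v y) $ i"
        using i by (simp add: y_def)
    qed
    ultimately show ?L
      using yc by (auto simp: eigenvalue_def eigenvector_def adj_matrix_def)
  }
qed

lemma spectrum_adj_matrix_unique:
  assumes "vertex_enumeration \<Gamma> vs" "vertex_enumeration \<Gamma> ws"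
  shows "spectrum (adj_matrix \<Gamma> vs) = spectrum (adj_matrix \<Gamma> ws)"
  unfolding spectrum_def eigenvalue_adj_matrix_iff[OF assms(1), abs_def]
    eigenvalue_adj_matrix_iff[OF assms(2), abs_def] ..

lemma index_eq:
  assumes "vertex_enumeration \<Gamma> vs"
  shows "index \<Gamma> = Max (spectrum (adj_matrix \<Gamma> vs))"
  unfolding index_def
  using spectrum_adj_matrix_unique[OF someI[of "vertex_enumeration \<Gamma>", OF assms] assms] by simp

end

theory Submission
  imports Defs
begin

text \<open>
For a signed graph with adjacency matrix \<open>A\<close> let \<open>D = J - I - A\<close> be its matrix of defects: \<open>0\<close> for a
positive edge, \<open>1\<close> for a nonedge and \<open>2\<close> for a negative edge. An eigenvector \<open>x\<close> of \<open>A\<close> with entry sum 1 for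
the eigenvalue \<open>m - 1\<close> is a solution of \<open>(m I + D) x = 1\<close>, the right-hand side being the all-ones vector.
Comparing indices becomes comparing the total weights of solutions of such systems at the same \<open>m\<close>:

\<^item> Upper bounds. Switching makes an eigenvector \<open>x\<close> for the index nonnegative. If \<open>E\<close> is a symmetric
  matrix, entrywise at most \<open>D\<close>, and \<open>y \<ge> 0\<close> solves \<open>(m I + E) y = 1\<close>, then
  \<open>1 = sum x = y\<^sup>T (m I + E) x \<le> sum y\<close>
  (lemmas \<open>weight_duality\<close> and \<open>domination\<close>).
\<^item> Lower bounds. If the solution for a graph has total weight greater than 1 at \<open>m\<close>, it has total weight
  1 at some larger \<open>m\<close>, where it is an eigenvector, so the index is greater than \<open>m - 1\<close>
  (lemma \<open>sigma_index_from_test_value\<close>).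

The combinatorial part is short. After switching, an unbalanced graph still has a negative edge \<open>u u'\<close>.
It lies in at most \<open>t - 1\<close> negative triangles, and a vertex that does not form one with it has a defect
at \<open>u\<close> or at \<open>u'\<close>. So the graph is dominated by a graph \<open>Sigma_graph s _ r\<close> with
\<open>s + r \<ge> k = n - 1 - t\<close>, in which \<open>u u'\<close> is the only negative edge, \<open>r\<close> vertices are not adjacent to
\<open>u\<close>, \<open>s\<close> vertices are not adjacent to \<open>u'\<close>, and there are no other nonedges. Its weights are explicit and
their sum is \<open>(n - 2 + gain m s r) / m\<close>.
For given \<open>s + r\<close> the gain decreases in \<open>s r\<close>. Hence the best pair is \<open>(0, k)\<close>, the excluded graph,
and the next ones are \<open>(0, k + 1)\<close> and \<open>(1, k - 1)\<close>. Which of these two wins depends on whether \<open>m\<close>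
lies below or above a value close to \<open>2 k + 2\<close> (lemmas \<open>gain_crossover_lower\<close> and
\<open>gain_crossover_upper\<close>), that is, on whether \<open>n \<le> 2 k + 2\<close>, which means \<open>2 t \<le> n\<close>. For \<open>k \<le> 1\<close>
the pair \<open>(1, k - 1)\<close> is either meaningless or isomorphic to the excluded one.

A graph dominated only by the excluded graph, but different from it, has one more defect somewhere. Wherever it
is, it costs more than one more nonedge at \<open>u\<close>, or the graph is dominated by another pair as well
(lemma \<open>one_hub_saturated\<close>). Finally, equality in the bound makes \<open>x\<close> equal to the weights, which are
positive, and so the two matrices agree (lemma \<open>obeys_tight\<close>). The exception is \<open>t = 3\<close> with \<open>m = n - 1\<close>,
where the weight of \<open>u\<close> is zero and the number of negative triangles at \<open>u\<close> decides
(lemma \<open>pendant_limit\<close>).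
\<close>

section \<open>Weights and gains\<close>

text \<open>
Let \<open>u\<close>, \<open>u'\<close> be the ends of the negative edge of a graph of the family \<open>Sigma\<close>, with
\<open>r\<close> vertices nonadjacent to \<open>u\<close> and \<open>s\<close> vertices nonadjacent to \<open>u'\<close>. In the solution of
\<open>(m I + D) y = 1\<close> the nonneighbours of \<open>u\<close> have weight \<open>(1 - y u) / m\<close> and those of \<open>u'\<close> have
weight \<open>(1 - y u') / m\<close>; eliminating them leaves a system of two linear equations with the
solution \<open>y u = hub m s r\<close> and \<open>y u' = hub m r s\<close>.
\<close>

definition hub :: "real \<Rightarrow> real \<Rightarrow> real \<Rightarrow> real" where
  "hub m s r = ((m - r) * (m^2 - s) - 2 * m * (m - s)) / ((m^2 - r) * (m^2 - s) - 4 * m^2)"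

text \<open>
The total weight of that solution is \<open>(n - 2 + gain m s r) / m\<close>, so at a given \<open>m\<close> and order \<open>n\<close>
the graphs are ordered by their gains.
\<close>

definition gain :: "real \<Rightarrow> real \<Rightarrow> real \<Rightarrow> real" where
  "gain m s r = (m - r) * hub m s r + (m - s) * hub m r s"

text \<open>
The positive lower bound is \<open>m^2 (m - 2) (m + 1)\<close>, obtained by replacing \<open>s + r\<close> by its largest
value \<open>m - 2\<close>.
\<close>

lemma hub_denominator_pos:
  fixes m s r :: real
  assumes "3 \<le> m" "0 \<le> s" "0 \<le> r" "s + r + 2 \<le> m"
  shows "0 < (m^2 - r) * (m^2 - s) - 4 * m^2"
proof -
  have "0 < (m - 2) * (m + 1)" using assms by simp
  also have "\<dots> = m^2 - m - 2" by Groebner_Basis.algebra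
  also have "\<dots> \<le> m^2 - (s + r) - 4" using assms by simp
  finally have "0 < m^2 * (m^2 - (s + r) - 4) + r * s"
    using assms by (intro add_pos_nonneg mult_pos_pos) auto
  also have "\<dots> = (m^2 - r) * (m^2 - s) - 4 * m^2" by Groebner_Basis.algebra
  finally show ?thesis .
qed

lemma hub_equation:
  assumes "3 \<le> m" "0 \<le> s" "0 \<le> r" "s + r + 2 \<le> m"
  shows "m * hub m s r + 2 * hub m r s + r * ((1 - hub m s r) / m) = 1"
proof -
  define d where "d = (m^2 - r) * (m^2 - s) - 4 * m^2"
  have d: "d > 0" using hub_denominator_pos[OF assms] by (simp add: d_def)
  have m: "m > 0" using assms by simp
  have h1: "hub m s r = ((m - r) * (m^2 - s) - 2 * m * (m - s)) / d" by (simp add: hub_def d_def)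
  have h2: "hub m r s = ((m - s) * (m^2 - r) - 2 * m * (m - r)) / d"
    by (simp add: hub_def d_def mult.commute)
  have "(m^2 - r) * hub m s r + 2 * m * hub m r s
      = ((m^2 - r) * ((m - r) * (m^2 - s) - 2 * m * (m - s))
         + 2 * m * ((m - s) * (m^2 - r) - 2 * m * (m - r))) / d"
    by (simp add: h1 h2 add_divide_distrib)
  also have "(m^2 - r) * ((m - r) * (m^2 - s) - 2 * m * (m - s))
         + 2 * m * ((m - s) * (m^2 - r) - 2 * m * (m - r)) = (m - r) * d"
    unfolding d_def by Groebner_Basis.algebra
  finally have *: "(m^2 - r) * hub m s r + 2 * m * hub m r s = m - r" using d by simp
  have "m * hub m s r + 2 * hub m r s + r * ((1 - hub m s r) / m)
      = ((m^2 - r) * hub m s r + 2 * m * hub m r s + r) / m"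
    using m by (simp add: field_simps power2_eq_square)
  then show ?thesis using * m by simp
qed

text \<open>
The bound \<open>s + r + 2 \<le> m\<close> is sharp for \<open>s = 0\<close>: there the weight is proportional to
\<open>m - r - 2\<close>. The boundary case does occur, see the lemma \<open>pendant_limit\<close> below, and is the
reason for the separate condition for strict positivity.
\<close>

lemma hub_nonneg_pos:
  assumes "3 \<le> m" "0 \<le> s" "0 \<le> r" "s + r + 2 \<le> m"
  shows "0 \<le> hub m s r" "s + r + 2 < m \<or> 0 < s \<Longrightarrow> 0 < hub m s r"
proof -
  note d = hub_denominator_pos[OF assms]
  have sm: "s \<le> m" using assms by simp
  have mm: "m \<le> m^2" using assms by (simp add: power2_eq_square)
  have eq: "(m - r) * (m^2 - s) - 2 * m * (m - s)
      = (m - r - s - 2) * (m^2 - s) + s * (m^2 - s + 2 * m - 2)" by Groebner_Basis.algebra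
  have a: "0 \<le> (m - r - s - 2) * (m^2 - s)" using assms mm sm by (intro mult_nonneg_nonneg) auto
  have b: "0 \<le> s * (m^2 - s + 2 * m - 2)" using assms mm sm by (intro mult_nonneg_nonneg) auto
  show "0 \<le> hub m s r" unfolding hub_def eq using a b d by simp
  assume *: "s + r + 2 < m \<or> 0 < s"
  have "m * 3 \<le> m^2" using assms by (simp add: power2_eq_square)
  then have sm2: "s < m^2" using sm assms by simp
  have "0 < (m - r - s - 2) * (m^2 - s) + s * (m^2 - s + 2 * m - 2)"
  proof (cases "s = 0")
    case True
    then show ?thesis using * sm2 assms by simp
  next
    case False
    have "0 < s * (m^2 - s + 2 * m - 2)" using False assms mm sm by (intro mult_pos_pos) auto
    then show ?thesis using a by simp
  qed
  then show "0 < hub m s r" unfolding hub_def eq using d by simp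
qed

lemma hub_less_one:
  assumes "3 \<le> m" "0 \<le> s" "0 \<le> r" "s + r + 2 \<le> m"
  shows "hub m s r < 1"
proof -
  note d = hub_denominator_pos[OF assms]
  have m2: "2 * m \<le> m^2 - m" using mult_right_mono[OF assms(1), of m] assms(1)
    by (simp add: power2_eq_square)
  have "0 < 2 * m * (m - s)" using assms by simp
  moreover have "4 * m^2 \<le> (m^2 - m) * (m^2 - s)"
  proof -
    have "2 * m * (2 * m) \<le> (m^2 - m) * (m^2 - s)"
      using m2 assms by (intro mult_mono) auto
    then show ?thesis by (simp add: power2_eq_square)
  qed
  ultimately have "(m - r) * (m^2 - s) - 2 * m * (m - s) < (m^2 - r) * (m^2 - s) - 4 * m^2"
    by (simp add: algebra_simps)
  then show ?thesis unfolding hub_def using d by simp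
qed

text \<open>
The gain depends on \<open>s\<close> and \<open>r\<close> only through their sum and product. This is what makes the
family easy to compare for a fixed number of nonedges.
\<close>

lemma gain_closed_form:
  fixes m s r :: real
  defines "K \<equiv> s + r" and "P \<equiv> s * r"
  shows "gain m s r = (2 * m^4 - (2 * K + 4) * m^3 + (K^2 + 3 * K) * m^2 - P * (2 * m^2 + K))
      / (m^4 - (K + 4) * m^2 + P)"
proof -
  have d: "(m^2 - r) * (m^2 - s) - 4 * m^2 = m^4 - (K + 4) * m^2 + P"
    "(m^2 - s) * (m^2 - r) - 4 * m^2 = m^4 - (K + 4) * m^2 + P"
    unfolding K_def P_def by Groebner_Basis.algebra+
  have n: "(m - r) * ((m - r) * (m^2 - s) - 2 * m * (m - s))
      + (m - s) * ((m - s) * (m^2 - r) - 2 * m * (m - r))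
    = 2 * m^4 - (2 * K + 4) * m^3 + (K^2 + 3 * K) * m^2 - P * (2 * m^2 + K)"
    unfolding K_def P_def by Groebner_Basis.algebra
  show ?thesis
    unfolding gain_def hub_def d n[symmetric] by (simp add: add_divide_distrib)
qed

lemma gain_cong:
  assumes "s + r = s' + r'" "s * r = s' * r'"
  shows "gain m s r = gain m s' r'"
  using assms by (simp only: gain_closed_form)

lemma gain_one_sided:
  fixes m r :: real
  assumes "3 \<le> m" "0 \<le> r" "r + 2 \<le> m"
  shows "0 < m^2 - r - 4" "gain m 0 r = 1 + (m - r - 2)^2 / (m^2 - r - 4)"
    "hub m 0 r = (m - r - 2) / (m^2 - r - 4)"
proof -
  have "0 < (m - 2) * (m + 1)" using assms by simp
  also have "\<dots> = m^2 - m - 2" by Groebner_Basis.algebra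
  also have "\<dots> \<le> m^2 - r - 4" using assms by simp
  finally show d: "0 < m^2 - r - 4" .
  have m: "m^2 \<noteq> 0" using assms by simp
  have "hub m 0 r = (m^2 * (m - r - 2)) / (m^2 * (m^2 - r - 4))"
    unfolding hub_def by (simp add: algebra_simps power2_eq_square)
  then show "hub m 0 r = (m - r - 2) / (m^2 - r - 4)" using m by simp
  have "gain m 0 r = (m^2 * (2 * m^2 - (2 * r + 4) * m + r^2 + 3 * r)) / (m^2 * (m^2 - r - 4))"
    unfolding gain_closed_form
    by (simp add: algebra_simps power2_eq_square power3_eq_cube power4_eq_xxxx)
  also have "\<dots> = (2 * m^2 - (2 * r + 4) * m + r^2 + 3 * r) / (m^2 - r - 4)" using m by simp
  also have "2 * m^2 - (2 * r + 4) * m + r^2 + 3 * r = (m^2 - r - 4) + (m - r - 2)^2" by Groebner_Basis.algebra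
  finally show "gain m 0 r = 1 + (m - r - 2)^2 / (m^2 - r - 4)"
    using d by (simp add: add_divide_distrib)
qed

text \<open>
With \<open>P = s r\<close> the closed form is \<open>(\<alpha> - \<beta> P) / (\<gamma> + P)\<close> for quantities \<open>\<alpha> \<ge> 0\<close> and
\<open>\<beta>, \<gamma> > 0\<close> that are determined by \<open>m\<close> and \<open>s + r\<close>. Hence the nonedges should be
concentrated at one end of the negative edge as far as possible.
\<close>

lemma gain_decreasing_in_product:
  fixes m s r s' r' :: real
  assumes "4 \<le> m" "0 \<le> s" "0 \<le> r" "0 \<le> s'" "0 \<le> r'" "s + r + 2 \<le> m"
    and sum: "s' + r' = s + r" and prod: "s * r < s' * r'"
  shows "gain m s' r' < gain m s r"
proof -
  define K where "K = s + r"
  define \<alpha> where "\<alpha> = 2 * m^4 - (2 * K + 4) * m^3 + (K^2 + 3 * K) * m^2"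
  define \<beta> where "\<beta> = 2 * m^2 + K"
  define \<gamma> where "\<gamma> = m^4 - (K + 4) * m^2"
  have g: "gain m s r = (\<alpha> - s * r * \<beta>) / (\<gamma> + s * r)"
    "gain m s' r' = (\<alpha> - s' * r' * \<beta>) / (\<gamma> + s' * r')"
    unfolding gain_closed_form \<alpha>_def \<beta>_def \<gamma>_def K_def sum by simp_all
  have "0 < m^2 - K - 4" using gain_one_sided(1)[of m K] assms by (simp add: K_def)
  then have "0 < m^2 * (m^2 - K - 4)" using assms by (intro mult_pos_pos) auto
  also have "\<dots> = \<gamma>" unfolding \<gamma>_def by Groebner_Basis.algebra
  finally have \<gamma>: "0 < \<gamma>" .
  have "0 \<le> m^2 * ((m - K)^2 + m * (m - 4) + 3 * K)"
    using assms by (intro mult_nonneg_nonneg add_nonneg_nonneg) (auto simp: K_def)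
  also have "\<dots> = \<alpha>" unfolding \<alpha>_def by Groebner_Basis.algebra
  finally have \<alpha>: "0 \<le> \<alpha>" .
  have \<beta>: "0 < \<beta>" unfolding \<beta>_def K_def using assms by (intro add_pos_nonneg) auto
  have "0 < (s' * r' - s * r) * (\<alpha> + \<beta> * \<gamma>)"
    using prod \<alpha> \<beta> \<gamma> by (intro mult_pos_pos add_nonneg_pos) auto
  also have "\<dots> = (\<alpha> - s * r * \<beta>) * (\<gamma> + s' * r') - (\<alpha> - s' * r' * \<beta>) * (\<gamma> + s * r)" by Groebner_Basis.algebra
  finally have "(\<alpha> - s' * r' * \<beta>) * (\<gamma> + s * r) < (\<alpha> - s * r * \<beta>) * (\<gamma> + s' * r')" by simp
  moreover have "0 < \<gamma> + s * r" "0 < \<gamma> + s' * r'" using \<gamma> assms by (auto intro: add_pos_nonneg)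
  ultimately show ?thesis unfolding g by (simp add: divide_simps)
qed

lemma fraction_less:
  fixes a b c d :: real
  assumes "0 < b" "0 < d" "0 < c * b - a * d"
  shows "a / b < c / d"
  using assms by (simp add: divide_simps)

lemma gain_two_hubs_form:
  fixes m k :: real
  shows "gain m 1 (k - 1) =
    (2 * m^4 - (2 * k + 4) * m^3 + (k^2 + 3 * k) * m^2 - (k - 1) * (2 * m^2 + k)) / (m^4 - (k + 4) * m^2 + (k - 1))"
  unfolding gain_closed_form by simp

lemma gain_two_hubs_denominator_pos:
  fixes m k :: real
  assumes "3 \<le> m" "1 \<le> k" "k + 2 \<le> m"
  shows "0 < m^4 - (k + 4) * m^2 + (k - 1)"
proof -
  have "0 < m^2 * (m^2 - k - 4)" using gain_one_sided(1)[of m k] assms by (intro mult_pos_pos) auto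
  also have "\<dots> = m^4 - (k + 4) * m^2" by Groebner_Basis.algebra
  finally show ?thesis using assms by simp
qed

lemma gain_one_sided_form:
  fixes m k :: real
  assumes "3 \<le> m" "0 \<le> k" "k + 3 \<le> m"
  shows "0 < m^2 - k - 5"
    "gain m 0 (k + 1) = ((m^2 - k - 5) + (m - k - 3)^2) / (m^2 - k - 5)"
proof -
  have e: "m^2 - (k + 1) - 4 = m^2 - k - 5" "m - (k + 1) - 2 = m - k - 3" by simp_all
  show d: "0 < m^2 - k - 5" using gain_one_sided(1)[of m "k + 1"] assms unfolding e by simp
  show "gain m 0 (k + 1) = ((m^2 - k - 5) + (m - k - 3)^2) / (m^2 - k - 5)"
    using gain_one_sided(2)[of m "k + 1"] assms d unfolding e by (simp add: add_divide_distrib)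
qed

section \<open>Comparison of gains\<close>

text \<open>
Two graphs compete for the second place: \<open>k + 1\<close> nonedges, all at one end of the negative edge,
and \<open>k\<close> nonedges of which exactly one is at the other end. The second one has one edge more, but
loses the advantage of concentration. The following two lemmas show that their order changes for
\<open>m\<close> between \<open>2 k + 3/2\<close> and \<open>2 k + 2\<close>. Both are polynomial
inequalities after cross-multiplication; written in the distances to the boundary of the region,
the polynomials have positive coefficients only.
\<close>

lemma gain_crossover_upper:
  fixes m k :: real
  assumes "2 \<le> k" "2 * k + 2 \<le> m"
  shows "gain m 0 (k + 1) < gain m 1 (k - 1)"
proof -
  define a where "a = m - 2 * k - 2"
  define b where "b = k - 2"
  have nn: "0 \<le> a" "0 \<le> b" using assms by (auto simp: a_def b_def)
  have m: "m = 2 * b + 6 + a" and k: "k = b + 2" by (auto simp: a_def b_def)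
  have "0 < 920 + 1240 * b + 588 * b^2 + 116 * b^3 + 8 * b^4 + 2746 * a + 3660 * a * b
      + 1802 * a * b^2 + 392 * a * b^3 + 32 * a * b^4 + 1704 * a^2 + 1728 * a^2 * b
      + 578 * a^2 * b^2 + 64 * a^2 * b^3 + 428 * a^3 + 288 * a^3 * b + 48 * a^3 * b^2 + 48 * a^4
      + 16 * a^4 * b + 2 * a^5"
    using nn by (intro add_pos_nonneg mult_nonneg_nonneg zero_le_power) auto
  also have "\<dots> = (2 * m^4 - (2 * k + 4) * m^3 + (k^2 + 3 * k) * m^2 - (k - 1) * (2 * m^2 + k)) * (m^2 - k - 5)
      - ((m^2 - k - 5) + (m - k - 3)^2) * (m^4 - (k + 4) * m^2 + (k - 1))"
    unfolding m k by Groebner_Basis.algebra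
  finally show ?thesis
    unfolding gain_two_hubs_form
    using gain_one_sided_form[of m k] gain_two_hubs_denominator_pos[of m k] assms
    by (simp add: fraction_less)
qed

lemma gain_crossover_lower:
  fixes m k :: real
  assumes "0 \<le> k" "k + 3 \<le> m" "m \<le> 2 * k + 3/2"
  shows "gain m 1 (k - 1) < gain m 0 (k + 1)"
proof -
  define a where "a = m - k - 3"
  define c where "c = 2 * k + 3/2 - m"
  have nn: "0 \<le> a" "0 \<le> c" using assms by (auto simp: a_def c_def)
  have k: "k = a + c + 3/2" and m: "m = 2 * a + c + 9/2" by (auto simp: a_def c_def field_simps)
  have "0 < (275/16) + (4865/8) * c + (1221/2) * c^2 + 223 * c^3 + 35 * c^4 + 2 * c^5
      + (125/2) * a + 1291 * a * c + 914 * a * c^2 + 212 * a * c^3 + 16 * a * c^4 + (181/2) * a^2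
      + 960 * a^2 * c + 430 * a^2 * c^2 + 48 * a^2 * c^3 + 48 * a^3 + 296 * a^3 * c
      + 64 * a^3 * c^2 + 8 * a^4 + 32 * a^4 * c"
    using nn by (intro add_pos_nonneg mult_nonneg_nonneg zero_le_power) auto
  also have "\<dots> = ((m^2 - k - 5) + (m - k - 3)^2) * (m^4 - (k + 4) * m^2 + (k - 1))
      - (2 * m^4 - (2 * k + 4) * m^3 + (k^2 + 3 * k) * m^2 - (k - 1) * (2 * m^2 + k)) * (m^2 - k - 5)"
    unfolding m k by Groebner_Basis.algebra
  finally show ?thesis
    unfolding gain_two_hubs_form
    using gain_one_sided_form[of m k] gain_two_hubs_denominator_pos[of m k] nn k m
    by (simp add: fraction_less)
qed

text \<open>
This excludes the gap between the two crossover bounds when \<open>n \<le> 2 k + 2\<close>: a value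
\<open>m > 2 k + 3/2\<close> attained by the second competitor satisfies \<open>m \<le> n - 2 + gain m 1 (k - 1)\<close>,
which is less than \<open>2 k + 3/2\<close>.
\<close>

lemma gain_two_hubs_less_three_halves:
  fixes m k :: real
  assumes "4 \<le> k" "2 * k + 3/2 \<le> m" "m \<le> 2 * k + 2"
  shows "gain m 1 (k - 1) < 3/2"
proof -
  define a where "a = m - 2 * k - 3/2"
  define b where "b = k - 4"
  have nn: "0 \<le> a" "a \<le> 1/2" "0 \<le> b" using assms by (auto simp: a_def b_def)
  have m: "m = 2 * b + 19/2 + a" and k: "k = b + 4" by (auto simp: a_def b_def)
  have aa: "a^2 \<le> 1" using nn by (simp add: power_le_one)
  have "0 < 101247/16 + (20417/4) * b + (2975/2) * b^2 + 184 * b^3 + 8 * b^4 + (3553/2) * a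
     + 982 * a * b + a * b^2 * (166 - 2 * a) + 8 * a * b^3 + a^2 * (149/2 - 14 * a - a^2) + a^2 * b * (9 - 4 * a)"
    using nn aa by (intro add_pos_nonneg mult_nonneg_nonneg zero_le_power) auto
  also have "\<dots> = 3 * (m^4 - (k + 4) * m^2 + (k - 1))
      - (2 * m^4 - (2 * k + 4) * m^3 + (k^2 + 3 * k) * m^2 - (k - 1) * (2 * m^2 + k)) * 2"
    unfolding m k by Groebner_Basis.algebra
  finally show ?thesis
    unfolding gain_two_hubs_form
    using gain_two_hubs_denominator_pos[of m k] nn m k
    by (intro fraction_less) auto
qed

text \<open>
Starting from \<open>k\<close> nonedges at one end of the negative edge, let one further edge \<open>p q\<close> be deleted.
This and the following lemmas state that the result has a smaller gain than deleting one more edge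
at the vertex which is already incident with the nonedges. Here \<open>p\<close> and \<open>q\<close> are adjacent to all
other vertices, so their weights change from \<open>1 / m\<close> to \<open>1 / (m + 1)\<close> and no other weight changes.
\<close>

lemma gain_deleted_pair_in_T:
  fixes m k :: real
  assumes "3 \<le> m" "0 \<le> k" "k + 3 \<le> m"
  shows "gain m 0 k - 2 / (m + 1) < gain m 0 (k + 1)"
proof -
  define Q where "Q = m^2 - k - 5"
  have Q: "0 < Q" "gain m 0 (k + 1) = 1 + (m - k - 3)^2 / Q"
    using gain_one_sided_form[OF assms] by (simp_all add: Q_def add_divide_distrib)
  have g: "gain m 0 k = 1 + (m - k - 2)^2 / (Q + 1)"
    using gain_one_sided(2)[of m k] assms by (simp add: Q_def algebra_simps)
  have "(m - k - 2)^2 / (Q + 1) \<le> (m - k - 2)^2 / Q"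
    using Q(1) by (intro divide_left_mono) auto
  moreover have "(m - k - 2)^2 / Q = (m - k - 3)^2 / Q + (2 * (m - k) - 5) / Q"
    unfolding add_divide_distrib[symmetric] by (simp add: power2_eq_square algebra_simps)
  moreover have "(2 * (m - k) - 5) / Q < 2 / (m + 1)"
  proof (rule fraction_less)
    have "0 \<le> k * m" using assms by simp
    then have "0 < 3 * m + 2 * (k * m) - 5" using assms by linarith
    also have "\<dots> = 2 * Q - (2 * (m - k) - 5) * (m + 1)" unfolding Q_def by Groebner_Basis.algebra
    finally show "0 < 2 * Q - (2 * (m - k) - 5) * (m + 1)" .
  qed (use Q(1) assms in auto)
  ultimately show ?thesis unfolding Q(2) g by linarith
qed

text \<open>
Now \<open>p\<close> and \<open>q\<close> are among the \<open>k\<close> nonneighbours of \<open>u\<close>. Their weights are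
\<open>(1 - y u) / (m + 1)\<close> instead of \<open>(1 - y u) / m\<close>, so that the \<open>k\<close> nonneighbours together act
on \<open>u\<close> like \<open>k - 2 / (m + 1)\<close> of them, and \<open>gain\<close> is a formula that makes sense for this
real argument. The same deviation \<open>2 / (m + 1)\<close> appears as the loss outside the gain.
\<close>

lemma gain_deleted_pair_in_R:
  fixes m k :: real
  assumes "2 \<le> k" "k + 3 \<le> m"
  shows "gain m 0 (k - 2 / (m + 1)) - 2 / (m + 1) < gain m 0 (k + 1)"
proof -
  define K where "K = k * (m + 1) - 2"
  have m: "0 < m + 1" using assms by simp
  have k': "k - 2 / (m + 1) = K / (m + 1)" unfolding K_def using m by (simp add: field_simps)
  have "2 / (m + 1) \<le> 2" "0 \<le> 2 / (m + 1)" using assms by (simp_all add: divide_le_eq)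
  then have k'0: "0 \<le> k - 2 / (m + 1)" "k - 2 / (m + 1) \<le> k" using assms by linarith+
  define d where "d = (m^2 - 4) * (m + 1) - K"
  have e: "m^2 - K / (m + 1) - 4 = d / (m + 1)" "m - K / (m + 1) - 2 = ((m - 2) * (m + 1) - K) / (m + 1)"
    unfolding d_def using m by (simp_all add: field_simps)
  have "0 < m^2 - K / (m + 1) - 4"
    using gain_one_sided(1)[of m "K / (m + 1)"] k'0 assms unfolding k' by simp
  then have d: "0 < d" unfolding e using m by (simp add: zero_less_divide_iff)
  have sq: "(x / y)\<^sup>2 / (z / y) = x\<^sup>2 / (y * z)" if "y > 0" "z > 0" for x y z :: real
    using that by (simp add: field_simps power2_eq_square)
  have "gain m 0 (k - 2 / (m + 1)) - 2 / (m + 1)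
      = 1 + ((m - 2) * (m + 1) - K)^2 / ((m + 1) * d) - 2 / (m + 1)"
    unfolding k' using gain_one_sided(2)[of m "K / (m + 1)"] k'0 assms
    unfolding k' e sq[OF m d] by simp
  also have "\<dots> = ((m + 1) * d + ((m - 2) * (m + 1) - K)^2 - 2 * d) / ((m + 1) * d)"
  proof -
    have "2 / (m + 1) = 2 * d / ((m + 1) * d)" "1 = ((m + 1) * d) / ((m + 1) * d)" using d m by simp_all
    then show ?thesis unfolding diff_divide_distrib add_divide_distrib by simp
  qed
  finally have g: "gain m 0 (k - 2 / (m + 1)) - 2 / (m + 1)
    = ((m + 1) * d + ((m - 2) * (m + 1) - K)^2 - 2 * d) / ((m + 1) * d)" .
  define a where "a = m - k - 3"
  define b where "b = k - 2"
  have nn: "0 \<le> a" "0 \<le> b" using assms by (auto simp: a_def b_def)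
  have mk: "m = b + 5 + a" "k = b + 2" by (auto simp: a_def b_def)
  have "0 < 3024 + 3852 * b + 1860 * b^2 + 427 * b^3 + 47 * b^4 + 2 * b^5 + 2508 * a
      + 2626 * a * b + 956 * a * b^2 + 146 * a * b^3 + 8 * a * b^4 + 730 * a^2 + 619 * a^2 * b
      + 155 * a^2 * b^2 + 12 * a^2 * b^3 + 90 * a^3 + 60 * a^3 * b + 8 * a^3 * b^2 + 4 * a^4
      + 2 * a^4 * b"
    using nn by (intro add_pos_nonneg mult_nonneg_nonneg zero_le_power) auto
  also have "\<dots> = ((m^2 - k - 5) + (m - k - 3)^2) * ((m + 1) * d)
    - ((m + 1) * d + ((m - 2) * (m + 1) - K)^2 - 2 * d) * (m^2 - k - 5)"
    unfolding d_def K_def mk by Groebner_Basis.algebra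
  finally show ?thesis
    unfolding g using gain_one_sided_form[of m k] d m assms
    by (simp add: fraction_less)
qed

text \<open>
The weight of \<open>u\<close> when one of \<open>p\<close>, \<open>q\<close> is a nonneighbour of \<open>u\<close> and the other is adjacent to
all other vertices. The weight of the nonneighbour is then \<open>1 / (m + 1) - y u * m / (m^2 - 1)\<close>, which
is the expression in the next lemma.
\<close>

definition hub_deleted_TR :: "real \<Rightarrow> real \<Rightarrow> real" where
  "hub_deleted_TR m k = (m - 1) * ((m + 1) * (m - k - 1) - m) / ((m^2 - k - 3) * (m^2 - 1) - m^2)"

lemma hub_deleted_TR_props:
  fixes m k :: real
  assumes "1 \<le> k" "k + 3 \<le> m"
  defines "y \<equiv> hub_deleted_TR m k"
  shows "0 \<le> y" "y \<le> 1/2"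
    "0 \<le> 1 / (m + 1) - y * m / (m^2 - 1)" "1 / (m + 1) - y * m / (m^2 - 1) \<le> 1"
    "m * y + 2 * ((1 - 2 * y) / m) + (k - 1) * ((1 - y) / m) + (1 / (m + 1) - y * m / (m^2 - 1)) = 1"
    "(m - 1) / (m + 1) + y * (- m / (m + 1) - (k - 1) + m - 2) < gain m 0 (k + 1)"
proof -
  define D where "D = (m^2 - k - 3) * (m^2 - 1) - m^2"
  define N where "N = (m - 1) * ((m + 1) * (m - k - 1) - m)"
  have yND: "y = N / D" by (simp add: y_def hub_deleted_TR_def N_def D_def)
  have m: "4 \<le> m" using assms by simp
  have m1: "0 < m + 1" "0 < m - 1" using m by auto
  have m2: "m^2 - 1 = (m + 1) * (m - 1)" by Groebner_Basis.algebra
  define a where "a = m - k - 3"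
  define b where "b = k - 1"
  have nn: "0 \<le> a" "0 \<le> b" using assms by (auto simp: a_def b_def)
  have mk: "m = b + 4 + a" "k = b + 1" by (auto simp: a_def b_def)
  have D: "0 < D" "2 * N \<le> D"
  proof -
    have q: "m * 4 \<le> m^2" using m by (simp add: power2_eq_square)
    have "0 < (m^2 - k - 4) * (m^2 - 1) - 1"
      using mult_mono[of "2*m" "m^2-k-4" 1 "m^2-1"] q assms m by simp
    moreover have "D = (m^2 - k - 4) * (m^2 - 1) - 1" unfolding D_def by Groebner_Basis.algebra
    ultimately show "0 < D" by simp
    have "0 \<le> (m - 1) * ((m + 1) * (m^2 - k - 3 - 2 * (m - k - 1)) + 2 * m) - m^2"
    proof -
      have "m^2 - k - 3 - 2 * (m - k - 1) = (m - 1)^2 + k - 2" by Groebner_Basis.algebra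
      moreover have "9 \<le> (m - 1)^2" using power_mono[of 3 "m - 1" 2] m by simp
      ultimately have "m + 1 \<le> (m + 1) * (m^2 - k - 3 - 2 * (m - k - 1))"
        using m1 assms by (simp)
      then have "(m - 1) * (m + 1 + 2 * m) \<le> (m - 1) * ((m + 1) * (m^2 - k - 3 - 2 * (m - k - 1)) + 2 * m)"
        using m1 by (intro mult_left_mono) auto
      moreover have "(m - 1) * (m + 1 + 2 * m) - m^2 = 2 * m * (m - 1) - 1" by Groebner_Basis.algebra
      moreover have "1 \<le> 2 * m * (m - 1)" using mult_mono[of 1 "2 * m" 1 "m - 1"] m by simp
      ultimately show ?thesis by simp
    qed
    also have "\<dots> = D - 2 * N" unfolding D_def N_def by Groebner_Basis.algebra
    finally show "2 * N \<le> D" by simp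
  qed
  have "(m + 1) * 1 \<le> (m + 1) * (m - k - 1)" using m1 assms by (intro mult_left_mono) auto
  then have "m \<le> (m + 1) * (m - k - 1)" by (rule order_trans[rotated]) simp
  then have "0 \<le> (m + 1) * (m - k - 1) - m" by (simp only: diff_ge_0_iff_ge)
  then have N: "0 \<le> N" unfolding N_def using m1 by (intro mult_nonneg_nonneg) auto
  show y0: "0 \<le> y" and y2: "y \<le> 1/2" unfolding yND using D N by (auto simp: field_simps)
  have yq: "1 / (m + 1) - y * m / (m^2 - 1) = (m - 1 - y * m) / ((m + 1) * (m - 1))"
    unfolding m2 diff_divide_distrib[of "m - 1"] using m1 by simp
  have ym: "y * m \<le> m / 2" using mult_right_mono[OF y2, of m] m by simp
  show "0 \<le> 1 / (m + 1) - y * m / (m^2 - 1)" unfolding yq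
  proof (intro divide_nonneg_nonneg mult_nonneg_nonneg)
    have "m / 2 \<le> m - 1" using m by simp
    with ym have "y * m \<le> m - 1" by (rule order_trans)
    then show "0 \<le> m - 1 - y * m" by (simp only: diff_ge_0_iff_ge)
  qed (use m in auto)
  have "1 / (m + 1) \<le> 1" using m by simp
  moreover have "0 \<le> y * m / (m^2 - 1)" unfolding m2 using y0 m by simp
  ultimately show "1 / (m + 1) - y * m / (m^2 - 1) \<le> 1" by linarith
  define i l where "i = 1 / m" and "l = 1 / ((m + 1) * (m - 1))"
  have il: "m * i = 1" "(m + 1) * (m - 1) * l = 1" using m m1 by (simp_all add: i_def l_def)
  have E: "m * y + 2 * ((1 - 2 * y) / m) + (k - 1) * ((1 - y) / m) + (1 / (m + 1) - y * m / (m^2 - 1))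
     = m * y + 2 * ((1 - 2 * y) * i) + (k - 1) * ((1 - y) * i) + (m - 1 - y * m) * l"
    unfolding yq i_def l_def by simp
  have "y * D = N" unfolding yND using D by simp
  then have "m * ((m + 1) * (m - 1)) *
    (m * y + 2 * ((1 - 2 * y) * i) + (k - 1) * ((1 - y) * i) + (m - 1 - y * m) * l - 1) = 0"
    using il unfolding D_def N_def by Groebner_Basis.algebra
  then show "m * y + 2 * ((1 - 2 * y) / m) + (k - 1) * ((1 - y) / m) + (1 / (m + 1) - y * m / (m^2 - 1)) = 1"
    unfolding E using m m1 by simp
  have "(m - 1) / (m + 1) + y * (- m / (m + 1) - (k - 1) + m - 2)
      = (m - 1) / (m + 1) + N / D * ((- m + (m - k - 1) * (m + 1)) / (m + 1))"
    unfolding yND using m1 by (simp add: field_simps)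
  also have "\<dots> = ((m - 1) * D + N * (- m + (m - k - 1) * (m + 1))) / ((m + 1) * D)"
    using m1 D by (simp add: add_divide_distrib)
  finally have eq: "(m - 1) / (m + 1) + y * (- m / (m + 1) - (k - 1) + m - 2)
    = ((m - 1) * D + N * (- m + (m - k - 1) * (m + 1))) / ((m + 1) * D)" .
  have "0 < 2200 + 4680 * b + 3908 * b^2 + 1647 * b^3 + 372 * b^4 + 43 * b^5 + 2 * b^6 + 3400 * a
      + 5980 * a * b + 3910 * a * b^2 + 1205 * a * b^3 + 177 * a * b^4 + 10 * a * b^5 + 1992 * a^2
      + 2823 * a^2 * b + 1370 * a^2 * b^2 + 277 * a^2 * b^3 + 20 * a^2 * b^4 + 560 * a^3
      + 613 * a^3 * b + 199 * a^3 * b^2 + 20 * a^3 * b^3 + 76 * a^4 + 60 * a^4 * b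
      + 10 * a^4 * b^2 + 4 * a^5 + 2 * a^5 * b"
    using nn by (intro add_pos_nonneg mult_nonneg_nonneg zero_le_power) auto
  also have "\<dots> = ((m^2 - k - 5) + (m - k - 3)^2) * ((m + 1) * D)
    - ((m - 1) * D + N * (- m + (m - k - 1) * (m + 1))) * (m^2 - k - 5)"
    unfolding D_def N_def mk by Groebner_Basis.algebra
  finally show "(m - 1) / (m + 1) + y * (- m / (m + 1) - (k - 1) + m - 2) < gain m 0 (k + 1)"
    unfolding eq using gain_one_sided_form[of m k] D m1 m assms
    by (simp add: fraction_less)
qed

text \<open>
The case that \<open>k = 1\<close> and the single nonneighbour of \<open>u\<close> is not adjacent to \<open>u'\<close> either.
The left-hand side belongs to the weights \<open>(m - 1) / d\<close> at \<open>u\<close> and \<open>u'\<close> and \<open>m / d\<close> at the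
nonneighbour, for \<open>d = m^2 + 2 m - 2\<close>.
\<close>

lemma gain_deleted_pair_at_second_hub:
  fixes m :: real
  assumes "5 \<le> m"
  shows "m * (3 * m - 2) / (m^2 + 2 * m - 2) - 1 < gain m 0 2"
proof -
  have q: "25 \<le> m^2" using power_mono[of 5 m 2] assms by simp
  have "gain m 0 2 = ((m^2 - 6) + (m - 4)^2) / (m^2 - 6)"
    using gain_one_sided[of m 2] assms by (simp add: add_divide_distrib)
  moreover have "m * (3 * m - 2) / (m^2 + 2 * m - 2) - 1
     = (m * (3 * m - 2) - (m^2 + 2 * m - 2)) / (m^2 + 2 * m - 2)"
    using q assms by (simp add: diff_divide_distrib)
  moreover have "(m * (3 * m - 2) - (m^2 + 2 * m - 2)) / (m^2 + 2 * m - 2) < ((m^2 - 6) + (m - 4)^2) / (m^2 - 6)"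
  proof (rule fraction_less)
    have "0 < 12 * m - 8" using assms by simp
    also have "\<dots> = ((m^2 - 6) + (m - 4)^2) * (m^2 + 2 * m - 2)
        - (m * (3 * m - 2) - (m^2 + 2 * m - 2)) * (m^2 - 6)" by Groebner_Basis.algebra
    finally show "0 < ((m^2 - 6) + (m - 4)^2) * (m^2 + 2 * m - 2)
        - (m * (3 * m - 2) - (m^2 + 2 * m - 2)) * (m^2 - 6)" .
  qed (use q assms in auto)
  ultimately show ?thesis by simp
qed

section \<open>Adjacency entries, eigenvalues and switching\<close>

lemma vertex_enumeration_exists:
  assumes "signed_graph \<Gamma>"
  obtains vs where "vertex_enumeration \<Gamma> vs"
  using assms finite_distinct_list[of "verts \<Gamma>"]
  unfolding signed_graph_def vertex_enumeration_def by auto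

lemma adj_entry_sym: "adj_entry \<Gamma> v w = adj_entry \<Gamma> w v"
  unfolding adj_entry_def by (simp add: insert_commute)

lemma adj_entry_values:
  assumes "signed_graph \<Gamma>"
  shows "adj_entry \<Gamma> v w \<in> {-1, 0, 1}"
  using assms unfolding signed_graph_def adj_entry_def by auto

lemma adj_entry_loop:
  assumes "signed_graph \<Gamma>"
  shows "adj_entry \<Gamma> v v = 0"
  using assms unfolding signed_graph_def adj_entry_def by (auto dest!: bspec)

lemma adj_entry_nonzero_iff:
  assumes "signed_graph \<Gamma>"
  shows "adj_entry \<Gamma> v w \<noteq> 0 \<longleftrightarrow> {v, w} \<in> edges \<Gamma>"
  using assms unfolding signed_graph_def adj_entry_def by auto

text \<open>
A complex eigenvalue \<open>l\<close> exists since \<open>\<complex>\<close> is algebraically closed. It is real because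
\<open>l * |y|^2\<close> is the value of a Hermitian form, and the real and imaginary parts of a complex eigenvector
\<open>y\<close> are real solutions of the eigenvalue equation, not both zero.
\<close>

lemma symmetric_real_eigenvector:
  fixes a :: "nat \<Rightarrow> nat \<Rightarrow> real"
  assumes "0 < n" and sym: "\<And>i j. a i j = a j i"
  shows "\<exists>k x. (\<exists>i<n. x i \<noteq> 0) \<and> (\<forall>i<n. (\<Sum>j<n. a i j * x j) = k * x i)"
proof -
  define A where "A = mat n n (\<lambda>(i, j). complex_of_real (a i j))"
  have A: "A \<in> carrier_mat n n" by (simp add: A_def)
  obtain l where "eigenvalue A l" using spectrum_non_empty[OF A assms(1)] by (auto simp: spectrum_def)
  then obtain y where y: "y \<in> carrier_vec n" "y \<noteq> 0\<^sub>v n" "A *\<^sub>v y = l \<cdot>\<^sub>v y"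
    using A by (auto simp: eigenvalue_def eigenvector_def)
  have eq: "(\<Sum>j<n. of_real (a i j) * y $ j) = l * y $ i" if "i < n" for i
  proof -
    have "(A *\<^sub>v y) $ i = (\<Sum>j<n. of_real (a i j) * y $ j)"
      using that y(1) by (auto simp: A_def scalar_prod_def lessThan_atLeast0)
    then show ?thesis using that y by simp
  qed
  obtain i0 where i0: "i0 < n" "y $ i0 \<noteq> 0" using y(1,2) by (auto simp: vec_eq_iff)
  define q where "q = (\<Sum>i<n. cnj (y $ i) * (\<Sum>j<n. of_real (a i j) * y $ j))"
  define N where "N = (\<Sum>i<n. (cmod (y $ i))\<^sup>2)"
  have "q = (\<Sum>i<n. l * (cnj (y $ i) * y $ i))"
    unfolding q_def by (intro sum.cong) (auto simp: eq)
  also have "\<dots> = l * of_real N"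
    unfolding N_def by (simp add: sum_distrib_left complex_norm_square mult.commute[of "cnj z" z for z] del: of_real_power)
  finally have q: "q = l * of_real N" .
  have "cnj q = (\<Sum>i<n. \<Sum>j<n. y $ i * of_real (a i j) * cnj (y $ j))"
    unfolding q_def by (simp add: sum_distrib_left mult.assoc)
  also have "\<dots> = (\<Sum>j<n. \<Sum>i<n. y $ i * of_real (a i j) * cnj (y $ j))" by (rule sum.swap)
  also have "\<dots> = q"
    unfolding q_def sum_distrib_left
    by (intro sum.cong refl) (subst sym, simp add: mult_ac)
  finally have "cnj q = q" .
  moreover have "0 < (cmod (y $ i0))\<^sup>2" using i0 by simp
  then have "N > 0" unfolding N_def using i0
    by (intro sum_pos2[of _ i0]) auto
  ultimately have "cnj l = l" unfolding q by simp
  then have l: "l = of_real (Re l)" by (simp add: complex_eq_iff)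
  have re: "(\<Sum>j<n. a i j * Re (y $ j)) = Re l * Re (y $ i)"
    and im: "(\<Sum>j<n. a i j * Im (y $ j)) = Re l * Im (y $ i)" if "i < n" for i
  proof -
    have "(\<Sum>j<n. of_real (a i j) * y $ j) = of_real (Re l) * y $ i" using eq[OF that] l by simp
    then have "Re (\<Sum>j<n. of_real (a i j) * y $ j) = Re (of_real (Re l) * y $ i)"
      "Im (\<Sum>j<n. of_real (a i j) * y $ j) = Im (of_real (Re l) * y $ i)" by simp_all
    then show "(\<Sum>j<n. a i j * Re (y $ j)) = Re l * Re (y $ i)"
      "(\<Sum>j<n. a i j * Im (y $ j)) = Re l * Im (y $ i)" by simp_all
  qed
  have "Re (y $ i0) \<noteq> 0 \<or> Im (y $ i0) \<noteq> 0" using i0 by (auto simp: complex_eq_iff)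
  then show ?thesis
  proof
    assume "Re (y $ i0) \<noteq> 0"
    then show ?thesis using re i0 by (intro exI[of _ "Re l"] exI[of _ "\<lambda>i. Re (y $ i)"]) auto
  next
    assume "Im (y $ i0) \<noteq> 0"
    then show ?thesis using im i0 by (intro exI[of _ "Re l"] exI[of _ "\<lambda>i. Im (y $ i)"]) auto
  qed
qed

text \<open>
These two facts make the index, which is defined as a maximum, an eigenvalue and an upper bound for
all eigenvalues.
\<close>

lemma adj_matrix_spectrum:
  assumes "signed_graph \<Gamma>" "verts \<Gamma> \<noteq> {}" and vs: "vertex_enumeration \<Gamma> vs"
  shows "finite (spectrum (adj_matrix \<Gamma> vs))" "spectrum (adj_matrix \<Gamma> vs) \<noteq> {}"
proof -
  let ?n = "length vs"
  have A: "adj_matrix \<Gamma> vs \<in> carrier_mat ?n ?n" by (simp add: adj_matrix_def)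
  show "finite (spectrum (adj_matrix \<Gamma> vs))" using card_finite_spectrum(1)[OF A] .
  have d: "distinct vs" "set vs = verts \<Gamma>" using vs by (auto simp: vertex_enumeration_def)
  have "?n > 0" using d assms(2) by auto
  then obtain k x where x: "\<exists>i<?n. x i \<noteq> 0"
    "\<And>i. i < ?n \<Longrightarrow> (\<Sum>j<?n. adj_entry \<Gamma> (vs ! i) (vs ! j) * x j) = k * x i"
    using symmetric_real_eigenvector[of ?n "\<lambda>i j. adj_entry \<Gamma> (vs ! i) (vs ! j)", OF _ adj_entry_sym]
    by auto
  have "adj_matrix \<Gamma> vs *\<^sub>v vec ?n x = k \<cdot>\<^sub>v vec ?n x"
    by (rule eq_vecI) (simp_all add: adj_matrix_def scalar_prod_def x(2) lessThan_atLeast0[symmetric])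
  moreover have "vec ?n x \<noteq> 0\<^sub>v ?n" using x(1) by (auto simp: vec_eq_iff)
  ultimately have "eigenvalue (adj_matrix \<Gamma> vs) k"
    unfolding eigenvalue_def eigenvector_def by (intro exI[of _ "vec ?n x"]) (simp add: adj_matrix_def)
  then show "spectrum (adj_matrix \<Gamma> vs) \<noteq> {}" by (auto simp: spectrum_def)
qed

lemma index_eigenvector:
  assumes "signed_graph \<Gamma>" "verts \<Gamma> \<noteq> {}"
  shows "\<exists>x. (\<exists>v\<in>verts \<Gamma>. x v \<noteq> 0) \<and>
    (\<forall>v\<in>verts \<Gamma>. (\<Sum>w\<in>verts \<Gamma>. adj_entry \<Gamma> v w * x w) = index \<Gamma> * x v)"
proof -
  obtain vs where vs: "vertex_enumeration \<Gamma> vs" using vertex_enumeration_exists[OF assms(1)] .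
  have "index \<Gamma> \<in> spectrum (adj_matrix \<Gamma> vs)"
    unfolding index_eq[OF vs] using adj_matrix_spectrum[OF assms vs] by (rule Max_in)
  then show ?thesis
    using eigenvalue_adj_matrix_iff[OF vs] by (simp add: spectrum_def)
qed

lemma eigenvalue_le_index:
  assumes "signed_graph \<Gamma>" "\<exists>v\<in>verts \<Gamma>. x v \<noteq> 0"
    and "\<And>v. v \<in> verts \<Gamma> \<Longrightarrow> (\<Sum>w\<in>verts \<Gamma>. adj_entry \<Gamma> v w * x w) = k * x v"
  shows "k \<le> index \<Gamma>"
proof -
  obtain vs where vs: "vertex_enumeration \<Gamma> vs" using vertex_enumeration_exists[OF assms(1)] .
  have "k \<in> spectrum (adj_matrix \<Gamma> vs)"
    using eigenvalue_adj_matrix_iff[OF vs] assms(2,3) by (auto simp: spectrum_def)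
  moreover have "verts \<Gamma> \<noteq> {}" using assms(2) by auto
  ultimately show ?thesis
    unfolding index_eq[OF vs] using adj_matrix_spectrum[OF assms(1) _ vs] by (intro Max_ge) auto
qed

text \<open>
The diagonal of the matrix that conjugates the adjacency matrix into that of the switched graph.
\<close>

definition unit_sign :: "'a set \<Rightarrow> 'a \<Rightarrow> real" where
  "unit_sign U v = (if v \<in> U then -1 else 1)"

lemma adj_entry_switch:
  assumes "signed_graph \<Gamma>" "v \<in> verts \<Gamma>" "w \<in> verts \<Gamma>"
  shows "adj_entry (switch U \<Gamma>) v w = unit_sign U v * unit_sign U w * adj_entry \<Gamma> v w"
  using assms unfolding adj_entry_def switch_def unit_sign_def by auto

lemma switch_simps [simp]:
  "verts (switch U \<Gamma>) = verts \<Gamma>" "edges (switch U \<Gamma>) = edges \<Gamma>"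
  by (simp_all add: switch_def)

lemma switch_switch [simp]: "switch U (switch U \<Gamma>) = \<Gamma>"
proof -
  have "sign (switch U (switch U \<Gamma>)) = sign \<Gamma>" by (auto simp: switch_def fun_eq_iff)
  then show ?thesis by (simp add: switch_def)
qed

lemma signed_graph_switch: "signed_graph \<Gamma> \<Longrightarrow> signed_graph (switch U \<Gamma>)"
  unfolding signed_graph_def by (auto simp: switch_def)

text \<open>
Switching at the same set twice is the identity, so it does not matter on which side it is done.
\<close>

lemma switching_isomorphicI:
  assumes "sg_isomorphic \<Delta> (switch U \<Gamma>)" "U \<subseteq> verts \<Gamma>"
  shows "switching_isomorphic \<Gamma> \<Delta>"
proof -
  have "switching_step (switch U \<Gamma>) \<Gamma>"
    unfolding switching_step_def using assms(2) by (intro exI[of _ U]) simp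
  then show ?thesis unfolding switching_isomorphic_def using assms(1) by blast
qed

text \<open>
Switching changes signs only. The two graphs that compete for the second place are told apart
from the extremal graph by their nonedges alone.
\<close>

lemma switching_isomorphic_underlying:
  assumes "switching_isomorphic \<Gamma> \<Delta>"
  shows "\<exists>f. bij_betw f (verts \<Delta>) (verts \<Gamma>) \<and>
    (\<forall>v\<in>verts \<Delta>. \<forall>w\<in>verts \<Delta>. {v, w} \<in> edges \<Delta> \<longleftrightarrow> {f v, f w} \<in> edges \<Gamma>)"
proof -
  obtain \<Delta>' where d: "sg_isomorphic \<Delta> \<Delta>'" "switching_step\<^sup>*\<^sup>* \<Delta>' \<Gamma>"
    using assms by (auto simp: switching_isomorphic_def)
  from d(2) have "verts \<Delta>' = verts \<Gamma> \<and> edges \<Delta>' = edges \<Gamma>"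
    by (induction rule: rtranclp_induct) (auto simp: switching_step_def)
  then show ?thesis using d(1) by (auto simp: sg_isomorphic_def)
qed

lemma sg_isomorphicI:
  assumes "signed_graph \<Gamma>" "signed_graph \<Delta>" "bij_betw f (verts \<Delta>) (verts \<Gamma>)"
    and eq: "\<And>v w. v \<in> verts \<Delta> \<Longrightarrow> w \<in> verts \<Delta> \<Longrightarrow> adj_entry \<Gamma> (f v) (f w) = adj_entry \<Delta> v w"
  shows "sg_isomorphic \<Delta> \<Gamma>"
  unfolding sg_isomorphic_def
proof (intro exI[of _ f] conjI ballI impI)
  fix v w assume vw: "v \<in> verts \<Delta>" "w \<in> verts \<Delta>"
  show e: "{v, w} \<in> edges \<Delta> \<longleftrightarrow> {f v, f w} \<in> edges \<Gamma>"
    using eq[OF vw] adj_entry_nonzero_iff[OF assms(1)] adj_entry_nonzero_iff[OF assms(2)] by metis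
  assume "{v, w} \<in> edges \<Delta>"
  then show "sign \<Gamma> {f v, f w} = sign \<Delta> {v, w}"
    using eq[OF vw] e by (simp add: adj_entry_def)
qed (rule assms(3))

section \<open>Negative triangles and balance\<close>

lemma cycle_edges_triangle: "cycle_edges [p, q, r] = {{p, q}, {q, r}, {p, r}}"
proof -
  have "{i. i < (3::nat)} = {0, 1, 2}" by auto
  moreover have "cycle_edges [p, q, r] = (\<lambda>i. {[p, q, r] ! i, [p, q, r] ! (Suc i mod 3)}) ` {i. i < 3}"
    unfolding cycle_edges_def by auto
  ultimately show ?thesis by (simp add: insert_commute)
qed

text \<open>
A product of three entries in \<open>{-1, 0, 1}\<close> is \<open>-1\<close> exactly if all three are edges and an odd
number of them is negative.
\<close>

lemma negative_triangle_iff: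
  assumes "signed_graph \<Gamma>"
  shows "negative_cycle \<Gamma> [p, q, r] \<longleftrightarrow>
    distinct [p, q, r] \<and> adj_entry \<Gamma> p q * adj_entry \<Gamma> q r * adj_entry \<Gamma> p r = -1"
proof (cases "distinct [p, q, r] \<and> {{p, q}, {q, r}, {p, r}} \<subseteq> edges \<Gamma>")
  case False
  then show ?thesis
    by (auto simp: negative_cycle_def is_cycle_def cycle_edges_triangle adj_entry_def)
next
  case True
  then have d: "{p, q} \<noteq> {q, r}" "{p, q} \<noteq> {p, r}" "{q, r} \<noteq> {p, r}"
    by (auto simp: doubleton_eq_iff)
  have s: "sign \<Gamma> e = -1 \<or> sign \<Gamma> e = 1" if "e \<in> edges \<Gamma>" for e
    using assms that by (auto simp: signed_graph_def)
  have "card {e \<in> {{p, q}, {q, r}, {p, r}}. sign \<Gamma> e = -1}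
     = (\<Sum>e\<in>{{p, q}, {q, r}, {p, r}}. if sign \<Gamma> e = -1 then 1 else 0)"
    by (simp only: sum.inter_filter[symmetric] card_eq_sum finite.intros)
  also have "\<dots> = (if sign \<Gamma> {p, q} = -1 then 1 else 0) + (if sign \<Gamma> {q, r} = -1 then 1 else 0)
       + (if sign \<Gamma> {p, r} = -1 then 1 else 0)"
    using d by simp
  finally have c: "card {e \<in> {{p, q}, {q, r}, {p, r}}. sign \<Gamma> e = -1}
     = (if sign \<Gamma> {p, q} = -1 then 1 else 0) + (if sign \<Gamma> {q, r} = -1 then 1 else 0)
       + (if sign \<Gamma> {p, r} = -1 then 1 else 0)" .
  have e: "{p, q} \<in> edges \<Gamma>" "{q, r} \<in> edges \<Gamma>" "{p, r} \<in> edges \<Gamma>" using True by auto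
  have "negative_cycle \<Gamma> [p, q, r] \<longleftrightarrow> odd (card {e \<in> {{p, q}, {q, r}, {p, r}}. sign \<Gamma> e = -1})"
    unfolding negative_cycle_def is_cycle_def cycle_edges_triangle using True by simp
  also have "\<dots> \<longleftrightarrow> adj_entry \<Gamma> p q * adj_entry \<Gamma> q r * adj_entry \<Gamma> p r = -1"
    unfolding c adj_entry_def using e s[OF e(1)] s[OF e(2)] s[OF e(3)]
    by (elim disjE) simp_all
  finally show ?thesis using True by simp
qed

text \<open>
If some switching makes all edges positive, the sign of an edge is the product of the values of
\<open>s\<close> at its ends. Along a cycle every vertex occurs in two consecutive edges, so the product of the signs is
a product of squares.
\<close>

lemma balancedI:
  fixes s :: "'a \<Rightarrow> real"
  assumes "signed_graph \<Gamma>"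
    and s: "\<And>v. s v \<in> {-1, 1}"
    and nonneg: "\<And>v w. v \<in> verts \<Gamma> \<Longrightarrow> w \<in> verts \<Gamma> \<Longrightarrow> 0 \<le> s v * s w * adj_entry \<Gamma> v w"
  shows "balanced \<Gamma>"
  unfolding balanced_def
proof (intro notI, elim exE)
  fix vs assume neg: "negative_cycle \<Gamma> vs"
  define n where "n = length vs"
  define nx where "nx i = Suc i mod n" for i
  define f where "f i = {vs ! i, vs ! nx i}" for i
  have n: "3 \<le> n" and d: "distinct vs" and e: "cycle_edges vs \<subseteq> edges \<Gamma>"
    and odd: "odd (card {e \<in> cycle_edges vs. sign \<Gamma> e = -1})"
    using neg by (auto simp: negative_cycle_def is_cycle_def n_def)
  have ce: "cycle_edges vs = f ` {..<n}"
    unfolding cycle_edges_def f_def nx_def n_def by auto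
  have nx: "nx i < n" for i using n by (simp add: nx_def)
  have nxinj: "inj_on nx {..<n}"
    by (rule inj_onI) (auto simp: nx_def mod_Suc split: if_splits)
  have nxbij: "bij_betw nx {..<n} {..<n}"
    using nxinj nx by (intro bij_betw_imageI endo_inj_surj) auto
  have finj: "inj_on f {..<n}"
  proof (rule inj_onI)
    fix i j assume ij: "i \<in> {..<n}" "j \<in> {..<n}" "f i = f j"
    show "i = j"
    proof (rule ccontr)
      assume "i \<noteq> j"
      then have "vs ! i \<noteq> vs ! j" using ij d by (simp add: nth_eq_iff_index_eq n_def)
      then have "vs ! i = vs ! nx j" "vs ! nx i = vs ! j"
        using ij(3) by (auto simp: f_def doubleton_eq_iff)
      then have "i = nx j" "nx i = j"
        using ij d nx by (auto simp: nth_eq_iff_index_eq n_def)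
      then show False using ij n by (auto simp: nx_def mod_Suc split: if_splits)
    qed
  qed
  have fe: "f i \<in> edges \<Gamma>" if "i < n" for i using e ce that by auto
  have sg: "of_int (sign \<Gamma> (f i)) = s (vs ! i) * s (vs ! nx i)" if "i < n" for i
  proof -
    have "vs ! i \<in> verts \<Gamma>" "vs ! nx i \<in> verts \<Gamma>"
      using fe[OF that] assms(1) by (auto simp: signed_graph_def f_def)
    then have "0 \<le> s (vs ! i) * s (vs ! nx i) * of_int (sign \<Gamma> (f i))"
      using nonneg[of "vs ! i" "vs ! nx i"] fe[OF that] by (simp add: adj_entry_def f_def)
    moreover have "sign \<Gamma> (f i) \<in> {-1, 1}" using fe[OF that] assms(1) by (auto simp: signed_graph_def)
    ultimately show ?thesis using s[of "vs ! i"] s[of "vs ! nx i"] by auto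
  qed
  have "(\<Prod>i<n. real_of_int (sign \<Gamma> (f i))) = (\<Prod>i<n. s (vs ! i)) * (\<Prod>i<n. s (vs ! nx i))"
    by (simp add: sg prod.distrib)
  also have "(\<Prod>i<n. s (vs ! nx i)) = (\<Prod>i<n. s (vs ! i))"
    using prod.reindex_bij_betw[OF nxbij, of "\<lambda>i. s (vs ! i)"] .
  also have "(\<Prod>i<n. s (vs ! i)) * (\<Prod>i<n. s (vs ! i)) = (\<Prod>i<n. s (vs ! i) * s (vs ! i))"
    by (simp add: prod.distrib)
  also have "\<dots> = 1"
  proof -
    have "s v * s v = 1" for v using s[of v] by auto
    then show ?thesis by simp
  qed
  finally have one: "(\<Prod>i<n. real_of_int (sign \<Gamma> (f i))) = 1" .
  define I where "I = {i \<in> {..<n}. sign \<Gamma> (f i) = -1}"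
  have "(\<Prod>i<n. real_of_int (sign \<Gamma> (f i))) = (\<Prod>i<n. if i \<in> I then -1 else 1)"
    using fe assms(1) by (intro prod.cong) (auto simp: I_def signed_graph_def)
  also have "\<dots> = (\<Prod>i\<in>I. -1)"
    by (simp add: prod.If_cases I_def Int_def) 
  also have "\<dots> = (-1) ^ card I" by simp
  finally have "even (card I)" using one by (metis neg_one_odd_power one_neq_neg_one)
  moreover have "{e \<in> cycle_edges vs. sign \<Gamma> e = -1} = f ` I" unfolding ce I_def by auto
  moreover have "card (f ` I) = card I"
    by (rule card_image) (rule inj_on_subset[OF finj], auto simp: I_def)
  ultimately show False using odd by simp
qed

section \<open>Defect matrices and their weights\<close>

text \<open>
The matrix \<open>J - I - A\<close> of a graph whose only negative edge is \<open>u u'\<close> and whose nonedges join \<open>u\<close> to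
\<open>R\<close> and \<open>u'\<close> to \<open>S\<close>; on the diagonal it is zero as long as \<open>u \<noteq> u'\<close>, \<open>u \<notin> R\<close>
and \<open>u' \<notin> S\<close>.
\<close>

definition defect :: "'a \<Rightarrow> 'a \<Rightarrow> 'a set \<Rightarrow> 'a set \<Rightarrow> 'a \<Rightarrow> 'a \<Rightarrow> real" where
  "defect u u' S R v w =
    (if {v, w} = {u, u'} then 2
     else if (v = u \<and> w \<in> R) \<or> (w = u \<and> v \<in> R) \<or> (v = u' \<and> w \<in> S) \<or> (w = u' \<and> v \<in> S) then 1
     else 0)"

definition layout :: "'a set \<Rightarrow> 'a \<Rightarrow> 'a \<Rightarrow> 'a set \<Rightarrow> 'a set \<Rightarrow> bool" where
  "layout V u u' S R \<longleftrightarrow> finite V \<and> u \<in> V \<and> u' \<in> V \<and> u \<noteq> u' \<and>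
     S \<subseteq> V - {u, u'} \<and> R \<subseteq> V - {u, u'} \<and> S \<inter> R = {}"

lemma defect_sym: "defect u u' S R v w = defect u u' S R w v"
  unfolding defect_def by (auto simp: insert_commute)

lemma defect_nonneg: "0 \<le> defect u u' S R v w"
  unfolding defect_def by simp

lemma layout_sum:
  fixes y :: "'a \<Rightarrow> real"
  assumes "layout V u u' S R"
  shows "sum y V = y u + y u' + sum y S + sum y R + sum y (V - ({u, u'} \<union> S \<union> R))"
proof -
  have f: "finite V" "finite S" "finite R"
    using assms by (auto simp: layout_def intro: finite_subset)
  have "V = ({u, u'} \<union> S \<union> R) \<union> (V - ({u, u'} \<union> S \<union> R))"
    using assms by (auto simp: layout_def)
  then have "sum y V = sum y ({u, u'} \<union> S \<union> R) + sum y (V - ({u, u'} \<union> S \<union> R))"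
    using f by (metis Diff_disjoint finite_Diff finite.emptyI finite.insertI finite_UnI sum.union_disjoint)
  also have "sum y ({u, u'} \<union> S \<union> R) = sum y ({u, u'} \<union> S) + sum y R"
    using f assms by (intro sum.union_disjoint) (auto simp: layout_def)
  also have "sum y ({u, u'} \<union> S) = sum y {u, u'} + sum y S"
    using f assms by (intro sum.union_disjoint) (auto simp: layout_def)
  also have "sum y {u, u'} = y u + y u'" using assms by (auto simp: layout_def)
  finally show ?thesis .
qed

lemma layout_card:
  assumes "layout V u u' S R"
  shows "card V = 2 + card S + card R + card (V - ({u, u'} \<union> S \<union> R))"
proof -
  have "real (card V) = real (2 + card S + card R + card (V - ({u, u'} \<union> S \<union> R)))"
    using layout_sum[OF assms, of "\<lambda>_. 1"] by simp
  then show ?thesis by linarith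
qed

lemma layout_card_rest:
  assumes "layout V u u' S R"
  shows "real (card (V - ({u, u'} \<union> S \<union> R))) = real (card V) - 2 - real (card S) - real (card R)"
  using layout_card[OF assms] by linarith

lemma defect_sum:
  fixes y :: "'a \<Rightarrow> real"
  assumes L: "layout V u u' S R"
  shows "(\<Sum>w\<in>V. defect u u' S R v w * y w) =
    (if v = u then 2 * y u' + sum y R else if v = u' then 2 * y u + sum y S
     else if v \<in> R then y u else if v \<in> S then y u' else 0)"
proof -
  have f: "finite V" and uV: "u \<in> V" "u' \<in> V" and SR: "S \<subseteq> V" "R \<subseteq> V"
    using L by (auto simp: layout_def)
  have delta: "(\<Sum>w\<in>V. (if w = z then c else 0) * y w) = c * y z" if "z \<in> V" for z c
  proof -
    have "(\<Sum>w\<in>V. (if w = z then c else 0) * y w) = (\<Sum>w\<in>V. if w = z then c * y w else 0)"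
      by (intro sum.cong) auto
    then show ?thesis using f that by simp
  qed
  have restrict: "(\<Sum>w\<in>V. (if w \<in> B then 1 else 0) * y w) = sum y B" if "B \<subseteq> V" for B
  proof -
    have "(\<Sum>w\<in>V. (if w \<in> B then 1 else 0) * y w) = (\<Sum>w\<in>V. if w \<in> B then y w else 0)"
      by (intro sum.cong) auto
    also have "\<dots> = sum y (V \<inter> B)" using f by (simp add: sum.inter_restrict)
    finally show ?thesis using that by (simp add: Int_absorb1)
  qed
  consider (u) "v = u" | (u') "v = u'" "v \<noteq> u" | (R) "v \<in> R" | (S) "v \<in> S"
    | (T) "v \<noteq> u" "v \<noteq> u'" "v \<notin> R" "v \<notin> S" by blast
  then show ?thesis
  proof cases
    case u
    then have "(\<Sum>w\<in>V. defect u u' S R v w * y w)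
        = (\<Sum>w\<in>V. (if w = u' then 2 else 0) * y w + (if w \<in> R then 1 else 0) * y w)"
      using L by (intro sum.cong) (auto simp: defect_def layout_def doubleton_eq_iff)
    then show ?thesis using u uV SR by (simp add: sum.distrib delta restrict)
  next
    case u'
    then have "(\<Sum>w\<in>V. defect u u' S R v w * y w)
        = (\<Sum>w\<in>V. (if w = u then 2 else 0) * y w + (if w \<in> S then 1 else 0) * y w)"
      using L by (intro sum.cong) (auto simp: defect_def layout_def doubleton_eq_iff)
    then show ?thesis using u' uV SR by (simp add: sum.distrib delta restrict)
  next
    case R
    then have "(\<Sum>w\<in>V. defect u u' S R v w * y w) = (\<Sum>w\<in>V. (if w = u then 1 else 0) * y w)"
      using L by (intro sum.cong) (auto simp: defect_def layout_def doubleton_eq_iff)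
    then show ?thesis using R uV L delta[OF uV(1), of 1] by (auto simp: layout_def)
  next
    case S
    then have "(\<Sum>w\<in>V. defect u u' S R v w * y w) = (\<Sum>w\<in>V. (if w = u' then 1 else 0) * y w)"
      using L by (intro sum.cong) (auto simp: defect_def layout_def doubleton_eq_iff)
    then show ?thesis using S uV L delta[OF uV(2), of 1] by (auto simp: layout_def)
  next
    case T
    then have "(\<Sum>w\<in>V. defect u u' S R v w * y w) = 0"
      by (intro sum.neutral) (auto simp: defect_def doubleton_eq_iff)
    then show ?thesis using T by simp
  qed
qed

text \<open>
The solution \<open>y\<close> of \<open>(m I + D) y = 1\<close> for the matrix \<open>D\<close> given by \<open>defect\<close>.
\<close>

definition weight :: "real \<Rightarrow> 'a \<Rightarrow> 'a \<Rightarrow> 'a set \<Rightarrow> 'a set \<Rightarrow> 'a \<Rightarrow> real" where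
  "weight m u u' S R v =
    (if v = u then hub m (card S) (card R) else if v = u' then hub m (card R) (card S)
     else if v \<in> R then (1 - hub m (card S) (card R)) / m
     else if v \<in> S then (1 - hub m (card R) (card S)) / m else 1 / m)"

lemma weight_sums:
  assumes "layout V u u' S R"
  shows "sum (weight m u u' S R) R = card R * ((1 - hub m (card S) (card R)) / m)"
    "sum (weight m u u' S R) S = card S * ((1 - hub m (card R) (card S)) / m)"
proof -
  have "sum (weight m u u' S R) R = (\<Sum>v\<in>R. (1 - hub m (card S) (card R)) / m)"
    using assms by (intro sum.cong) (auto simp: layout_def weight_def)
  then show "sum (weight m u u' S R) R = card R * ((1 - hub m (card S) (card R)) / m)" by simp
  have "sum (weight m u u' S R) S = (\<Sum>v\<in>S. (1 - hub m (card R) (card S)) / m)"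
    using assms by (intro sum.cong) (auto simp: layout_def weight_def)
  then show "sum (weight m u u' S R) S = card S * ((1 - hub m (card R) (card S)) / m)" by simp
qed

lemma weight_equation:
  assumes L: "layout V u u' S R" and m: "3 \<le> m" "real (card S) + real (card R) + 2 \<le> m"
  shows "m * weight m u u' S R v + (\<Sum>w\<in>V. defect u u' S R v w * weight m u u' S R w) = 1"
proof -
  note e1 = hub_equation[of m "card S" "card R"] and e2 = hub_equation[of m "card R" "card S"]
  have u: "u \<noteq> u'" "u \<notin> R" "u' \<notin> R" "u \<notin> S" "u' \<notin> S" "S \<inter> R = {}"
    using L by (auto simp: layout_def)
  have w: "weight m u u' S R u = hub m (card S) (card R)"
    "weight m u u' S R u' = hub m (card R) (card S)"
    using u by (auto simp: weight_def)
  have cancel: "m * (z / m) = z" for z using m by simp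
  show ?thesis
    unfolding defect_sum[OF L] weight_sums[OF L] w
    using u m e1 e2 by (auto simp: weight_def cancel)
qed

lemma weight_sum:
  assumes L: "layout V u u' S R" and m: "m \<noteq> 0"
  shows "sum (weight m u u' S R) V = (real (card V) - 2 + gain m (card S) (card R)) / m"
proof -
  have u: "u \<noteq> u'" using L by (auto simp: layout_def)
  have "sum (weight m u u' S R) (V - ({u, u'} \<union> S \<union> R)) = (\<Sum>v\<in>V - ({u, u'} \<union> S \<union> R). 1 / m)"
    by (intro sum.cong) (auto simp: weight_def)
  then have T: "sum (weight m u u' S R) (V - ({u, u'} \<union> S \<union> R)) =
      (real (card V) - 2 - card S - card R) / m"
    using layout_card[OF L] by simp
  show ?thesis
    unfolding layout_sum[OF L] T weight_sums[OF L] gain_def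
    using u m by (simp add: weight_def field_simps)
qed

lemma weight_nonneg_pos:
  assumes L: "layout V u u' S R" and m: "3 \<le> m" "real (card S) + real (card R) + 2 \<le> m"
  shows "0 \<le> weight m u u' S R v"
    "real (card S) + real (card R) + 2 < m \<or> S \<noteq> {} \<and> R \<noteq> {} \<Longrightarrow> 0 < weight m u u' S R v"
proof -
  note h1 = hub_nonneg_pos[of m "card S" "card R"] hub_less_one[of m "card S" "card R"]
  note h2 = hub_nonneg_pos[of m "card R" "card S"] hub_less_one[of m "card R" "card S"]
  have fin: "finite S" "finite R" using L by (auto simp: layout_def intro: finite_subset)
  show "0 \<le> weight m u u' S R v" using h1 h2 m by (auto simp: weight_def)
  assume "real (card S) + real (card R) + 2 < m \<or> S \<noteq> {} \<and> R \<noteq> {}"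
  then have "real (card S) + real (card R) + 2 < m \<or> 0 < real (card S) \<and> 0 < real (card R)"
    using fin by (auto simp: card_gt_0_iff)
  then show "0 < weight m u u' S R v" using h1 h2 m by (auto simp: weight_def)
qed

text \<open>
No weight exceeds \<open>1 / m\<close>, since \<open>D\<close> and the weights are nonnegative.
\<close>

lemma weight_sum_le:
  assumes L: "layout V u u' S R" and m: "3 \<le> m" "real (card S) + real (card R) + 2 \<le> m"
  shows "sum (weight m u u' S R) V \<le> card V / m"
proof -
  have "weight m u u' S R v \<le> 1 / m" for v
  proof -
    have "0 \<le> (\<Sum>w\<in>V. defect u u' S R v w * weight m u u' S R w)"
      using weight_nonneg_pos(1)[OF assms] defect_nonneg by (intro sum_nonneg mult_nonneg_nonneg) auto
    then have "m * weight m u u' S R v \<le> 1" using weight_equation[OF assms, of v] by linarith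
    then show ?thesis using m by (simp add: field_simps)
  qed
  then have "sum (weight m u u' S R) V \<le> (\<Sum>v\<in>V. 1 / m)" by (intro sum_mono)
  then show ?thesis by simp
qed

text \<open>
Pair the inequality for \<open>x\<close> with \<open>y\<close>: by symmetry
\<open>sum y \<ge> y\<^sup>T (m I + D) x = x\<^sup>T (m I + D) y = sum x\<close>. The difference of the two sides is the sum of the
slacks weighted by \<open>y\<close>, whence the second statement.
\<close>

lemma weight_duality:
  fixes x y :: "'a \<Rightarrow> real"
  assumes sym: "\<And>v w. D v w = D w v"
    and y0: "\<And>v. v \<in> V \<Longrightarrow> 0 \<le> y v"
    and y1: "\<And>v. v \<in> V \<Longrightarrow> m * y v + (\<Sum>w\<in>V. D v w * y w) = 1"
    and x1: "\<And>v. v \<in> V \<Longrightarrow> m * x v + (\<Sum>w\<in>V. D v w * x w) \<le> 1"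
    and fin: "finite V"
  shows "sum x V \<le> sum y V"
    "sum x V = sum y V \<Longrightarrow> v \<in> V \<Longrightarrow> 0 < y v \<Longrightarrow> m * x v + (\<Sum>w\<in>V. D v w * x w) = 1"
proof -
  define e where "e v = 1 - (m * x v + (\<Sum>w\<in>V. D v w * x w))" for v
  have e: "0 \<le> e v" if "v \<in> V" for v using x1[OF that] by (simp add: e_def)
  have "(\<Sum>v\<in>V. y v * (\<Sum>w\<in>V. D v w * x w)) = (\<Sum>v\<in>V. \<Sum>w\<in>V. y v * D v w * x w)"
    by (simp add: sum_distrib_left mult.assoc)
  also have "\<dots> = (\<Sum>w\<in>V. \<Sum>v\<in>V. y v * D v w * x w)" by (rule sum.swap)
  also have "\<dots> = (\<Sum>w\<in>V. x w * (\<Sum>v\<in>V. D w v * y v))"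
    by (intro sum.cong refl) (simp add: sum_distrib_left sym mult_ac)
  finally have swap: "(\<Sum>v\<in>V. y v * (\<Sum>w\<in>V. D v w * x w)) = (\<Sum>w\<in>V. x w * (\<Sum>v\<in>V. D w v * y v))" .
  have "(\<Sum>v\<in>V. y v * e v) = (\<Sum>v\<in>V. y v - m * (x v * y v) - y v * (\<Sum>w\<in>V. D v w * x w))"
    by (intro sum.cong) (auto simp: e_def algebra_simps)
  also have "\<dots> = sum y V - (\<Sum>v\<in>V. m * (x v * y v)) - (\<Sum>w\<in>V. x w * (\<Sum>v\<in>V. D w v * y v))"
    by (simp add: sum_subtractf swap)
  also have "\<dots> = sum y V - (\<Sum>v\<in>V. x v * (m * y v + (\<Sum>w\<in>V. D v w * y w)))"
    by (simp add: sum.distrib algebra_simps)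
  also have "(\<Sum>v\<in>V. x v * (m * y v + (\<Sum>w\<in>V. D v w * y w))) = sum x V"
    by (intro sum.cong) (auto simp: y1)
  finally have key: "(\<Sum>v\<in>V. y v * e v) = sum y V - sum x V" .
  have nn: "0 \<le> (\<Sum>v\<in>V. y v * e v)" using y0 e by (intro sum_nonneg mult_nonneg_nonneg) auto
  show "sum x V \<le> sum y V" using nn key by simp
  assume eq: "sum x V = sum y V" and v: "v \<in> V" "0 < y v"
  have "\<forall>v\<in>V. y v * e v = 0"
    using key eq y0 e by (subst sum_nonneg_eq_0_iff[symmetric]) (auto simp: fin)
  then have "e v = 0" using v by auto
  then show "m * x v + (\<Sum>w\<in>V. D v w * x w) = 1" by (simp add: e_def)
qed

section \<open>Graphs with a single negative edge\<close>

lemma sigma_verts: "verts (Sigma_graph s \<tau> r) = {..<s + \<tau> + r + 2}"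
  unfolding Sigma_graph_def Let_def by auto

lemma sigma_edge_iff:
  assumes "v \<in> verts (Sigma_graph s \<tau> r)" "w \<in> verts (Sigma_graph s \<tau> r)"
  shows "{v, w} \<in> edges (Sigma_graph s \<tau> r) \<longleftrightarrow>
    v \<noteq> w \<and> defect 0 1 {2..<2 + s} {2 + s + \<tau>..<2 + s + \<tau> + r} v w \<noteq> 1"
proof -
  have *: "{v, w} \<in> {{i, j} | i j. P i j} \<longleftrightarrow> P v w \<or> P w v" for P
    by (auto simp: doubleton_eq_iff)
  have **: "{v, w} \<in> {{c, i} | i. P i} \<longleftrightarrow> v = c \<and> P w \<or> w = c \<and> P v" for P c
    by (auto simp: doubleton_eq_iff)
  have v: "v < s + \<tau> + r + 2" and w: "w < s + \<tau> + r + 2" using assms by (simp_all add: sigma_verts)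
  have "v = 0 \<or> v = 1 \<or> 2 \<le> v" by linarith
  moreover have "w = 0 \<or> w = 1 \<or> 2 \<le> w" by linarith
  ultimately show ?thesis
    unfolding Sigma_graph_def Let_def sgraph.simps Un_iff * ** atLeastLessThan_iff singleton_iff
      defect_def doubleton_eq_iff
    using v w by (elim disjE) (simp_all, linarith+)
qed

lemma sigma_signed_graph: "signed_graph (Sigma_graph s \<tau> r)"
  unfolding signed_graph_def by (auto simp: Sigma_graph_def Let_def card_insert_if)

lemma sigma_layout:
  "layout (verts (Sigma_graph s \<tau> r)) 0 1 {2..<2 + s} {2 + s + \<tau>..<2 + s + \<tau> + r}"
  unfolding layout_def sigma_verts by auto

lemma sigma_adj_entry:
  assumes "v \<in> verts (Sigma_graph s \<tau> r)" "w \<in> verts (Sigma_graph s \<tau> r)"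
  shows "adj_entry (Sigma_graph s \<tau> r) v w =
    (if v = w then 0 else 1 - defect 0 1 {2..<2 + s} {2 + s + \<tau>..<2 + s + \<tau> + r} v w)"
  unfolding adj_entry_def sigma_edge_iff[OF assms]
  by (simp add: Sigma_graph_def Let_def defect_def)

text \<open>
If the solution of \<open>(m I + D) y = 1\<close> has total weight 1, then the right-hand side equals \<open>J y\<close>
and \<open>y\<close> is an eigenvector of \<open>J - I - D\<close> for the eigenvalue \<open>m - 1\<close>.
\<close>

lemma eigenvector_from_weights:
  fixes y :: "'a \<Rightarrow> real"
  assumes "finite V" "v \<in> V" "D v v = 0" "sum y V = 1" "m * y v + (\<Sum>w\<in>V. D v w * y w) = 1"
  shows "(\<Sum>w\<in>V. (if v = w then 0 else 1 - D v w) * y w) = (m - 1) * y v"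
proof -
  have "(\<Sum>w\<in>V. (if v = w then 0 else 1 - D v w) * y w)
      = (\<Sum>w\<in>V. y w - (if v = w then y w else 0) - D v w * y w)"
    using assms(3) by (intro sum.cong) (auto simp: algebra_simps)
  also have "\<dots> = 1 - y v - (\<Sum>w\<in>V. D v w * y w)"
    using assms(1,2,4) by (simp add: sum_subtractf)
  also have "\<dots> = (m - 1) * y v" using assms(5) by (simp add: algebra_simps)
  finally show ?thesis .
qed

lemma sigma_index_ge:
  assumes m: "3 \<le> m" "real s + real r + 2 \<le> m"
    and root: "real (s + \<tau> + r) + gain m s r = m"
  shows "m - 1 \<le> index (Sigma_graph s \<tau> r)"
proof -
  define V where "V = verts (Sigma_graph s \<tau> r)"
  define S where "S = {2..<2 + s}"
  define R where "R = {2 + s + \<tau>..<2 + s + \<tau> + r}"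
  note defs = S_def[symmetric] R_def[symmetric] V_def[symmetric]
  have L: "layout V 0 1 S R" using sigma_layout unfolding V_def S_def R_def .
  have c: "card S = s" "card R = r" "card V = s + \<tau> + r + 2"
    by (simp_all add: S_def R_def V_def sigma_verts)
  define y where "y = weight m 0 1 S R"
  have m': "3 \<le> m" "real (card S) + real (card R) + 2 \<le> m" using m c by simp_all
  have one: "sum y V = 1" unfolding y_def using weight_sum[OF L, of m] root m c by simp
  have eq: "m * y v + (\<Sum>w\<in>V. defect 0 1 S R v w * y w) = 1" for v
    unfolding y_def by (rule weight_equation[OF L m'])
  show ?thesis
  proof (rule eigenvalue_le_index[OF sigma_signed_graph])
    have "\<exists>v\<in>V. y v \<noteq> 0" using one by (metis sum.neutral zero_neq_one)
    then show "\<exists>v\<in>verts (Sigma_graph s \<tau> r). y v \<noteq> 0" unfolding defs .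
    fix v assume v: "v \<in> verts (Sigma_graph s \<tau> r)"
    have "(\<Sum>w\<in>V. adj_entry (Sigma_graph s \<tau> r) v w * y w)
        = (\<Sum>w\<in>V. (if v = w then 0 else 1 - defect 0 1 S R v w) * y w)"
      using v by (intro sum.cong refl) (simp add: sigma_adj_entry S_def R_def V_def)
    also have "\<dots> = (m - 1) * y v"
      using v L one eq
      by (intro eigenvector_from_weights) (auto simp: layout_def defs defect_def doubleton_eq_iff)
    finally show "(\<Sum>w\<in>verts (Sigma_graph s \<tau> r). adj_entry (Sigma_graph s \<tau> r) v w * y w) = (m - 1) * y v"
      unfolding defs .
  qed
qed

text \<open>
The total weight \<open>(n - 2 + gain m s r) / m\<close> is continuous in \<open>m\<close> and less than 1 for
\<open>m = n + 1\<close>. If it is at least 1 at \<open>m\<close>, it takes the value 1 at some point not smaller than \<open>m\<close>,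
and such a point yields an eigenvalue.
\<close>

lemma sigma_index_from_test_value:
  assumes m: "3 \<le> m" "real s + real r + 2 \<le> m"
    and test: "m \<le> real (s + \<tau> + r) + gain m s r"
  shows "m - 1 \<le> index (Sigma_graph s \<tau> r)"
    "m < real (s + \<tau> + r) + gain m s r \<Longrightarrow> m - 1 < index (Sigma_graph s \<tau> r)"
proof -
  define n where "n = s + \<tau> + r + 2"
  define f where "f x = real (s + \<tau> + r) + gain x s r - x" for x
  have bound: "real (s + \<tau> + r) + gain x s r \<le> n" if "m \<le> x" for x
  proof -
    define S where "S = {2..<2 + s}"
    define R where "R = {2 + s + \<tau>..<2 + s + \<tau> + r}"
    have L: "layout {..<n} 0 1 S R"
      using sigma_layout unfolding n_def S_def R_def sigma_verts .
    have c: "card S = s" "card R = r" by (simp_all add: S_def R_def)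
    have "(real n - 2 + gain x s r) / x \<le> n / x"
      using weight_sum[OF L, of x] weight_sum_le[OF L, of x] c m that by simp
    then show ?thesis using m that by (simp add: divide_le_cancel n_def)
  qed
  have mn: "m \<le> real n + 1" using bound[of m] test by simp
  have hi: "f (real n + 1) \<le> 0" using bound[of "real n + 1"] mn by (simp add: f_def)
  have lo: "0 \<le> f m" using test by (simp add: f_def)
  have cont: "continuous_on {m..real n + 1} f"
  proof -
    have "0 < (x^2 - r) * (x^2 - s) - 4 * x^2" "0 < (x^2 - s) * (x^2 - r) - 4 * x^2"
      if "x \<in> {m..real n + 1}" for x
      using that m hub_denominator_pos[of x s r] hub_denominator_pos[of x r s] by auto
    then have "\<forall>x\<in>{m..real n + 1}. (x^2 - r) * (x^2 - s) - 4 * x^2 \<noteq> 0"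
      "\<forall>x\<in>{m..real n + 1}. (x^2 - s) * (x^2 - r) - 4 * x^2 \<noteq> 0"
      by (metis less_irrefl)+
    then show ?thesis
      unfolding f_def gain_def hub_def by (intro continuous_intros)
  qed
  obtain x where x: "m \<le> x" "f x = 0" using IVT2'[OF hi lo mn cont] by blast
  have "x - 1 \<le> index (Sigma_graph s \<tau> r)"
    using x m by (intro sigma_index_ge) (auto simp: f_def)
  then show "m - 1 \<le> index (Sigma_graph s \<tau> r)" using x by simp
  assume "m < real (s + \<tau> + r) + gain m s r"
  then have "x \<noteq> m" using x by (auto simp: f_def)
  then show "m - 1 < index (Sigma_graph s \<tau> r)"
    using x \<open>x - 1 \<le> index (Sigma_graph s \<tau> r)\<close> by simp
qed

text \<open>
The parts \<open>S\<close>, \<open>R\<close> and the remaining vertices can be matched by arbitrary bijections, because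
the entries of the matrix depend only on the parts.
\<close>

lemma sigma_isomorphic:
  assumes G: "signed_graph \<Gamma>" and L: "layout (verts \<Gamma>) u u' S R"
    and c: "card S = s" "card R = r" "card (verts \<Gamma>) = s + \<tau> + r + 2"
    and adj: "\<And>v w. v \<in> verts \<Gamma> \<Longrightarrow> w \<in> verts \<Gamma> \<Longrightarrow> v \<noteq> w \<Longrightarrow> adj_entry \<Gamma> v w = 1 - defect u u' S R v w"
  shows "sg_isomorphic (Sigma_graph s \<tau> r) \<Gamma>"
proof -
  define V where "V = verts (Sigma_graph s \<tau> r)"
  define S' where "S' = {2..<2 + s}"
  define R' where "R' = {2 + s + \<tau>..<2 + s + \<tau> + r}"
  define T' where "T' = {2 + s..<2 + s + \<tau>}"
  define T where "T = verts \<Gamma> - ({u, u'} \<union> S \<union> R)"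
  have V: "V = {0} \<union> ({1} \<union> (S' \<union> (T' \<union> R')))"
    unfolding V_def sigma_verts S'_def T'_def R'_def by auto
  have fin: "finite S" "finite R" "finite T" using L by (auto simp: layout_def T_def intro: finite_subset)
  have cT: "card T = \<tau>" using layout_card[OF L] c by (simp add: T_def)
  obtain fS fR fT where b: "bij_betw fS S' S" "bij_betw fR R' R" "bij_betw fT T' T"
    using finite_same_card_bij[of S' S] finite_same_card_bij[of R' R] finite_same_card_bij[of T' T] fin c cT
    by (auto simp: S'_def R'_def T'_def)
  define f where "f i = (if i = 0 then u else if i = 1 then u' else if i \<in> S' then fS i
      else if i \<in> T' then fT i else fR i)" for i :: nat
  have f: "f 0 = u" "f 1 = u'" by (simp_all add: f_def)
  have bS: "bij_betw f S' S" using b(1) by (rule bij_betw_cong[THEN iffD1, rotated]) (auto simp: f_def S'_def)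
  have bT: "bij_betw f T' T" using b(3) by (rule bij_betw_cong[THEN iffD1, rotated]) (auto simp: f_def S'_def T'_def)
  have bR: "bij_betw f R' R" using b(2) by (rule bij_betw_cong[THEN iffD1, rotated]) (auto simp: f_def S'_def T'_def R'_def)
  have bij: "bij_betw f V (verts \<Gamma>)"
  proof -
    have 1: "bij_betw f (T' \<union> R') (T \<union> R)" by (rule bij_betw_combine[OF bT bR]) (auto simp: T_def)
    have 2: "bij_betw f (S' \<union> (T' \<union> R')) (S \<union> (T \<union> R))"
      using L by (intro bij_betw_combine[OF bS 1]) (auto simp: T_def layout_def)
    have 3: "bij_betw f ({1} \<union> (S' \<union> (T' \<union> R'))) ({u'} \<union> (S \<union> (T \<union> R)))"
      using L f by (intro bij_betw_combine[OF _ 2]) (auto simp: T_def layout_def bij_betw_def)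
    have 4: "bij_betw f V ({u} \<union> ({u'} \<union> (S \<union> (T \<union> R))))"
      unfolding V using L f by (intro bij_betw_combine[OF _ 3]) (auto simp: T_def layout_def bij_betw_def)
    have "{u} \<union> ({u'} \<union> (S \<union> (T \<union> R))) = verts \<Gamma>"
      using L by (auto simp: T_def layout_def)
    then show ?thesis using 4 by simp
  qed
  have inj: "f v = f w \<longleftrightarrow> v = w" if "v \<in> V" "w \<in> V" for v w
    using bij that by (auto simp: bij_betw_def inj_on_def)
  have mem: "f v \<in> S \<longleftrightarrow> v \<in> S'" "f v \<in> R \<longleftrightarrow> v \<in> R'" if "v \<in> V" for v
  proof -
    have sub: "S' \<subseteq> V" "R' \<subseteq> V" unfolding V by auto
    have "S = f ` S'" "R = f ` R'" using bS bR by (auto simp: bij_betw_def)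
    then show "f v \<in> S \<longleftrightarrow> v \<in> S'" "f v \<in> R \<longleftrightarrow> v \<in> R'" using sub that inj by (auto simp: image_iff)
  qed
  have z: "0 \<in> V" "1 \<in> V" by (auto simp: V)
  have hub0: "f v = u \<longleftrightarrow> v = 0" "f v = u' \<longleftrightarrow> v = 1" if "v \<in> V" for v
    using inj[OF that z(1)] inj[OF that z(2)] f by auto
  show ?thesis
  proof (rule sg_isomorphicI[OF G sigma_signed_graph])
    show "bij_betw f (verts (Sigma_graph s \<tau> r)) (verts \<Gamma>)" using bij unfolding V_def .
    fix v w assume vw: "v \<in> verts (Sigma_graph s \<tau> r)" "w \<in> verts (Sigma_graph s \<tau> r)"
    then have vw': "v \<in> V" "w \<in> V" by (simp_all add: V_def)
    have fv: "f v \<in> verts \<Gamma>" "f w \<in> verts \<Gamma>" using bij vw' by (auto simp: bij_betw_def)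
    show "adj_entry \<Gamma> (f v) (f w) = adj_entry (Sigma_graph s \<tau> r) v w"
    proof (cases "v = w")
      case True
      then show ?thesis using adj_entry_loop[OF G] adj_entry_loop[OF sigma_signed_graph] by simp
    next
      case False
      then have "f v \<noteq> f w" using inj vw' by simp
      then have "adj_entry \<Gamma> (f v) (f w) = 1 - defect u u' S R (f v) (f w)" using adj fv by simp
      also have "defect u u' S R (f v) (f w) = defect 0 1 S' R' v w"
        by (simp only: defect_def doubleton_eq_iff hub0[OF vw'(1)] hub0[OF vw'(2)]
            mem[OF vw'(1)] mem[OF vw'(2)])
      finally show ?thesis using False sigma_adj_entry[OF vw] by (simp add: S'_def R'_def)
    qed
  qed
qed

lemma sigma_unbalanced:
  assumes "1 \<le> \<tau>"
  shows "\<not> balanced (Sigma_graph s \<tau> r)"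
proof -
  have "negative_cycle (Sigma_graph s \<tau> r) [0, 1, 2 + s]"
    unfolding negative_triangle_iff[OF sigma_signed_graph]
    using assms by (simp add: sigma_adj_entry sigma_verts defect_def doubleton_eq_iff)
  then show ?thesis by (auto simp: balanced_def)
qed

text \<open>
A negative triangle contains the only negative edge, and its third vertex is a common neighbour of
the ends of that edge.
\<close>

lemma sigma_unbalanced_triangles:
  "unbalanced_triangles (Sigma_graph s \<tau> r) \<subseteq> (\<lambda>z. {{0, 1}, {0, z}, {1, z}}) ` {2 + s..<2 + s + \<tau>}"
proof
  fix E assume "E \<in> unbalanced_triangles (Sigma_graph s \<tau> r)"
  then obtain vs where vs: "E = cycle_edges vs" "negative_cycle (Sigma_graph s \<tau> r) vs" "length vs = 3"
    by (auto simp: unbalanced_triangles_def)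
  then obtain p q t where pq: "vs = [p, q, t]" by (auto simp: numeral_3_eq_3 length_Suc_conv)
  have neg: "distinct [p, q, t]"
    "adj_entry (Sigma_graph s \<tau> r) p q * adj_entry (Sigma_graph s \<tau> r) q t * adj_entry (Sigma_graph s \<tau> r) p t = -1"
    using vs(2) unfolding pq negative_triangle_iff[OF sigma_signed_graph] by auto
  then have e: "{p, q} \<in> edges (Sigma_graph s \<tau> r)" "{q, t} \<in> edges (Sigma_graph s \<tau> r)" "{p, t} \<in> edges (Sigma_graph s \<tau> r)"
    using adj_entry_nonzero_iff[OF sigma_signed_graph] by (metis mult_zero_left mult_zero_right zero_neq_neg_one)+
  then have v: "p \<in> verts (Sigma_graph s \<tau> r)" "q \<in> verts (Sigma_graph s \<tau> r)" "t \<in> verts (Sigma_graph s \<tau> r)"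
    using sigma_signed_graph[of s \<tau> r] unfolding signed_graph_def by auto
  have adj: "adj_entry (Sigma_graph s \<tau> r) a b = (if {a, b} = {0, 1} then -1 else 1)"
    if "{a, b} \<in> edges (Sigma_graph s \<tau> r)" for a b
    using that by (auto simp: adj_entry_def Sigma_graph_def Let_def)
  have T: "z \<in> {2 + s..<2 + s + \<tau>}"
    if "{0, z} \<in> edges (Sigma_graph s \<tau> r)" "{1, z} \<in> edges (Sigma_graph s \<tau> r)" "z \<noteq> 0" "z \<noteq> 1"
      "z \<in> verts (Sigma_graph s \<tau> r)" for z
  proof -
    have "0 \<in> verts (Sigma_graph s \<tau> r)" "1 \<in> verts (Sigma_graph s \<tau> r)" by (simp_all add: sigma_verts)
    then show ?thesis
      using sigma_edge_iff[of 0 s \<tau> r z] sigma_edge_iff[of 1 s \<tau> r z] that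
      by (simp add: sigma_verts defect_def doubleton_eq_iff split: if_splits)
  qed
  have pqt: "{p, q} = {0, 1} \<or> {q, t} = {0, 1} \<or> {p, t} = {0, 1}"
    using neg(2) adj[OF e(1)] adj[OF e(2)] adj[OF e(3)] by (auto split: if_splits)
  have ex: "E \<in> (\<lambda>z. {{0, 1}, {0, z}, {1, z}}) ` {2 + s..<2 + s + \<tau>}"
    if "{a, b} = {0, 1}" "{a, c} \<in> edges (Sigma_graph s \<tau> r)" "{b, c} \<in> edges (Sigma_graph s \<tau> r)"
      "c \<noteq> a" "c \<noteq> b" "c \<in> verts (Sigma_graph s \<tau> r)" "E = {{a, b}, {a, c}, {b, c}}" for a b c
  proof (rule image_eqI)
    have ab: "a = 0 \<and> b = 1 \<or> a = 1 \<and> b = 0" using that(1) by (simp add: doubleton_eq_iff)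
    then show "E = {{0, 1}, {0, c}, {1, c}}"
      unfolding that(7) by (elim disjE conjE) (simp_all add: insert_commute)
    show "c \<in> {2 + s..<2 + s + \<tau>}" using T[of c] ab that by auto
  qed
  have E: "E = {{p, q}, {p, t}, {q, t}}" "E = {{q, t}, {q, p}, {t, p}}" "E = {{p, t}, {p, q}, {t, q}}"
    unfolding vs(1) pq cycle_edges_triangle by (auto simp: insert_commute)
  have e': "{q, p} \<in> edges (Sigma_graph s \<tau> r)" "{t, p} \<in> edges (Sigma_graph s \<tau> r)"
    "{t, q} \<in> edges (Sigma_graph s \<tau> r)"
    using e by (simp_all add: insert_commute)
  have d: "t \<noteq> p" "t \<noteq> q" "p \<noteq> q" "p \<noteq> t" "q \<noteq> p" "q \<noteq> t" using neg(1) by auto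
  show "E \<in> (\<lambda>z. {{0, 1}, {0, z}, {1, z}}) ` {2 + s..<2 + s + \<tau>}"
    using pqt
  proof (elim disjE)
    assume "{p, q} = {0, 1}"
    then show ?thesis by (rule ex[OF _ e(3) e(2) d(1,2) v(3) E(1)])
  next
    assume "{q, t} = {0, 1}"
    then show ?thesis by (rule ex[OF _ e'(1) e'(2) d(3,4) v(1) E(2)])
  next
    assume "{p, t} = {0, 1}"
    then show ?thesis by (rule ex[OF _ e(1) e'(3) d(5,6) v(2) E(3)])
  qed
qed

lemma sigma_tC3_free:
  assumes "\<tau> < t"
  shows "tC3_free t (Sigma_graph s \<tau> r)"
  unfolding tC3_free_def
proof (intro notI, elim exE conjE)
  fix \<T> assume \<T>: "\<T> \<subseteq> unbalanced_triangles (Sigma_graph s \<tau> r)" "card \<T> = t"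
  have "card \<T> \<le> card ((\<lambda>z. {{0, 1}, {0, z}, {1, z}}) ` {2 + s..<2 + s + \<tau>})"
    using \<T>(1) sigma_unbalanced_triangles[of s \<tau> r] by (intro card_mono) auto
  also have "\<dots> \<le> \<tau>" using card_image_le[of "{2 + s..<2 + s + \<tau>}"] by simp
  finally show False using assms \<T>(2) by simp
qed

text \<open>
With its standard labelling \<open>Gamma_graph\<close> is literally the member of the other family in which
all nonedges are at one end of the negative edge.
\<close>

lemma Gamma_graph_eq_sigma:
  assumes "2 \<le> t" "t \<le> n"
  shows "Gamma_graph n t = Sigma_graph 0 (t - 2) (n - t)"
proof -
  define G where "G = Gamma_graph n t"
  define H where "H = Sigma_graph 0 (t - 2) (n - t)"
  have v: "verts G = verts H" unfolding G_def H_def sigma_verts using assms by (auto simp: Gamma_graph_def)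
  have s: "sign G = sign H" by (simp add: G_def H_def Gamma_graph_def Sigma_graph_def Let_def)
  have "edges G = edges H"
  proof (rule Set.set_eqI)
    fix e :: "nat set"
    have sgG: "e \<subseteq> verts G \<and> card e = 2" if "e \<in> edges G"
      using that assms by (auto simp: G_def Gamma_graph_def card_insert_if)
    have sgH: "e \<subseteq> verts H \<and> card e = 2" if "e \<in> edges H"
      using that sigma_signed_graph unfolding H_def signed_graph_def by blast
    have iff: "{v, w} \<in> edges G \<longleftrightarrow> {v, w} \<in> edges H" if "v \<in> verts G" "w \<in> verts G" for v w
    proof -
      have I: "{2..<2 + 0} = ({}::nat set)" "{2 + 0 + (t - 2)..<2 + 0 + (t - 2) + (n - t)} = {t..<n}"
        using assms by auto
      have "{v, w} \<in> edges H \<longleftrightarrow> v \<noteq> w \<and> defect 0 1 {} {t..<n} v w \<noteq> 1"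
        using sigma_edge_iff[of v 0 "t - 2" "n - t" w] that v unfolding H_def I by simp
      moreover have "{v, w} \<in> edges G \<longleftrightarrow> v \<noteq> w \<and> defect 0 1 {} {t..<n} v w \<noteq> 1"
      proof -
        have *: "{v, w} \<in> {{i, j} | i j. P i j} \<longleftrightarrow> P v w \<or> P w v" for P
          by (auto simp: doubleton_eq_iff)
        have **: "{v, w} \<in> {{c, i} | i. P i} \<longleftrightarrow> v = c \<and> P w \<or> w = c \<and> P v" for P c
          by (auto simp: doubleton_eq_iff)
        have vw: "v < n" "w < n" using that assms by (auto simp: G_def Gamma_graph_def)
        have "v = 0 \<or> v = 1 \<or> 2 \<le> v" by linarith
        moreover have "w = 0 \<or> w = 1 \<or> 2 \<le> w" by linarith
        ultimately show ?thesis
          unfolding G_def Gamma_graph_def sgraph.simps Un_iff * ** atLeastLessThan_iff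
            defect_def doubleton_eq_iff
          using vw assms by (elim disjE) (simp_all, linarith+)
      qed
      ultimately show ?thesis by simp
    qed
    show "e \<in> edges G \<longleftrightarrow> e \<in> edges H"
      using sgG sgH iff v by (metis card_2_iff insert_subset)
  qed
  then have "G = H" using v s by simp
  then show ?thesis by (simp add: G_def H_def)
qed

section \<open>Domination for nonnegative eigenvectors\<close>

lemma sum_constant_except_one:
  fixes y :: "'a \<Rightarrow> real"
  assumes "finite B" "p \<in> B" "\<And>v. v \<in> B \<Longrightarrow> v \<noteq> p \<Longrightarrow> y v = c"
  shows "sum y B = y p + (real (card B) - 1) * c"
proof -
  have "sum y B = y p + sum y (B - {p})" using assms by (simp add: sum.remove)
  also have "sum y (B - {p}) = (\<Sum>v\<in>B - {p}. c)" using assms by (intro sum.cong) auto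
  also have "\<dots> = (real (card B) - 1) * c"
    using assms card_gt_0_iff[of B] by (auto simp: of_nat_diff)
  finally show ?thesis .
qed

lemma sum_constant_except_two:
  fixes y :: "'a \<Rightarrow> real"
  assumes "finite B" "p \<in> B" "q \<in> B" "p \<noteq> q" "\<And>v. v \<in> B \<Longrightarrow> v \<noteq> p \<Longrightarrow> v \<noteq> q \<Longrightarrow> y v = c"
  shows "sum y B = y p + y q + (real (card B) - 2) * c"
proof -
  have "sum y B = y p + sum y (B - {p})" using assms by (simp add: sum.remove)
  also have "sum y (B - {p}) = y q + (real (card (B - {p})) - 1) * c"
    using assms by (intro sum_constant_except_one) auto
  also have "real (card (B - {p})) = real (card B) - 1"
    using assms card_gt_0_iff[of B] by (auto simp: of_nat_diff)
  finally show ?thesis by simp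
qed

text \<open>
Up to the names of the vertices, \<open>a\<close> is the adjacency matrix of the graph
\<open>Sigma_graph (card S) _ (card R)\<close>.
\<close>

definition shaped :: "'a set \<Rightarrow> ('a \<Rightarrow> 'a \<Rightarrow> real) \<Rightarrow> 'a \<Rightarrow> 'a \<Rightarrow> 'a set \<Rightarrow> 'a set \<Rightarrow> bool" where
  "shaped V a u u' S R \<longleftrightarrow> layout V u u' S R \<and>
     (\<forall>v\<in>V. \<forall>w\<in>V. v \<noteq> w \<longrightarrow> a v w = 1 - defect u u' S R v w)"

text \<open>
The situation after switching at the set of vertices where an eigenvector is negative: \<open>a\<close> is the
adjacency matrix, \<open>x\<close> a nonnegative eigenvector with entry sum 1, and \<open>m - 1\<close> its eigenvalue.
\<close>

locale nonneg_eigenvector =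
  fixes V :: "'a set" and a :: "'a \<Rightarrow> 'a \<Rightarrow> real" and x :: "'a \<Rightarrow> real" and m :: real
  assumes fin: "finite V" and card_ge: "9 \<le> card V"
    and sym: "a v w = a w v"
    and entries: "a v w \<in> {-1, 0, 1}"
    and nonneg: "v \<in> V \<Longrightarrow> 0 \<le> x v"
    and total: "sum x V = 1"
    and eigen: "v \<in> V \<Longrightarrow> (\<Sum>w\<in>V - {v}. a v w * x w) = (m - 1) * x v"
    and m_ge: "real (card V) - 1 \<le> m"
begin

definition D :: "'a \<Rightarrow> 'a \<Rightarrow> real" where
  "D v w = (if v = w then 0 else 1 - a v w)"

lemma entry_le_1: "a v w \<le> 1"
  using entries[of v w] by auto

lemma m_ge_8: "8 \<le> m"
  using m_ge card_ge by linarith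

lemma D_equation:
  assumes v: "v \<in> V"
  shows "m * x v + (\<Sum>w\<in>V. D v w * x w) = 1"
proof -
  have "(\<Sum>w\<in>V. D v w * x w) = (\<Sum>w\<in>V - {v}. D v w * x w)"
    using v fin by (simp add: sum.remove D_def)
  also have "\<dots> = (\<Sum>w\<in>V - {v}. x w - a v w * x w)"
    by (intro sum.cong) (auto simp: D_def algebra_simps)
  also have "\<dots> = sum x (V - {v}) - (m - 1) * x v"
    using eigen[OF v] by (simp add: sum_subtractf)
  also have "sum x (V - {v}) = 1 - x v" using v fin total by (simp add: sum.remove)
  finally show ?thesis by (simp add: algebra_simps)
qed

text \<open>
The central inequality. If \<open>E\<close> is entrywise at most the defect matrix \<open>D\<close>, then \<open>x\<close>
satisfies \<open>(m I + E) x \<le> 1\<close>, and \<open>weight_duality\<close> bounds its sum, which is 1, by the total weight of the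
solution for \<open>E\<close>. In the case of equality the slacks vanish, and \<open>D\<close> and \<open>E\<close> agree wherever both
vectors are positive.
\<close>

lemma domination:
  fixes y :: "'a \<Rightarrow> real"
  assumes "\<And>v w. E v w = E w v"
    and le: "\<And>v w. v \<in> V \<Longrightarrow> w \<in> V \<Longrightarrow> E v w \<le> D v w"
    and "\<And>v. v \<in> V \<Longrightarrow> 0 \<le> y v"
    and "\<And>v. v \<in> V \<Longrightarrow> m * y v + (\<Sum>w\<in>V. E v w * y w) = 1"
  shows "1 \<le> sum y V"
    "sum y V = 1 \<Longrightarrow> v \<in> V \<Longrightarrow> 0 < y v \<Longrightarrow> m * x v + (\<Sum>w\<in>V. E v w * x w) = 1"
    "sum y V = 1 \<Longrightarrow> v \<in> V \<Longrightarrow> 0 < y v \<Longrightarrow> w \<in> V \<Longrightarrow> 0 < x w \<Longrightarrow> D v w = E v w"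
proof -
  have x1: "m * x v + (\<Sum>w\<in>V. E v w * x w) \<le> 1" if "v \<in> V" for v
  proof -
    have "(\<Sum>w\<in>V. E v w * x w) \<le> (\<Sum>w\<in>V. D v w * x w)"
      using that le nonneg by (intro sum_mono mult_right_mono) auto
    then show ?thesis using D_equation[OF that] by simp
  qed
  note dual = weight_duality[of E V y m x, OF assms(1,3,4) x1 fin]
  show "1 \<le> sum y V" using dual(1) total by simp
  assume eq: "sum y V = 1" and v: "v \<in> V" "0 < y v"
  show tight: "m * x v + (\<Sum>w\<in>V. E v w * x w) = 1"
    using dual(2)[of v] eq total v by simp
  assume w: "w \<in> V" "0 < x w"
  have "(\<Sum>w\<in>V. (D v w - E v w) * x w) = 0"
    using tight D_equation[OF v(1)] by (simp add: left_diff_distrib sum_subtractf)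
  then have "\<forall>w\<in>V. (D v w - E v w) * x w = 0"
    using le[OF v(1)] nonneg fin by (subst sum_nonneg_eq_0_iff[symmetric]) auto
  then show "D v w = E v w" using w by auto
qed

text \<open>
The graph has at least the defects of the \<open>Sigma\<close> graph given by \<open>S\<close> and \<open>R\<close>.
\<close>

definition obeys :: "'a \<Rightarrow> 'a \<Rightarrow> 'a set \<Rightarrow> 'a set \<Rightarrow> bool" where
  "obeys u u' S R \<longleftrightarrow> layout V u u' S R \<and> a u u' = -1 \<and> (\<forall>w\<in>R. a u w \<le> 0) \<and> (\<forall>w\<in>S. a u' w \<le> 0)"

lemma defect_le_D:
  assumes "obeys u u' S R" "v \<in> V" "w \<in> V"
  shows "defect u u' S R v w \<le> D v w"
proof -
  consider "v = w" | "v \<noteq> w" "{v, w} = {u, u'}"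
    | "v \<noteq> w" "{v, w} \<noteq> {u, u'}" "(v = u \<and> w \<in> R) \<or> (w = u \<and> v \<in> R) \<or> (v = u' \<and> w \<in> S) \<or> (w = u' \<and> v \<in> S)"
    | "v \<noteq> w" "{v, w} \<noteq> {u, u'}" "\<not> ((v = u \<and> w \<in> R) \<or> (w = u \<and> v \<in> R) \<or> (v = u' \<and> w \<in> S) \<or> (w = u' \<and> v \<in> S))"
    by blast
  then show ?thesis
  proof cases
    case 1
    then show ?thesis using assms by (auto simp: defect_def D_def obeys_def layout_def doubleton_eq_iff)
  next
    case 2
    then have "a v w = -1" using assms(1) sym[of u u'] by (auto simp: obeys_def doubleton_eq_iff)
    then show ?thesis using 2 by (simp add: D_def defect_def)
  next
    case 3
    then have "a v w \<le> 0" using assms(1) sym[of v w] by (auto simp: obeys_def)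
    then show ?thesis using 3 by (simp add: D_def defect_def)
  next
    case 4
    then have "defect u u' S R v w = 0" unfolding defect_def by (simp only: if_False)
    then show ?thesis using entry_le_1[of v w] 4 by (simp add: D_def)
  qed
qed

lemma obeys_bound:
  assumes O: "obeys u u' S R" and small: "real (card S) + real (card R) + 2 \<le> m"
  shows "m \<le> real (card V) - 2 + gain m (card S) (card R)"
proof -
  have L: "layout V u u' S R" using O by (simp add: obeys_def)
  have m3: "3 \<le> m" using m_ge_8 by simp
  have "1 \<le> sum (weight m u u' S R) V"
    by (rule domination(1)[of "defect u u' S R"])
      (use defect_sym defect_le_D[OF O] weight_nonneg_pos(1)[OF L m3 small] weight_equation[OF L m3 small] in auto)
  then show ?thesis using weight_sum[OF L, of m] m3 by simp
qed

text \<open>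
If the bound is attained, \<open>x\<close> solves the same nonsingular linear system as the weights, so it equals
them and is positive. Then \<open>domination\<close> forces the two matrices to coincide.
\<close>

lemma obeys_tight:
  assumes O: "obeys u u' S R" and small: "real (card S) + real (card R) + 2 \<le> m"
    and strict: "real (card S) + real (card R) + 2 < m \<or> S \<noteq> {} \<and> R \<noteq> {}"
    and tight: "m = real (card V) - 2 + gain m (card S) (card R)"
  shows "shaped V a u u' S R"
proof -
  have L: "layout V u u' S R" using O by (simp add: obeys_def)
  have m3: "3 \<le> m" using m_ge_8 by simp
  define y where "y = weight m u u' S R"
  define E where "E = defect u u' S R"
  have y: "0 < y v" for v unfolding y_def using weight_nonneg_pos(2)[OF L m3 small strict] .
  have yeq: "m * y v + (\<Sum>w\<in>V. E v w * y w) = 1" for v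
    unfolding y_def E_def by (rule weight_equation[OF L m3 small])
  have one: "sum y V = 1" unfolding y_def using weight_sum[OF L, of m] tight m3 by simp
  note dom = domination[of E y, OF defect_sym[of u u' S R, folded E_def]
      defect_le_D[OF O, folded E_def] less_imp_le[OF y] yeq]
  have xeq: "m * x v + (\<Sum>w\<in>V. E v w * x w) = 1" if "v \<in> V" for v
    using dom(2)[OF _ _ one that y] by simp
  \<comment> \<open>the difference of \<open>x\<close> and the weights solves the homogeneous system\<close>
  have xy: "x v = y v" if "v \<in> V" for v
  proof -
    define z where "z v = x v - y v" for v
    have z: "m * z v + (\<Sum>w\<in>V. E v w * z w) = 0" if "v \<in> V" for v
      using xeq[OF that] yeq[of v] by (simp add: z_def algebra_simps sum_subtractf)
    have u: "u \<in> V" "u' \<in> V" "u \<noteq> u'" "S \<subseteq> V" "R \<subseteq> V" "S \<inter> R = {}" "u \<notin> S" "u \<notin> R" "u' \<notin> S" "u' \<notin> R"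
      using L by (auto simp: layout_def)
    define s r where "s = real (card S)" and "r = real (card R)"
    have zR: "m * z w = - z u" if "w \<in> R" for w
    proof -
      have "w \<noteq> u" "w \<noteq> u'" "w \<in> V" using that u by auto
      then show ?thesis
        using z[of w] that unfolding E_def defect_sum[OF L] by simp
    qed
    have zS: "m * z w = - z u'" if "w \<in> S" for w
    proof -
      have "w \<noteq> u" "w \<noteq> u'" "w \<in> V" "w \<notin> R" using that u by auto
      then show ?thesis
        using z[of w] that unfolding E_def defect_sum[OF L] by simp
    qed
    have "m * sum z R = (\<Sum>w\<in>R. - z u)" unfolding sum_distrib_left using zR by (intro sum.cong) auto
    then have sR: "m * sum z R = - r * z u" by (simp add: r_def)
    have "m * sum z S = (\<Sum>w\<in>S. - z u')" unfolding sum_distrib_left using zS by (intro sum.cong) auto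
    then have sS: "m * sum z S = - s * z u'" by (simp add: s_def)
    have e1: "m * z u + 2 * z u' + sum z R = 0"
      using z[OF u(1)] unfolding E_def defect_sum[OF L] by simp
    have e2: "m * z u' + 2 * z u + sum z S = 0"
      using z[OF u(2)] u(3) unfolding E_def defect_sum[OF L] by simp
    \<comment> \<open>\<open>z\<close> vanishes at \<open>u\<close> and \<open>u'\<close>: the determinant of this system is the denominator of \<open>hub\<close>\<close>
    have f1: "(m^2 - r) * z u + 2 * m * z u' = 0" using e1 sR by Groebner_Basis.algebra
    have f2: "(m^2 - s) * z u' + 2 * m * z u = 0" using e2 sS by Groebner_Basis.algebra
    have d: "(m^2 - r) * (m^2 - s) - 4 * m^2 \<noteq> 0"
      using hub_denominator_pos[of m s r] m3 small by (simp add: s_def r_def)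
    have "((m^2 - r) * (m^2 - s) - 4 * m^2) * z u = 0" "((m^2 - r) * (m^2 - s) - 4 * m^2) * z u' = 0"
      using f1 f2 by Groebner_Basis.algebra+
    then have uu: "z u = 0" "z u' = 0" using d by simp_all
    have "m * z v = 0"
    proof -
      consider "v = u" | "v = u'" | "v \<in> R" | "v \<in> S" | "v \<noteq> u" "v \<noteq> u'" "v \<notin> R" "v \<notin> S" by blast
      then show ?thesis
      proof cases
        case 5
        then show ?thesis using z[OF that] unfolding E_def defect_sum[OF L] by simp
      qed (use uu zR zS in auto)
    qed
    then show ?thesis using m3 by (simp add: z_def)
  qed
  show ?thesis
    unfolding shaped_def
  proof (intro conjI ballI impI)
    fix v w assume vw: "v \<in> V" "w \<in> V" "v \<noteq> w"
    have "0 < x w" using xy[OF vw(2)] y[of w] by simp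
    then have "D v w = E v w" using dom(3)[OF _ _ one vw(1) y vw(2)] by simp
    then show "a v w = 1 - defect u u' S R v w" using vw(3) by (simp add: D_def E_def)
  qed (rule L)
qed

text \<open>
The same bound for one further defect, at a pair \<open>p q\<close> which has none in the \<open>Sigma\<close>
graph. The condition on \<open>y\<close> is \<open>(m I + E) y = 1\<close>, written out for the resulting matrix \<open>E\<close>.
\<close>

lemma extra_pair_bound:
  fixes y :: "'a \<Rightarrow> real"
  assumes O: "obeys u u' {} R" and pq: "p \<in> V" "q \<in> V" "p \<noteq> q" "a p q \<le> 0"
    and free: "defect u u' {} R p q = 0"
    and y0: "\<And>v. v \<in> V \<Longrightarrow> 0 \<le> y v"
    and y1: "\<And>v. v \<in> V \<Longrightarrow> m * y v +
      (if v = u then 2 * y u' + sum y R else if v = u' then 2 * y u else if v \<in> R then y u else 0) +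
      (if v = p then y q else if v = q then y p else 0) = 1"
  shows "1 \<le> sum y V"
proof -
  have L: "layout V u u' {} R" using O by (simp add: obeys_def)
  define E where "E v w = defect u u' {} R v w + (if {v, w} = {p, q} then 1 else 0)" for v w
  have extra: "(\<Sum>w\<in>V. (if {v, w} = {p, q} then 1 else 0) * y w) = (if v = p then y q else if v = q then y p else 0)" for v
  proof -
    have "(\<Sum>w\<in>V. (if {v, w} = {p, q} then 1 else 0) * y w)
       = (\<Sum>w\<in>V. if v = p then (if w = q then y w else 0) else if v = q then (if w = p then y w else 0) else 0)"
      using pq(3) by (intro sum.cong) (auto simp: doubleton_eq_iff)
    then show ?thesis using fin pq by simp
  qed
  show ?thesis
  proof (rule domination(1)[of E])
    show "E v w = E w v" for v w unfolding E_def using defect_sym[of u u' "{}" R v w] by (simp add: insert_commute)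
    show "E v w \<le> D v w" if "v \<in> V" "w \<in> V" for v w
    proof (cases "{v, w} = {p, q}")
      case True
      then have "a v w \<le> 0" "defect u u' {} R v w = 0" "v \<noteq> w"
        using pq free sym[of p q] defect_sym[of u u' "{}" R p q] by (auto simp: doubleton_eq_iff)
      then show ?thesis using True by (simp add: E_def D_def)
    next
      case False
      then show ?thesis using defect_le_D[OF O that] by (simp add: E_def)
    qed
    show "0 \<le> y v" if "v \<in> V" for v using y0[OF that] .
    show "m * y v + (\<Sum>w\<in>V. E v w * y w) = 1" if "v \<in> V" for v
      using y1[OF that] unfolding E_def distrib_right sum.distrib extra defect_sum[OF L]
      by (simp only: empty_iff if_False sum.empty add_0_right add.assoc)
  qed
qed

lemma deleted_pair_in_T_bound:
  assumes O: "obeys u u' {} R" and small: "real (card R) + 2 \<le> m"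
    and pq: "p \<in> V - ({u, u'} \<union> R)" "q \<in> V - ({u, u'} \<union> R)" "p \<noteq> q" "a p q \<le> 0"
  shows "m \<le> real (card V) - 2 + (gain m 0 (card R) - 2 / (m + 1))"
proof -
  have L: "layout V u u' {} R" using O by (simp add: obeys_def)
  have m3: "3 \<le> m" using m_ge_8 by simp
  have small': "real (card {}) + real (card R) + 2 \<le> m" using small by simp
  define w where "w = weight m u u' {} R"
  define y where "y v = (if v = p \<or> v = q then 1 / (m + 1) else w v)" for v
  have w0: "0 \<le> w v" and w1: "m * w v + (if v = u then 2 * w u' + sum w R else if v = u' then 2 * w u else if v \<in> R then w u else 0) = 1" for v
    using weight_nonneg_pos(1)[OF L m3 small'] weight_equation[OF L m3 small', of v]
    unfolding w_def defect_sum[OF L]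
    by (simp_all only: empty_iff if_False sum.empty add_0_right)
  have yw: "y u = w u" "y u' = w u'" "sum y R = sum w R" "w p = 1 / m" "w q = 1 / m"
    using pq by (auto simp: y_def w_def weight_def intro!: sum.cong)
  have eq: "m * (1 / (m + 1)) + 1 / (m + 1) = 1" using m3 by (simp add: field_simps)
  have "1 \<le> sum y V"
  proof (rule extra_pair_bound[OF O _ _ pq(3,4)])
    show "p \<in> V" "q \<in> V" using pq by auto
    show "defect u u' {} R p q = 0" using pq by (auto simp: defect_def doubleton_eq_iff)
    show "0 \<le> y v" for v using w0 m3 by (simp add: y_def)
    show "m * y v + (if v = u then 2 * y u' + sum y R else if v = u' then 2 * y u else if v \<in> R then y u else 0) +
      (if v = p then y q else if v = q then y p else 0) = 1" for v
    proof (cases "v = p \<or> v = q")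
      case True
      then show ?thesis using pq eq by (auto simp: y_def)
    next
      case False
      then show ?thesis using w1[of v] unfolding yw(1-3) by (simp add: y_def)
    qed
  qed
  moreover have "sum y V = sum w V - 2 / m + 2 / (m + 1)"
  proof -
    have "sum (\<lambda>v. y v - w v) V = (y p - w p) + (y q - w q) + (real (card V) - 2) * 0"
      using pq fin by (intro sum_constant_except_two) (auto simp: y_def)
    then show ?thesis unfolding sum_subtractf yw by (simp add: y_def)
  qed
  moreover have "sum w V = (real (card V) - 2 + gain m 0 (card R)) / m"
    unfolding w_def using weight_sum[OF L, of m] m3 by simp
  ultimately have "1 \<le> (real (card V) - 2 + gain m 0 (card R)) / m - 2 / m + 2 / (m + 1)" by simp
  also have "\<dots> = (real (card V) - 2 + (gain m 0 (card R) - 2 / (m + 1))) / m"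
  proof -
    have "2 / (m + 1) - 2 / m = - (2 / (m + 1)) / m" using m3 by (simp add: field_simps)
    then show ?thesis by (simp add: diff_divide_distrib add_divide_distrib)
  qed
  finally show ?thesis using m3 by simp
qed

lemma deleted_pair_in_R_bound:
  assumes O: "obeys u u' {} R" and small: "real (card R) + 2 \<le> m"
    and pq: "p \<in> R" "q \<in> R" "p \<noteq> q" "a p q \<le> 0"
  shows "m \<le> real (card V) - 2 + (gain m 0 (card R - 2 / (m + 1)) - 2 / (m + 1))"
proof -
  have L: "layout V u u' {} R" using O by (simp add: obeys_def)
  have m3: "3 \<le> m" using m_ge_8 by simp
  have u: "u \<in> V" "u' \<in> V" "u \<noteq> u'" "u \<notin> R" "u' \<notin> R" "R \<subseteq> V" "finite R"
    using L fin by (auto simp: layout_def intro: finite_subset)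
  define \<kappa> where "\<kappa> = real (card R) - 2 / (m + 1)"
  have "2 \<le> card R" using pq u card_mono[of R "{p, q}"] by simp
  moreover have "2 / (m + 1) \<le> 2" "0 \<le> 2 / (m + 1)" using m3 by (simp_all add: divide_le_eq)
  ultimately have \<kappa>: "0 \<le> \<kappa>" "\<kappa> + 2 \<le> m" using small unfolding \<kappa>_def by linarith+
  \<comment> \<open>with the reciprocals as unknowns the identities below are polynomial\<close>
  define i j where "i = 1 / m" and "j = 1 / (m + 1)"
  define h h' where "h = hub m 0 \<kappa>" and "h' = hub m \<kappa> 0"
  have h: "0 \<le> h" "h < 1" "0 \<le> h'" "m * h + 2 * h' + \<kappa> * ((1 - h) / m) = 1" "m * h' + 2 * h = 1"
    using hub_nonneg_pos(1)[of m 0 \<kappa>] hub_nonneg_pos(1)[of m \<kappa> 0] hub_less_one[of m 0 \<kappa>]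
      hub_equation[of m 0 \<kappa>] hub_equation[of m \<kappa> 0] \<kappa> m3 by (simp_all add: h_def h'_def)
  define y where "y v = (if v = u then h else if v = u' then h' else if v = p \<or> v = q then (1 - h) / (m + 1)
     else if v \<in> R then (1 - h) / m else 1 / m)" for v
  have "sum y R = (1 - h) / (m + 1) + (1 - h) / (m + 1) + (real (card R) - 2) * ((1 - h) / m)"
    using pq u by (subst sum_constant_except_two[of R p q y "(1 - h) / m"]) (auto simp: y_def)
  also have "\<dots> = \<kappa> * ((1 - h) / m)"
  proof -
    have "(m + 1) * j = 1" "m * i = 1" using m3 by (simp_all add: i_def j_def)
    then have "(1 - h) * j + (1 - h) * j + (real (card R) - 2) * ((1 - h) * i)
        = (real (card R) - 2 * j) * ((1 - h) * i)" by Groebner_Basis.algebra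
    then show ?thesis by (simp add: \<kappa>_def i_def j_def)
  qed
  finally have yR: "sum y R = \<kappa> * ((1 - h) / m)" .
  have cancel: "m * (z / m) = z" "m * (z / (m + 1)) + z / (m + 1) = z" for z
  proof -
    have "m * (z / (m + 1)) + z / (m + 1) = (m + 1) * (z / (m + 1))"
      by (simp only: distrib_right mult_1_left)
    then show "m * (z / (m + 1)) + z / (m + 1) = z" using m3 by simp
  qed (use m3 in simp)
  have "1 \<le> sum y V"
  proof (rule extra_pair_bound[OF O _ _ pq(3,4)])
    show "p \<in> V" "q \<in> V" using pq u by auto
    show "defect u u' {} R p q = 0" using pq u by (auto simp: defect_def doubleton_eq_iff)
    show "0 \<le> y v" for v using h m3 by (simp add: y_def)
    show "m * y v + (if v = u then 2 * y u' + sum y R else if v = u' then 2 * y u else if v \<in> R then y u else 0) +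
      (if v = p then y q else if v = q then y p else 0) = 1" for v
      unfolding yR using u pq h m3 cancel(2)[of "1 - h"] by (auto simp: y_def cancel(1))
  qed
  also have "sum y V = h + h' + \<kappa> * ((1 - h) / m) + (real (card V) - 2 - card R) * (1 / m)"
  proof -
    have "sum y (V - ({u, u'} \<union> {} \<union> R)) = (\<Sum>v\<in>V - ({u, u'} \<union> {} \<union> R). 1 / m)"
      using pq by (intro sum.cong) (auto simp: y_def)
    also have "\<dots> = (real (card V) - 2 - card R) * (1 / m)"
      unfolding sum_constant layout_card_rest[OF L] by simp
    finally show ?thesis unfolding layout_sum[OF L, of y] yR using u by (simp add: y_def)
  qed
  also have "\<dots> = (real (card V) - 2 + (gain m 0 \<kappa> - 2 / (m + 1))) / m"
  proof -
    have "m * i = 1" "\<kappa> = real (card R) - 2 * j" using m3 by (simp_all add: i_def j_def \<kappa>_def)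
    then have "m * (h + h' + \<kappa> * ((1 - h) * i) + (real (card V) - 2 - card R) * i)
      = real (card V) - 2 + ((m - \<kappa>) * h + (m - 0) * h' - 2 * j)" by Groebner_Basis.algebra
    then have "m * (h + h' + \<kappa> * ((1 - h) / m) + (real (card V) - 2 - card R) * (1 / m))
      = real (card V) - 2 + (gain m 0 \<kappa> - 2 / (m + 1))"
      by (simp add: i_def j_def gain_def h_def[symmetric] h'_def[symmetric])
    then show ?thesis using m3 by (simp only: eq_divide_eq mult.commute[of m]) simp
  qed
  finally show ?thesis using m3 by (simp add: \<kappa>_def)
qed

lemma deleted_pair_T_R_bound:
  assumes O: "obeys u u' {} R" and small: "real (card R) + 3 \<le> m"
    and pq: "p \<in> V - ({u, u'} \<union> R)" "q \<in> R" "a p q \<le> 0"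
  shows "m < real (card V) - 2 + gain m 0 (card R + 1)"
proof -
  have L: "layout V u u' {} R" using O by (simp add: obeys_def)
  have m3: "3 \<le> m" using m_ge_8 by simp
  have u: "u \<in> V" "u' \<in> V" "u \<noteq> u'" "u \<notin> R" "u' \<notin> R" "R \<subseteq> V" "finite R"
    using L fin by (auto simp: layout_def intro: finite_subset)
  have pq': "p \<noteq> u" "p \<noteq> u'" "p \<notin> R" "p \<noteq> q" "q \<noteq> u" "q \<noteq> u'" "q \<noteq> p" using pq u by auto
  have k1: "1 \<le> card R" using pq u by (auto simp: Suc_le_eq card_gt_0_iff)
  define k where "k = real (card R)"
  define h where "h = hub_deleted_TR m k"
  define Q where "Q = 1 / (m + 1) - h * m / (m^2 - 1)"
  have k: "1 \<le> k" "k + 3 \<le> m" using k1 small by (simp_all add: k_def)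
  note H = hub_deleted_TR_props[OF k, folded h_def, folded Q_def]
  have m21: "m^2 - 1 = (m + 1) * (m - 1)" by Groebner_Basis.algebra
  have Qeq: "m * Q + h + (1 - Q) / m = 1"
  proof -
    have "Q * ((m + 1) * (m - 1)) = m - 1 - h * m"
      unfolding Q_def m21 using m3 by (simp add: left_diff_distrib)
    then have "m * (m * Q + h) + (1 - Q) = m" by Groebner_Basis.algebra
    moreover have "m * (m * Q + h + (1 - Q) / m) = m * (m * Q + h) + (1 - Q)"
      using m3 by (simp add: distrib_left)
    ultimately have "m * (m * Q + h + (1 - Q) / m) = m" by simp
    then show ?thesis using m3 by simp
  qed
  define y where "y v = (if v = u then h else if v = u' then (1 - 2 * h) / m else if v = p then (1 - Q) / m
     else if v = q then Q else if v \<in> R then (1 - h) / m else 1 / m)" for v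
  have yR: "sum y R = Q + (k - 1) * ((1 - h) / m)"
    using pq pq' u by (subst sum_constant_except_one[of R q y "(1 - h) / m"]) (auto simp: y_def k_def)
  have cancel: "m * (z / m) = z" for z using m3 by simp
  have "1 \<le> sum y V"
  proof (rule extra_pair_bound[OF O _ _ pq'(4) pq(3)])
    show "p \<in> V" "q \<in> V" using pq u by auto
    show "defect u u' {} R p q = 0" using pq pq' by (auto simp: defect_def doubleton_eq_iff)
    show "0 \<le> y v" for v using H m3 by (simp add: y_def)
    show "m * y v + (if v = u then 2 * y u' + sum y R else if v = u' then 2 * y u else if v \<in> R then y u else 0) +
      (if v = p then y q else if v = q then y p else 0) = 1" for v
      unfolding yR using u pq pq' H(5) Qeq m3 by (auto simp: y_def cancel)
  qed
  also have "sum y V = h + (1 - 2 * h) / m + (Q + (k - 1) * ((1 - h) / m)) + ((1 - Q) / m + (real (card V) - 3 - k) * (1 / m))"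
  proof -
    have "sum y (V - ({u, u'} \<union> {} \<union> R)) = y p + (real (card (V - ({u, u'} \<union> {} \<union> R))) - 1) * (1 / m)"
      using pq pq' fin by (intro sum_constant_except_one) (auto simp: y_def)
    then show ?thesis
      unfolding layout_sum[OF L, of y] yR layout_card_rest[OF L] using u pq' by (simp add: y_def k_def)
  qed
  also have "\<dots> = (real (card V) - 2 + ((m - 1) / (m + 1) + h * (- m / (m + 1) - (k - 1) + m - 2))) / m"
  proof -
    define i j N where "i = 1 / m" and "j = 1 / (m + 1)" and "N = real (card V)"
    have "(m - 1) * Q = (m - 1) * j - h * m * j"
    proof -
      have "Q = j - h * m * j / (m - 1)" unfolding Q_def m21 j_def by simp
      then have "(m - 1) * Q = (m - 1) * j - (m - 1) * (h * m * j / (m - 1))"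
        by (simp only: right_diff_distrib)
      then show ?thesis using m3 by simp
    qed
    moreover have "m * i = 1" using m3 by (simp add: i_def)
    ultimately have "m * (h + (1 - 2 * h) * i + (Q + (k - 1) * ((1 - h) * i)) + ((1 - Q) * i + (N - 3 - k) * i))
      = N - 2 + ((m - 1) * j + h * (- m * j - (k - 1) + m - 2))"
      by Groebner_Basis.algebra
    then have "m * (h + (1 - 2 * h) / m + (Q + (k - 1) * ((1 - h) / m)) + ((1 - Q) / m + (N - 3 - k) * (1 / m)))
      = N - 2 + ((m - 1) / (m + 1) + h * (- m / (m + 1) - (k - 1) + m - 2))"
      by (simp add: i_def j_def)
    then show ?thesis using m3 unfolding N_def[symmetric] by (simp only: eq_divide_eq mult.commute[of m]) simp
  qed
  finally have "m \<le> real (card V) - 2 + ((m - 1) / (m + 1) + h * (- m / (m + 1) - (k - 1) + m - 2))"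
    using m3 by simp
  also have "\<dots> < real (card V) - 2 + gain m 0 (k + 1)" using H(6) by simp
  finally show ?thesis by (simp add: k_def add.commute)
qed

lemma deleted_pair_at_second_hub_bound:
  assumes O: "obeys u u' {} {q}" and q: "a u' q \<le> 0"
  shows "m < real (card V) - 2 + gain m 0 2"
proof -
  have L: "layout V u u' {} {q}" using O by (simp add: obeys_def)
  have u: "u \<in> V" "u' \<in> V" "u \<noteq> u'" "q \<noteq> u" "q \<noteq> u'" "q \<in> V"
    using L fin by (auto simp: layout_def)
  define d where "d = m^2 + 2 * m - 2"
  have d: "0 < d" unfolding d_def using m_ge_8 power_mono[of 8 m 2] by simp
  define y where "y v = (if v = u \<or> v = u' then (m - 1) / d else if v = q then m / d else 1 / m)" for v
  have e1: "m * ((m - 1) / d) + 2 * ((m - 1) / d) + m / d = 1"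
  proof -
    have "m * (m - 1) + 2 * (m - 1) + m = d" unfolding d_def by Groebner_Basis.algebra
    then show ?thesis unfolding times_divide_eq_right add_divide_distrib[symmetric] using d by simp
  qed
  have e2: "m * (m / d) + (m - 1) / d + (m - 1) / d = 1"
  proof -
    have "m * m + (m - 1) + (m - 1) = d" unfolding d_def by Groebner_Basis.algebra
    then show ?thesis unfolding times_divide_eq_right add_divide_distrib[symmetric] using d by simp
  qed
  have "1 \<le> sum y V"
  proof (rule extra_pair_bound[OF O, of u' q])
    show "u' \<in> V" "q \<in> V" "u' \<noteq> q" "a u' q \<le> 0" using u q by auto
    show "defect u u' {} {q} u' q = 0" using u by (auto simp: defect_def doubleton_eq_iff)
    show "0 \<le> y v" for v using d m_ge_8 by (simp add: y_def)
    show "m * y v + (if v = u then 2 * y u' + sum y {q} else if v = u' then 2 * y u else if v \<in> {q} then y u else 0) +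
      (if v = u' then y q else if v = q then y u' else 0) = 1" for v
      using u e1 e2 m_ge_8 by (auto simp: y_def)
  qed
  also have "sum y V = (m - 1) / d + (m - 1) / d + m / d + (real (card V) - 3) * (1 / m)"
  proof -
    have "sum y (V - ({u, u'} \<union> {} \<union> {q})) = (\<Sum>v\<in>V - ({u, u'} \<union> {} \<union> {q}). 1 / m)"
      by (intro sum.cong) (auto simp: y_def)
    also have "\<dots> = (real (card V) - 3) * (1 / m)"
      unfolding sum_constant layout_card_rest[OF L] by simp
    finally show ?thesis unfolding layout_sum[OF L, of y] using u by (simp add: y_def)
  qed
  also have "\<dots> = (real (card V) - 2 + (m * (3 * m - 2) / d - 1)) / m"
  proof -
    have "(m - 1) / d + (m - 1) / d + m / d = (3 * m - 2) / d"
      unfolding add_divide_distrib[symmetric] by simp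
    moreover have "m * (3 * m - 2) / d / m = (3 * m - 2) / d" using m_ge_8 by simp
    moreover have "(real (card V) - 2 + (c - 1)) / m = c / m + (real (card V) - 3) * (1 / m)" for c
      unfolding times_divide_eq_right mult_1_right add_divide_distrib[symmetric] by simp
    ultimately show ?thesis by simp
  qed
  finally have "m \<le> real (card V) - 2 + (m * (3 * m - 2) / d - 1)" using m_ge_8 by simp
  also have "\<dots> < real (card V) - 2 + gain m 0 2"
    using gain_deleted_pair_at_second_hub[of m] m_ge_8 by (simp add: d_def)
  finally show ?thesis .
qed

end

section \<open>Graphs with few negative triangles\<close>

lemma (in nonneg_eigenvector) m_le_card: "m \<le> real (card V)"
proof -
  have "m * x v \<le> 1" if "v \<in> V" for v
  proof -
    have "0 \<le> (\<Sum>w\<in>V. D v w * x w)"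
      using nonneg entry_le_1 by (intro sum_nonneg mult_nonneg_nonneg) (auto simp: D_def)
    then show ?thesis using D_equation[OF that] by linarith
  qed
  then have "(\<Sum>v\<in>V. m * x v) \<le> (\<Sum>v\<in>V. 1)" by (intro sum_mono) auto
  then show ?thesis using total by (simp add: sum_distrib_left[symmetric])
qed

text \<open>
Forgetting defects enlarges the class of graphs. This allows one to shrink \<open>S\<close> and \<open>R\<close> to exactly the sizes
that are needed.
\<close>

lemma (in nonneg_eigenvector) obeys_subset:
  assumes "obeys u u' S R" "S' \<subseteq> S" "R' \<subseteq> R"
  shows "obeys u u' S' R'"
  using assms unfolding obeys_def layout_def by blast

lemma (in nonneg_eigenvector) obeys_swap:
  assumes "obeys u u' S R"
  shows "obeys u' u R S"
  using assms sym[of u u'] unfolding obeys_def layout_def by auto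

lemma defect_swap: "defect u u' S R = defect u' u R S"
  unfolding defect_def by (intro ext) (auto simp: insert_commute)

lemma (in nonneg_eigenvector) shaped_swap:
  assumes "shaped V a u u' S R"
  shows "shaped V a u' u R S"
  using assms unfolding shaped_def layout_def defect_swap[of u u'] by auto

text \<open>
The vertex set of a negative triangle. Triangles are counted by their vertex sets here, which is the
same as counting them by their edge sets.
\<close>

definition negative_triple :: "'a set \<Rightarrow> ('a \<Rightarrow> 'a \<Rightarrow> real) \<Rightarrow> 'a set \<Rightarrow> bool" where
  "negative_triple V a X \<longleftrightarrow>
    (\<exists>p q r. X = {p, q, r} \<and> distinct [p, q, r] \<and> X \<subseteq> V \<and> a p q * a q r * a p r = -1)"

lemma negative_tripleI:
  assumes "p \<noteq> q" "q \<noteq> r" "p \<noteq> r" "p \<in> V" "q \<in> V" "r \<in> V" "a p q * a q r * a p r = -1"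
  shows "negative_triple V a {p, q, r}"
proof -
  have "{p, q, r} = {p, q, r} \<and> distinct [p, q, r] \<and> {p, q, r} \<subseteq> V \<and> a p q * a q r * a p r = -1"
    using assms by simp
  then show ?thesis unfolding negative_triple_def by blast
qed

text \<open>
The hypotheses on the signed graph in terms of its matrix. The number \<open>k\<close> is the number of nonedges
of the extremal graph which is excluded by the last assumption; for \<open>t \<ge> n - 1\<close> the truncated
subtraction correctly gives \<open>0\<close>, since then the extremal graph is complete.
\<close>

locale few_negative_triangles = nonneg_eigenvector +
  fixes t k :: nat
  assumes t_ge: "3 \<le> t" and k_eq: "k = card V - 1 - t"
    and triangles: "finite F \<Longrightarrow> (\<And>X. X \<in> F \<Longrightarrow> negative_triple V a X) \<Longrightarrow> card F < t"
    and negative_edge: "\<exists>u\<in>V. \<exists>u'\<in>V. u \<noteq> u' \<and> a u u' = -1"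
    and not_extremal: "\<And>u u' R. shaped V a u u' {} R \<Longrightarrow> card R \<noteq> k"
begin

lemma k_bounds: "k + 4 \<le> card V" "real k + 3 \<le> m"
proof -
  show "k + 4 \<le> card V" using k_eq t_ge card_ge by linarith
  then show "real k + 3 \<le> m" using m_ge by linarith
qed

text \<open>
The graph has all the defects of the excluded graph, but is not equal to it. If one common neighbour \<open>z\<close>
of \<open>u\<close> and \<open>u'\<close> is joined to both by negative edges, it can be added to \<open>R\<close>. If \<open>u\<close> has
a negative edge to some \<open>w\<close> in \<open>R\<close>, the triangles \<open>u u' z\<close> already exhaust the permitted number, so not
all triangles \<open>u w z\<close> can be negative and there is a further defect between \<open>w\<close> and some \<open>z\<close>.
Otherwise the entries at \<open>u\<close> are those of the excluded graph, and there is a further defect at a pair not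
containing \<open>u\<close>; the cases are the possible positions of this pair.
\<close>

lemma one_hub_saturated:
  assumes O: "obeys u u' {} R" and cR: "card R = k"
    and T1: "\<And>z. z \<in> V - ({u, u'} \<union> R) \<Longrightarrow> a u z * a u' z = 1"
  shows "(\<exists>u u' R. obeys u u' {} R \<and> card R = k + 1) \<or>
    (2 \<le> k \<and> (\<exists>u u' S R. obeys u u' S R \<and> S \<noteq> {} \<and> R \<noteq> {} \<and> card S + card R = k)) \<or>
    m < real (card V) - 2 + gain m 0 (real k + 1)" (is "?A \<or> ?B \<or> ?C")
proof -
  have L: "layout V u u' {} R" using O by (simp add: obeys_def)
  have u: "u \<in> V" "u' \<in> V" "u \<noteq> u'" "u \<notin> R" "u' \<notin> R" "R \<subseteq> V" "finite R"
    using L fin by (auto simp: layout_def intro: finite_subset)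
  have auu: "a u u' = -1" using O by (simp add: obeys_def)
  define T where "T = V - ({u, u'} \<union> R)"
  have fT: "finite T" using fin by (simp add: T_def)
  have cT: "card T + 2 + k = card V" using layout_card[OF L] cR unfolding T_def by simp
  have m3: "3 \<le> m" using m_ge_8 by simp
  show ?thesis
  proof (cases "\<exists>z\<in>T. a u z \<noteq> 1")
    case True
    then obtain z where z: "z \<in> T" "a u z \<noteq> 1" by blast
    then have "a u z = -1" using T1[of z] entries[of u z] by (auto simp: T_def)
    then have "obeys u u' {} (insert z R)"
      using O z by (auto simp: obeys_def layout_def T_def)
    moreover have "card (insert z R) = k + 1" using z u cR by (simp add: T_def)
    ultimately show ?thesis by blast
  next
    case False
    then have Tu: "a u z = 1" "a u' z = 1" if "z \<in> T" for z
      using T1[of z] that by (auto simp: T_def)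
    show ?thesis
    proof (cases "\<exists>w\<in>R. a u w = -1")
      case True
      then obtain w where w: "w \<in> R" "a u w = -1" by blast
      have "k \<noteq> 0" using w(1) u(7) cR card_gt_0_iff[of R] by auto
      then have Tt: "card T + 1 = t" using cT k_eq t_ge by linarith
      then have "T \<noteq> {}" using t_ge by auto
      then obtain z0 where z0: "z0 \<in> T" by blast
      have wu: "w \<noteq> u" "w \<noteq> u'" "w \<in> V" "w \<notin> T" using w u by (auto simp: T_def)
      have Tv: "z \<noteq> u" "z \<noteq> u'" "z \<in> V" if "z \<in> T" for z using that by (auto simp: T_def)
      have "\<exists>z\<in>T. a z w \<le> 0"
      proof (rule ccontr)
        assume "\<not> (\<exists>z\<in>T. a z w \<le> 0)"
        then have zw: "a z w = 1" if "z \<in> T" for z using that entries[of z w] by auto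
        define F where "F = insert {u, w, z0} ((\<lambda>z. {u, u', z}) ` T)"
        have "card F < t"
        proof (rule triangles)
          show "finite F" using fT by (simp add: F_def)
          fix X assume "X \<in> F"
          then consider "X = {u, w, z0}" | z where "z \<in> T" "X = {u, u', z}" by (auto simp: F_def)
          then show "negative_triple V a X"
          proof cases
            case 1
            show ?thesis
              unfolding 1
              by (rule negative_tripleI) (use wu Tv[OF z0] u Tu[OF z0] w(2) zw[OF z0] sym[of w z0] z0 in auto)
          next
            case 2
            show ?thesis
              unfolding 2(2) by (rule negative_tripleI) (use Tv[OF 2(1)] u Tu[OF 2(1)] auu in auto)
          qed
        qed
        moreover have "card F = t"
        proof -
          have "inj_on (\<lambda>z. {u, u', z}) T"
            by (rule inj_onI, drule equalityD1) (use Tv in auto)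
          then have "card ((\<lambda>z. {u, u', z}) ` T) = card T" by (rule card_image)
          moreover have "{u, w, z0} \<notin> (\<lambda>z. {u, u', z}) ` T" using wu u Tv by auto
          ultimately show ?thesis unfolding F_def using fT Tt by simp
        qed
        ultimately show False by simp
      qed
      then obtain z where "z \<in> T" "a z w \<le> 0" by blast
      then have "m < real (card V) - 2 + gain m 0 (card R + 1)"
        using deleted_pair_T_R_bound[OF O, of z w] w k_bounds cR by (simp add: T_def)
      then show ?thesis using cR by (simp add: add.commute)
    next
      case False
      then have Ru: "a u w = 0" if "w \<in> R" for w
        using that O entries[of u w] by (force simp: obeys_def)
      have "\<not> shaped V a u u' {} R" using not_extremal cR by blast
      then obtain v w where vw: "v \<in> V" "w \<in> V" "v \<noteq> w" "a v w \<noteq> 1 - defect u u' {} R v w"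
        using L by (auto simp: shaped_def)
      have u_ok: "a u z = 1 - defect u u' {} R u z" if zV: "z \<in> V" "z \<noteq> u" for z
      proof -
        consider "z = u'" | "z \<in> R" | "z \<in> T" using zV unfolding T_def by blast
        then show ?thesis
          by cases (use auu Ru Tu u zV in \<open>auto simp: defect_def doubleton_eq_iff T_def\<close>)
      qed
      then have vwu: "v \<noteq> u" "w \<noteq> u"
        using vw sym[of v w] defect_sym[of u u' "{}" R v w] by auto
      then have d0: "defect u u' {} R v w = 0" by (auto simp: defect_def doubleton_eq_iff)
      then have le: "a v w \<le> 0" "a w v \<le> 0" using vw(4) entries[of v w] sym[of v w] by auto
      have UR: ?thesis if q: "q \<in> R" "a u' q \<le> 0" for q
      proof (cases "2 \<le> k")
        case True
        have "obeys u u' {q} (R - {q})" using O q u by (auto simp: obeys_def layout_def)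
        moreover have "card (R - {q}) = k - 1" using q u cR by simp
        moreover have "R - {q} \<noteq> {}" using \<open>card (R - {q}) = k - 1\<close> True
          by (metis card.empty diff_is_0_eq not_less_eq_eq numeral_2_eq_2 One_nat_def)
        moreover have "card {q} + card (R - {q}) = k" using \<open>card (R - {q}) = k - 1\<close> True by simp
        ultimately show ?thesis using True by blast
      next
        case False
        moreover have "card R \<noteq> 0" using q u by auto
        ultimately have k1: "k = 1" using cR by linarith
        then have "R = {q}" using cR q by (metis card_1_singletonE singletonD)
        then show ?thesis using deleted_pair_at_second_hub_bound[of u u' q] O q k1 by simp
      qed
      have TR: ?thesis if "p \<in> T" "q \<in> R" "a p q \<le> 0" for p q
        using deleted_pair_T_R_bound[OF O, of p q] that k_bounds cR by (simp add: T_def add.commute)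
      have TT: ?thesis if "p \<in> T" "q \<in> T" "p \<noteq> q" "a p q \<le> 0" for p q
        using deleted_pair_in_T_bound[OF O, of p q] that k_bounds cR gain_deleted_pair_in_T[of m k] m3 by (simp add: T_def)
      have RR: ?thesis if "p \<in> R" "q \<in> R" "p \<noteq> q" "a p q \<le> 0" for p q
      proof -
        have "2 \<le> k" using that u cR card_mono[of R "{p, q}"] by simp
        then show ?thesis using deleted_pair_in_R_bound[OF O, of p q] that k_bounds cR gain_deleted_pair_in_R[of k m] by simp
      qed
      have "v = u' \<or> v \<in> R \<or> v \<in> T" "w = u' \<or> w \<in> R \<or> w \<in> T" using vw vwu by (auto simp: T_def)
      moreover have "\<not> (v = u' \<and> w \<in> T)" "\<not> (w = u' \<and> v \<in> T)" using Tu le sym by force+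
      ultimately show ?thesis
        using vw(3) le UR TR TT RR by blast
    qed
  qed
qed

text \<open>
Fix a negative edge \<open>u u'\<close>. Fewer than \<open>t\<close> vertices form a negative triangle with it; every other vertex
has a defect at \<open>u\<close> or at \<open>u'\<close>, and there are at least \<open>k\<close> of these. Discarding surplus
defects leaves \<open>k + 1\<close> of them at one end, or \<open>k\<close> of them distributed over both ends, unless there
are exactly \<open>k\<close> and all at one end, which is the preceding lemma, or \<open>k = 1\<close> and there is one
at each end.
\<close>

lemma three_cases:
  "(\<exists>u u' R. obeys u u' {} R \<and> card R = k + 1) \<or>
    (2 \<le> k \<and> (\<exists>u u' S R. obeys u u' S R \<and> S \<noteq> {} \<and> R \<noteq> {} \<and> card S + card R = k)) \<or>
    m < real (card V) - 2 + gain m 0 (real k + 1)" (is "?A \<or> ?B \<or> ?C")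
proof -
  obtain u u' where u: "u \<in> V" "u' \<in> V" "u \<noteq> u'" "a u u' = -1" using negative_edge by blast
  define T where "T = {w \<in> V - {u, u'}. a u w * a u' w = 1}"
  define R where "R = {w \<in> V - {u, u'}. a u w * a u' w \<noteq> 1 \<and> a u w \<le> 0}"
  define S where "S = {w \<in> V - {u, u'}. a u w * a u' w \<noteq> 1 \<and> \<not> a u w \<le> 0}"
  have f: "finite T" "finite R" "finite S" using fin by (auto simp: T_def R_def S_def)
  have SRT: "S \<inter> R = {}" "T = V - ({u, u'} \<union> S \<union> R)" by (auto simp: T_def R_def S_def)
  have L: "layout V u u' S R" using u fin SRT(1) by (auto simp: layout_def R_def S_def)
  have "a u' w \<le> 0" if "w \<in> S" for w
  proof -
    have "a u w = 1" using that entries[of u w] by (auto simp: S_def)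
    then show ?thesis using that entries[of u' w] by (auto simp: S_def)
  qed
  then have O: "obeys u u' S R" using L u by (auto simp: obeys_def R_def)
  have cT: "card T < t"
  proof -
    have "card ((\<lambda>z. {u, u', z}) ` T) < t"
    proof (rule triangles)
      fix X assume "X \<in> (\<lambda>z. {u, u', z}) ` T"
      then obtain z where z: "z \<in> T" "X = {u, u', z}" by auto
      then have neg: "a u u' * a u' z * a u z = -1" using u(4) by (simp add: T_def mult.commute)
      show "negative_triple V a X"
        unfolding z(2) by (rule negative_tripleI) (use z u neg in \<open>auto simp: T_def\<close>)
    qed (use f in simp)
    moreover have "inj_on (\<lambda>z. {u, u', z}) T"
      by (rule inj_onI, drule equalityD1) (auto simp: T_def)
    ultimately show ?thesis by (simp add: card_image)
  qed
  have "card V = 2 + card S + card R + card T" using layout_card[OF L] unfolding SRT(2)[symmetric] .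
  then have sum: "k \<le> card S + card R" "card S + card R = k \<Longrightarrow> card T + 2 + k = card V"
    using cT k_eq by linarith+
  have "k + 1 \<le> card R \<or> k + 1 \<le> card S \<or> card R \<le> k \<and> card S \<le> k \<and> k + 1 \<le> card S + card R
    \<or> card S + card R = k \<and> card S \<noteq> 0 \<and> card R \<noteq> 0 \<or> card R = k \<and> card S = 0 \<or> card S = k \<and> card R = 0"
    using sum(1) by arith
  then consider (R) "k + 1 \<le> card R" | (S) "k + 1 \<le> card S"
    | (both) "card R \<le> k" "card S \<le> k" "k + 1 \<le> card S + card R"
    | (eq) "card S + card R = k" "card S \<noteq> 0" "card R \<noteq> 0"
    | (eqR) "card R = k" "S = {}" | (eqS) "card S = k" "R = {}"
    using card_0_eq[OF f(2)] card_0_eq[OF f(3)] by blast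
  then show ?thesis
  proof cases
    case R
    obtain R' where "R' \<subseteq> R" "card R' = k + 1" using R by (rule obtain_subset_with_card_n)
    then have ?A using obeys_subset[OF O, of "{}" R'] by blast
    then show ?thesis ..
  next
    case S
    obtain S' where "S' \<subseteq> S" "card S' = k + 1" using S by (rule obtain_subset_with_card_n)
    then have ?A using obeys_subset[OF obeys_swap[OF O], of "{}" S'] by blast
    then show ?thesis ..
  next
    case both
    then have pos: "1 \<le> card S" "1 \<le> card R" "1 \<le> k" by linarith+
    show ?thesis
    proof (cases "2 \<le> k")
      case True
      \<comment> \<open>as many vertices of \<open>S\<close> as possible, but leaving at least one place for \<open>R\<close>\<close>
      define s where "s = min (card S) (k - 1)"
      have s: "s \<le> card S" "k - s \<le> card R" "1 \<le> s" "1 \<le> k - s" "s \<le> k"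
        using both pos True by (auto simp: s_def)
      obtain S' where S': "S' \<subseteq> S" "card S' = s" using s(1) by (rule obtain_subset_with_card_n)
      obtain R' where R': "R' \<subseteq> R" "card R' = k - s" using s(2) by (rule obtain_subset_with_card_n)
      have "S' \<noteq> {}" "R' \<noteq> {}" "card S' + card R' = k" using S' R' s by auto
      then show ?thesis using obeys_subset[OF O S'(1) R'(1)] True by blast
    next
      case False
      then have k1: "k = 1" using pos by simp
      obtain S' where S': "S' \<subseteq> S" "card S' = 1" using pos(1) by (rule obtain_subset_with_card_n)
      obtain R' where R': "R' \<subseteq> R" "card R' = 1" using pos(2) by (rule obtain_subset_with_card_n)
      have "m \<le> real (card V) - 2 + gain m 1 1"
        using obeys_bound[OF obeys_subset[OF O S'(1) R'(1)]] S' R' m_ge_8 by simp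
      also have "\<dots> < real (card V) - 2 + gain m 0 2"
        using gain_decreasing_in_product[of m 0 2 1 1] m_ge_8 by simp
      finally show ?thesis using k1 by simp
    qed
  next
    case eq
    then have "2 \<le> k" "S \<noteq> {}" "R \<noteq> {}" by auto
    then show ?thesis using O eq(1) by blast
  next
    case eqR
    have "a u z * a u' z = 1" if "z \<in> V - ({u, u'} \<union> R)" for z
    proof -
      have "z \<in> T" unfolding SRT(2) using that eqR(2) by simp
      then show ?thesis by (simp add: T_def)
    qed
    then show ?thesis using O eqR by (intro one_hub_saturated[of u u' R]) auto
  next
    case eqS
    have "a u' z * a u z = 1" if "z \<in> V - ({u', u} \<union> S)" for z
    proof -
      have "z \<in> T" unfolding SRT(2) using that eqS(2) by auto
      then show ?thesis by (simp add: T_def mult.commute)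
    qed
    then show ?thesis using obeys_swap[OF O] eqS by (intro one_hub_saturated[of u' u S]) auto
  qed
qed

text \<open>
The case of equality that \<open>obeys_tight\<close> leaves open: \<open>t = 3\<close> and \<open>m = n - 1\<close>. The weight of \<open>u\<close> is
zero, so the entries of \<open>a\<close> at \<open>u\<close> are not determined by domination. All other entries are those of a
positive complete graph on which \<open>x\<close> is constant. The eigenvalue equation at \<open>u\<close> says that \<open>u\<close>
has as many positive as negative edges, and two of each kind would give at least four negative
triangles, while at most two are allowed.
\<close>

lemma pendant_limit:
  assumes O: "obeys u u' {} R" and cR: "card R = k + 1" and m: "m = real k + 3"
  shows "\<exists>R. shaped V a u u' {} R \<and> card R = k + 1"
proof -
  have L: "layout V u u' {} R" using O by (simp add: obeys_def)
  have u: "u \<in> V" "u' \<in> V" "u \<noteq> u'" "u \<notin> R" "u' \<notin> R" "R \<subseteq> V" "finite R"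
    using L fin by (auto simp: layout_def intro: finite_subset)
  have auu: "a u u' = -1" using O by (simp add: obeys_def)
  have m3: "3 \<le> m" using m_ge_8 by simp
  have n: "card V = k + 4" using k_bounds m_ge m by linarith
  have t3: "t = 3" using n k_eq card_ge by linarith
  define E where "E = defect u u' {} R"
  \<comment> \<open>the weights for \<open>m = k + 3\<close>, where \<open>hub\<close> vanishes\<close>
  define y where "y v = (if v = u then 0 else 1 / m)" for v
  have yR: "sum y R = (real k + 1) / m"
    unfolding y_def using u cR by (subst sum.cong[of R R _ "\<lambda>_. 1 / m"]) auto
  have yeq: "m * y v + (\<Sum>w\<in>V. E v w * y w) = 1" if "v \<in> V" for v
    unfolding E_def defect_sum[OF L] yR using u m3 m by (auto simp: y_def add_divide_distrib[symmetric])
  have one: "sum y V = 1"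
  proof -
    have "sum y V = y u + (real (card V) - 1) * (1 / m)"
      using u fin by (intro sum_constant_except_one) (auto simp: y_def)
    then show ?thesis using n m m3 by (simp add: y_def)
  qed
  have y0: "0 \<le> y v" for v using m3 by (simp add: y_def)
  have ypos: "0 < y v" if "v \<noteq> u" for v using that m3 by (simp add: y_def)
  note dom = domination[of E y, OF defect_sym[of u u' "{}" R, folded E_def]
      defect_le_D[OF O, folded E_def] y0 yeq]
  have xeq: "m * x v + (\<Sum>w\<in>V. E v w * x w) = 1" if "v \<in> V" "v \<noteq> u" for v
    using dom(2)[OF _ _ _ one that(1) ypos[OF that(2)]] by simp
  have xR: "m * x w = 1 - x u" if "w \<in> R" for w
  proof -
    have "w \<noteq> u" "w \<noteq> u'" "w \<in> V" using that u by auto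
    then show ?thesis using xeq[of w] that unfolding E_def defect_sum[OF L] by simp
  qed
  have xu': "m * x u' = 1 - 2 * x u"
    using xeq[of u'] u unfolding E_def defect_sum[OF L] by simp
  have xT: "m * x w = 1" if "w \<in> V" "w \<noteq> u" "w \<noteq> u'" "w \<notin> R" for w
    using xeq[of w] that unfolding E_def defect_sum[OF L] by simp
  have "x u = 0"
  proof -
    have "(\<Sum>w\<in>V. E u w * x w) \<le> (\<Sum>w\<in>V. D u w * x w)"
      using defect_le_D[OF O u(1)] nonneg unfolding E_def by (intro sum_mono mult_right_mono) auto
    then have "m * x u + 2 * x u' + sum x R \<le> 1"
      using D_equation[OF u(1)] unfolding E_def defect_sum[OF L] by simp
    then have "m * (m * x u + 2 * x u' + sum x R) \<le> m * 1" using m3 by (intro mult_left_mono) auto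
    moreover have "m * sum x R = (real k + 1) * (1 - x u)"
    proof -
      have "m * sum x R = (\<Sum>w\<in>R. 1 - x u)" unfolding sum_distrib_left using xR by (intro sum.cong) auto
      then show ?thesis using cR by simp
    qed
    moreover have "m * (m * x u + 2 * x u' + sum x R) = m * (m * x u) + 2 * (m * x u') + m * sum x R"
      by (simp add: algebra_simps)
    ultimately have "m * (m * x u) + 2 * (1 - 2 * x u) + (real k + 1) * (1 - x u) \<le> m"
      using xu' by simp
    moreover have "real k + 1 = m - 2" using m by simp
    ultimately have "m * (m * x u) + 2 * (1 - 2 * x u) + (m - 2) * (1 - x u) \<le> m" by simp
    then have "x u * (m * m - m - 2) \<le> 0" by (simp add: algebra_simps)
    moreover have "0 < (m - 2) * (m + 1)" using m3 by simp
    moreover have "(m - 2) * (m + 1) = m * m - m - 2" by Groebner_Basis.algebra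
    ultimately have "x u \<le> 0" by (auto simp: mult_le_0_iff)
    then show ?thesis using nonneg[OF u(1)] by simp
  qed
  then have xm: "m * x w = 1" if "w \<in> V" "w \<noteq> u" for w
    using that xR xu' xT by (cases "w = u'"; cases "w \<in> R") auto
  have xpos: "0 < x w" if "w \<in> V" "w \<noteq> u" for w
    using xm[OF that] m3 by (metis less_eq_real_def mult_zero_right nonneg that(1) zero_neq_one)
  have clique: "a v w = 1" if "v \<in> V" "w \<in> V" "v \<noteq> w" "v \<noteq> u" "w \<noteq> u" for v w
  proof -
    have "D v w = E v w"
      using dom(3)[OF _ _ _ one that(1) ypos[OF that(4)] that(2) xpos[OF that(2,5)]] by simp
    then show ?thesis using that by (simp add: D_def E_def defect_def doubleton_eq_iff)
  qed
  define P N where "P = {w \<in> V - {u}. a u w = 1}" and "N = {w \<in> V - {u}. a u w = -1}"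
  have fPN: "finite P" "finite N" using fin by (auto simp: P_def N_def)
  have "(\<Sum>w\<in>V - {u}. a u w) = 0"
  proof -
    have "(\<Sum>w\<in>V - {u}. a u w) = (\<Sum>w\<in>V - {u}. m * (a u w * x w))"
      using xm by (intro sum.cong) (auto simp: mult.left_commute)
    also have "\<dots> = m * ((m - 1) * x u)" using eigen[OF u(1)] by (simp add: sum_distrib_left[symmetric])
    finally show ?thesis using \<open>x u = 0\<close> by simp
  qed
  moreover have "(\<Sum>w\<in>V - {u}. a u w) = real (card P) - real (card N)"
  proof -
    have "(\<Sum>w\<in>V - {u}. a u w) = (\<Sum>w\<in>V - {u}. (if w \<in> P then 1 else 0) - (if w \<in> N then 1 else 0))"
    proof (rule sum.cong[OF refl])
      fix w assume "w \<in> V - {u}"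
      then show "a u w = (if w \<in> P then 1 else 0) - (if w \<in> N then 1 else 0)"
        using entries[of u w] by (auto simp: P_def N_def)
    qed
    also have "\<dots> = real (card ((V - {u}) \<inter> P)) - real (card ((V - {u}) \<inter> N))"
      using fin by (simp add: sum_subtractf sum.If_cases)
    also have "\<dots> = real (card P) - real (card N)"
    proof -
      have "(V - {u}) \<inter> P = P" "(V - {u}) \<inter> N = N" by (auto simp: P_def N_def)
      then show ?thesis by simp
    qed
    finally show ?thesis .
  qed
  ultimately have PN: "card P = card N" by simp
  have u'N: "u' \<in> N" using u auu by (auto simp: N_def)
  have "card N < 2"
  proof (rule ccontr)
    assume "\<not> card N < 2"
    then have 2: "2 \<le> card N" "2 \<le> card P" using PN by simp_all
    obtain q1 q2 where q: "q1 \<in> N" "q2 \<in> N" "q1 \<noteq> q2"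
      using 2(1) by (meson card_2_iff' obtain_subset_with_card_n subset_iff)
    obtain p1 p2 where p: "p1 \<in> P" "p2 \<in> P" "p1 \<noteq> p2"
      using 2(2) by (meson card_2_iff' obtain_subset_with_card_n subset_iff)
    have pq: "p \<noteq> q" "p \<in> V" "q \<in> V" "p \<noteq> u" "q \<noteq> u" "a u p * a p q * a u q = -1" if "p \<in> P" "q \<in> N" for p q
    proof -
      show ne: "p \<noteq> q" using that by (auto simp: P_def N_def)
      show "p \<in> V" "q \<in> V" "p \<noteq> u" "q \<noteq> u" "a u p * a p q * a u q = -1"
        using that clique[of p q, OF _ _ ne] by (auto simp: P_def N_def)
    qed
    have "card {{u, p1, q1}, {u, p1, q2}, {u, p2, q1}} < t"
    proof (rule triangles)
      fix X assume "X \<in> {{u, p1, q1}, {u, p1, q2}, {u, p2, q1}}"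
      then obtain p' q' where X: "p' \<in> P" "q' \<in> N" "X = {u, p', q'}" using p q by auto
      show "negative_triple V a X"
        unfolding X(3) by (rule negative_tripleI) (use pq[OF X(1,2)] u in auto)
    qed simp
    moreover have "card {{u, p1, q1}, {u, p1, q2}, {u, p2, q1}} = 3"
    proof -
      have "{u, p1, q1} \<noteq> {u, p1, q2}" "{u, p1, q1} \<noteq> {u, p2, q1}" "{u, p1, q2} \<noteq> {u, p2, q1}"
        using p q pq[of p1 q1] pq[of p1 q2] pq[of p2 q1] by (auto simp: set_eq_iff)
      then show ?thesis by simp
    qed
    ultimately show False using t3 by simp
  qed
  moreover have "card N \<noteq> 0" using u'N fPN by auto
  ultimately have "card N = 1" by simp
  then obtain z where z: "P = {z}" using PN by (metis card_1_singletonE)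
  have N: "N = {u'}" using \<open>card N = 1\<close> u'N by (metis card_1_singletonE singletonD)
  have zV: "z \<in> V" "z \<noteq> u" "a u z = 1" using z unfolding P_def by blast+
  then have zu': "z \<noteq> u'" using auu by auto
  define R' where "R' = V - {u, u', z}"
  have "shaped V a u u' {} R'"
    unfolding shaped_def
  proof (intro conjI ballI impI)
    show L': "layout V u u' {} R'" using u fin by (auto simp: layout_def R'_def)
    have auz: "a u w = 1 - defect u u' {} R' u w" if wV: "w \<in> V" "w \<noteq> u" for w
    proof -
      consider "w = u'" | "w = z" | "w \<in> R'" using wV unfolding R'_def by blast
      then show ?thesis
      proof cases
        case 1
        then show ?thesis using auu by (simp add: defect_def)
      next
        case 2
        then show ?thesis using zV zu' u by (simp add: defect_def doubleton_eq_iff R'_def)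
      next
        case 3
        then have "w \<notin> P" "w \<notin> N" using z N by (auto simp: R'_def)
        then have "a u w \<noteq> 1" "a u w \<noteq> -1" using wV unfolding P_def N_def by blast+
        then have "a u w = 0" using entries[of u w] by blast
        then show ?thesis using 3 u by (auto simp: defect_def doubleton_eq_iff R'_def)
      qed
    qed
    fix v w assume vw: "v \<in> V" "w \<in> V" "v \<noteq> w"
    show "a v w = 1 - defect u u' {} R' v w"
    proof (cases "v = u \<or> w = u")
      case True
      then show ?thesis using auz[of w] auz[of v] vw sym[of v w] defect_sym[of u u' "{}" R' v w] by auto
    next
      case False
      then show ?thesis using clique[of v w] vw by (simp add: defect_def doubleton_eq_iff)
    qed
  qed
  moreover have "card R' = k + 1" unfolding R'_def using n zV zu' u fin by (simp add: card_Diff_subset)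
  ultimately show ?thesis by blast
qed

text \<open>
The total weight of the second best graph at \<open>m\<close> is at most 1 when the given graph is maximal. Each of
the three cases above either contradicts this or is a case of equality.
\<close>

lemma extremal_one_hub:
  assumes range: "k \<le> 1 \<or> card V \<le> 2 * k + 2"
    and max: "real (card V) - 2 + gain m 0 (real k + 1) \<le> m"
  shows "\<exists>u u' R. shaped V a u u' {} R \<and> card R = k + 1"
  using three_cases
proof (elim disjE conjE exE)
  fix u u' R assume O: "obeys u u' {} R" and cR: "card R = k + 1"
  show ?thesis
  proof (cases "m = real k + 3")
    case True
    then show ?thesis using pendant_limit[OF O cR] by blast
  next
    case False
    then have m: "real k + 3 < m" using k_bounds by simp
    have cR': "real (card R) = real k + 1" using cR by simp
    have "m = real (card V) - 2 + gain m (card ({}::'a set)) (card R)"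
      using obeys_bound[OF O] max m cR' by simp
    then have "shaped V a u u' {} R" using m cR' by (intro obeys_tight[OF O]) auto
    then show ?thesis using cR by blast
  qed
next
  fix u u' S R assume k: "2 \<le> k" and O: "obeys u u' S R" and SR: "S \<noteq> {}" "R \<noteq> {}" "card S + card R = k"
  have n: "card V \<le> 2 * k + 2" using range k by simp
  have fSR: "finite S" "finite R" using O fin by (auto simp: obeys_def layout_def intro: finite_subset)
  have sum: "real (card S) + real (card R) = k" using SR(3) by linarith
  have "1 \<le> real (card S)" "1 \<le> real (card R)" using SR fSR by (auto simp: Suc_le_eq card_gt_0_iff)
  then have "0 \<le> (real (card S) - 1) * (real (card R) - 1)" by simp
  then have prod: "real k - 1 \<le> real (card S) * real (card R)" using sum by (simp add: algebra_simps)
  have "gain m (card S) (card R) \<le> gain m 1 (real k - 1)"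
  proof (cases "real k - 1 = real (card S) * real (card R)")
    case True
    have "gain m (card S) (card R) = gain m 1 (real k - 1)"
      using sum True by (intro gain_cong) simp_all
    then show ?thesis by simp
  next
    case False
    then show ?thesis
      using gain_decreasing_in_product[of m 1 "real k - 1" "card S" "card R"] sum prod k k_bounds m_ge_8 by simp
  qed
  then have b: "m \<le> real (card V) - 2 + gain m 1 (real k - 1)"
    using obeys_bound[OF O] sum k_bounds by simp
  have k4: "4 \<le> k" using n card_ge by linarith
  have "m \<le> 2 * real k + 3/2"
  proof (rule ccontr)
    assume "\<not> m \<le> 2 * real k + 3/2"
    moreover have "m \<le> 2 * real k + 2" using m_le_card n by linarith
    ultimately have "gain m 1 (real k - 1) < 3/2" using k4 by (intro gain_two_hubs_less_three_halves) auto
    then show False using b n \<open>\<not> m \<le> 2 * real k + 3/2\<close> by linarith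
  qed
  then have "gain m 1 (real k - 1) < gain m 0 (real k + 1)"
    using k_bounds by (intro gain_crossover_lower) auto
  then show ?thesis using b max by simp
qed (use max in simp)

lemma extremal_two_hubs:
  assumes range: "2 \<le> k" "2 * k + 3 \<le> card V"
    and max: "real (card V) - 2 + gain m 1 (real k - 1) \<le> m"
  shows "\<exists>u u' S R. shaped V a u u' S R \<and> card S = 1 \<and> card R = k - 1"
proof -
  have m2: "2 * real k + 2 \<le> m" using range m_ge by linarith
  have less: "gain m 0 (real k + 1) < gain m 1 (real k - 1)"
    using range m2 by (intro gain_crossover_upper) auto
  show ?thesis
    using three_cases
  proof (elim disjE conjE exE)
    fix u u' R assume O: "obeys u u' {} R" and cR: "card R = k + 1"
    have "m \<le> real (card V) - 2 + gain m 0 (real k + 1)"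
      using obeys_bound[OF O] cR k_bounds by (simp add: add.commute)
    then show ?thesis using less max by simp
  next
    fix u u' S R assume O: "obeys u u' S R" and SR: "S \<noteq> {}" "R \<noteq> {}" "card S + card R = k"
    have fSR: "finite S" "finite R" using O fin by (auto simp: obeys_def layout_def intro: finite_subset)
    have sum: "real (card S) + real (card R) = k" using SR(3) by linarith
    have small: "real (card S) + real (card R) + 2 \<le> m" using sum k_bounds by simp
    have pos: "1 \<le> real (card S)" "1 \<le> real (card R)" using SR fSR by (auto simp: Suc_le_eq card_gt_0_iff)
    have "(real (card S) - 1) * (real (card R) - 1) = 0"
    proof (rule ccontr)
      assume "(real (card S) - 1) * (real (card R) - 1) \<noteq> 0"
      then have "0 < (real (card S) - 1) * (real (card R) - 1)" using pos by auto
      then have "gain m (card S) (card R) < gain m 1 (real k - 1)"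
        using gain_decreasing_in_product[of m 1 "real k - 1" "card S" "card R"] sum range k_bounds m_ge_8
        by (simp add: algebra_simps)
      then show False using obeys_bound[OF O small] max by simp
    qed
    then have one: "card S = 1 \<or> card R = 1" by auto
    have "real (card S) * real (card R) = real k - 1" using one sum by auto
    then have "gain m (card S) (card R) = gain m 1 (real k - 1)"
      using sum by (intro gain_cong) simp_all
    then have "m = real (card V) - 2 + gain m (card S) (card R)"
      using obeys_bound[OF O small] max by simp
    then have sh: "shaped V a u u' S R" using SR by (intro obeys_tight[OF O small]) auto
    show ?thesis
    proof (cases "card S = 1")
      case True
      moreover have "card R = k - 1" using True SR(3) by simp
      ultimately show ?thesis using sh by blast
    next
      case False
      then have "card R = 1" "card S = k - 1" using one SR(3) by simp_all
      then show ?thesis using shaped_swap[OF sh] by blast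
    qed
  qed (use max less in simp)
qed

end

section \<open>The second best graph\<close>

lemma sigma_nonedge_iff:
  assumes "v \<in> verts (Sigma_graph s \<tau> r)" "w \<in> verts (Sigma_graph s \<tau> r)" "v \<noteq> w"
  shows "{v, w} \<notin> edges (Sigma_graph s \<tau> r) \<longleftrightarrow>
    (v = 0 \<and> 2 + s + \<tau> \<le> w) \<or> (w = 0 \<and> 2 + s + \<tau> \<le> v) \<or>
    (v = 1 \<and> 2 \<le> w \<and> w < 2 + s) \<or> (w = 1 \<and> 2 \<le> v \<and> v < 2 + s)"
proof -
  have vw: "v < s + \<tau> + r + 2" "w < s + \<tau> + r + 2" using assms(1,2) by (simp_all add: sigma_verts)
  have "v = 0 \<or> v = 1 \<or> 2 \<le> v" by linarith
  moreover have "w = 0 \<or> w = 1 \<or> 2 \<le> w" by linarith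
  ultimately show ?thesis
    unfolding sigma_edge_iff[OF assms(1,2)] defect_def atLeastLessThan_iff doubleton_eq_iff
    using vw assms(3) by (elim disjE) simp_all
qed

text \<open>
The first graph has one nonedge more.
\<close>

lemma one_hub_not_extremal:
  "\<not> switching_isomorphic (Sigma_graph 0 \<tau> (r + 1)) (Sigma_graph 0 (\<tau> + 1) r)"
proof
  define G where "G = Sigma_graph 0 \<tau> (r + 1)"
  define H where "H = Sigma_graph 0 (\<tau> + 1) r"
  assume "switching_isomorphic (Sigma_graph 0 \<tau> (r + 1)) (Sigma_graph 0 (\<tau> + 1) r)"
  then have "switching_isomorphic G H" unfolding G_def H_def .
  from switching_isomorphic_underlying[OF this]
  obtain f where f: "bij_betw f (verts H) (verts G)"
    "\<forall>v\<in>verts H. \<forall>w\<in>verts H. {v, w} \<in> edges H \<longleftrightarrow> {f v, f w} \<in> edges G"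
    by (elim exE conjE)
  define ne where "ne X = {(v, w). v \<in> verts X \<and> w \<in> verts X \<and> v \<noteq> w \<and> {v, w} \<notin> edges X}" for X :: "nat sgraph"
  have V: "verts G = verts H" by (simp add: G_def H_def sigma_verts)
  have surj: "\<exists>v\<in>verts H. y = f v" if "y \<in> verts G" for y
    using f(1) that by (auto simp: bij_betw_def)
  have fin: "finite (ne G)"
    by (rule finite_subset[of _ "verts G \<times> verts G"]) (auto simp: ne_def G_def sigma_verts)
  have "inj_on (map_prod f f) (ne H)"
    using f(1) by (auto simp: inj_on_def bij_betw_def ne_def)
  moreover have "map_prod f f ` ne H = ne G"
  proof (intro Set.set_eqI iffI)
    fix p assume "p \<in> map_prod f f ` ne H"
    then obtain v w where vw: "p = (f v, f w)" "v \<in> verts H" "w \<in> verts H" "v \<noteq> w" "{v, w} \<notin> edges H"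
      by (auto simp: ne_def)
    moreover have "f v \<in> verts G" "f w \<in> verts G" "f v \<noteq> f w"
      using f(1) vw by (auto simp: bij_betw_def inj_on_def)
    ultimately show "p \<in> ne G" using f(2) by (auto simp: ne_def)
  next
    fix p assume "p \<in> ne G"
    then obtain v' w' where p: "p = (v', w')" "v' \<in> verts G" "w' \<in> verts G" "v' \<noteq> w'" "{v', w'} \<notin> edges G"
      by (auto simp: ne_def)
    obtain v w where v: "v \<in> verts H" "v' = f v" and w: "w \<in> verts H" "w' = f w"
      using surj[OF p(2)] surj[OF p(3)] by blast
    have "{v, w} \<notin> edges H" using p(5) f(2) v w by blast
    then have "(v, w) \<in> ne H" using v w p(4) by (auto simp: ne_def)
    then show "p \<in> map_prod f f ` ne H" using p(1) v(2) w(2) by (intro image_eqI[of _ _ "(v, w)"]) simp_all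
  qed
  ultimately have "card (ne G) = card (ne H)" by (metis card_image)
  moreover have "card (ne H) < card (ne G)"
  proof (rule psubset_card_mono[OF fin])
    show "ne H \<subset> ne G"
  proof (rule psubsetI)
    show "ne H \<subseteq> ne G"
    proof
      fix p assume "p \<in> ne H"
      then obtain v w where p: "p = (v, w)" "v \<in> verts H" "w \<in> verts H" "v \<noteq> w" "{v, w} \<notin> edges H"
        by (auto simp: ne_def)
      have "(v = 0 \<and> 2 + 0 + (\<tau> + 1) \<le> w) \<or> (w = 0 \<and> 2 + 0 + (\<tau> + 1) \<le> v)"
        using p(5) sigma_nonedge_iff[OF p(2)[unfolded H_def] p(3)[unfolded H_def] p(4)]
        unfolding H_def[symmetric] by linarith
      moreover have vw: "v \<in> verts G" "w \<in> verts G" using p V by simp_all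
      ultimately have "{v, w} \<notin> edges G"
        using sigma_nonedge_iff[OF vw[unfolded G_def] p(4)]
        unfolding G_def[symmetric] by linarith
      then show "p \<in> ne G" using p(1,4) vw by (simp add: ne_def)
    qed
    have vG: "0 \<in> verts G" "2 + \<tau> \<in> verts G" and vH: "0 \<in> verts H" "2 + \<tau> \<in> verts H"
      by (simp_all add: G_def H_def sigma_verts)
    have ne0: "0 \<noteq> 2 + \<tau>" by simp
    have "{0, 2 + \<tau>} \<notin> edges G" "{0, 2 + \<tau>} \<in> edges H"
      using sigma_nonedge_iff[OF vG[unfolded G_def] ne0] sigma_nonedge_iff[OF vH[unfolded H_def] ne0]
      unfolding G_def[symmetric] H_def[symmetric] by simp_all
    then have "(0, 2 + \<tau>) \<in> ne G" "(0, 2 + \<tau>) \<notin> ne H" using vG ne0 by (simp_all add: ne_def)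
    then show "ne H \<noteq> ne G" by blast
    qed
  qed
  ultimately show False by simp
qed

text \<open>
The first graph has two disjoint nonedges, while all nonedges of the second one have a common vertex.
\<close>

lemma two_hubs_not_extremal:
  assumes "1 \<le> r"
  shows "\<not> switching_isomorphic (Sigma_graph 1 \<tau> r) (Sigma_graph 0 \<tau> (r + 1))"
proof
  define G where "G = Sigma_graph 1 \<tau> r"
  define H where "H = Sigma_graph 0 \<tau> (r + 1)"
  assume "switching_isomorphic (Sigma_graph 1 \<tau> r) (Sigma_graph 0 \<tau> (r + 1))"
  then have "switching_isomorphic G H" unfolding G_def H_def .
  from switching_isomorphic_underlying[OF this]
  obtain f where f: "bij_betw f (verts H) (verts G)"
    "\<forall>v\<in>verts H. \<forall>w\<in>verts H. {v, w} \<in> edges H \<longleftrightarrow> {f v, f w} \<in> edges G"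
    by (elim exE conjE)
  have G: "0 \<in> verts G" "1 \<in> verts G" "2 \<in> verts G" "3 + \<tau> \<in> verts G"
    using assms by (simp_all add: G_def sigma_verts)
  have surj: "\<exists>v\<in>verts H. f v = y" if "y \<in> verts G" for y
  proof -
    have "y \<in> f ` verts H" using f(1) that by (simp add: bij_betw_def)
    then show ?thesis by blast
  qed
  obtain a b c d where v: "f a = 0" "f b = 3 + \<tau>" "f c = 1" "f d = 2"
    "a \<in> verts H" "b \<in> verts H" "c \<in> verts H" "d \<in> verts H"
    using surj[OF G(1)] surj[OF G(4)] surj[OF G(2)] surj[OF G(3)] by blast
  have "{0, 3 + \<tau>} \<notin> edges G" "{1, 2} \<notin> edges G"
    using sigma_nonedge_iff[of 0 1 \<tau> r "3 + \<tau>"] sigma_nonedge_iff[of 1 1 \<tau> r 2] G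
    unfolding G_def by simp_all
  moreover have "{a, b} \<in> edges H \<longleftrightarrow> {f a, f b} \<in> edges G" "{c, d} \<in> edges H \<longleftrightarrow> {f c, f d} \<in> edges G"
    using f(2) v(5-8) by blast+
  ultimately have ne: "{a, b} \<notin> edges H" "{c, d} \<notin> edges H" unfolding v(1-4) by blast+
  have ab: "a \<noteq> b" and cd: "c \<noteq> d" using v(1-4) by auto
  have a0: "a = 0 \<or> b = 0"
    using ne(1) sigma_nonedge_iff[OF v(5)[unfolded H_def] v(6)[unfolded H_def] ab]
    unfolding H_def[symmetric] by linarith
  have c0: "c = 0 \<or> d = 0"
    using ne(2) sigma_nonedge_iff[OF v(7)[unfolded H_def] v(8)[unfolded H_def] cd]
    unfolding H_def[symmetric] by linarith
  have "f 0 = 0 \<or> f 0 = 3 + \<tau>" using a0 v(1,2) by (elim disjE) simp_all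
  moreover have "f 0 = 1 \<or> f 0 = 2" using c0 v(3,4) by (elim disjE) simp_all
  ultimately show False by linarith
qed

lemma admissible_iff:
  assumes "3 \<le> t" "9 \<le> n"
  defines "k \<equiv> n - 1 - t"
  shows "admissible n t \<Gamma> \<longleftrightarrow> signed_graph \<Gamma> \<and> card (verts \<Gamma>) = n \<and> \<not> balanced \<Gamma> \<and> tC3_free t \<Gamma> \<and>
    \<not> switching_isomorphic \<Gamma> (Sigma_graph 0 (n - 2 - k) k)"
proof (cases "t \<le> n - 2")
  case True
  then have "t + 1 - 2 = n - 2 - k" "n - (t + 1) = k" using assms(1,2) unfolding k_def by linarith+
  then have "Gamma_graph n (t + 1) = Sigma_graph 0 (n - 2 - k) k"
    using Gamma_graph_eq_sigma[of "t + 1" n] True assms(1,2) by simp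
  then show ?thesis using True assms(1,2) by (auto simp: admissible_def)
next
  case False
  then have "k = 0" "Gamma_graph n n = Sigma_graph 0 (n - 2 - k) k"
    using Gamma_graph_eq_sigma[of n n] assms by (simp_all add: k_def)
  then show ?thesis using False assms(1,2) by (auto simp: admissible_def)
qed

text \<open>
In terms of \<open>t\<close>, where \<open>k = n - 1 - t\<close>, the first case is \<open>t \<ge> n - 2\<close> or \<open>2 t \<le> n\<close>.
\<close>

definition second_extremal :: "nat \<Rightarrow> nat \<Rightarrow> nat sgraph" where
  "second_extremal n k =
    (if k \<le> 1 \<or> n \<le> 2 * k + 2 then Sigma_graph 0 (n - 3 - k) (k + 1)
     else Sigma_graph 1 (n - 2 - k) (k - 1))"

lemma second_extremal_admissible:
  assumes t: "3 \<le> t" and n: "9 \<le> n"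
  shows "admissible n t (second_extremal n (n - 1 - t))"
proof -
  define k where "k = n - 1 - t"
  have k: "k + 4 \<le> n" using t n by (simp add: k_def)
  show ?thesis
  proof (cases "k \<le> 1 \<or> n \<le> 2 * k + 2")
    case True
    define \<tau> where "\<tau> = n - 3 - k"
    have c: "n - 2 - k = \<tau> + 1" "\<tau> < t" "1 \<le> \<tau>" "0 + \<tau> + (k + 1) + 2 = n"
      using k n t unfolding \<tau>_def k_def by linarith+
    have "second_extremal n k = Sigma_graph 0 \<tau> (k + 1)"
      using True by (simp add: second_extremal_def \<tau>_def)
    moreover have "card (verts (Sigma_graph 0 \<tau> (k + 1))) = n" unfolding sigma_verts card_lessThan by (rule c(4))
    ultimately show ?thesis
      unfolding admissible_iff[OF t n] k_def[symmetric] c(1)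
      using sigma_signed_graph[of 0 \<tau> "k + 1"] sigma_unbalanced[OF c(3), of 0 "k + 1"]
        sigma_tC3_free[OF c(2), of 0 "k + 1"] one_hub_not_extremal[of \<tau> k]
      by (simp only: simp_thms)
  next
    case False
    define \<tau> r where "\<tau> = n - 2 - k" and "r = k - 1"
    have c: "\<tau> < t" "1 \<le> \<tau>" "1 + \<tau> + r + 2 = n" "1 \<le> r" and kr: "k = r + 1"
      using n t k False unfolding k_def \<tau>_def r_def by linarith+
    have "second_extremal n k = Sigma_graph 1 \<tau> r"
      using False by (simp only: second_extremal_def \<tau>_def r_def if_False)
    moreover have "card (verts (Sigma_graph 1 \<tau> r)) = n" unfolding sigma_verts card_lessThan by (rule c(3))
    moreover have "\<not> switching_isomorphic (Sigma_graph 1 \<tau> r) (Sigma_graph 0 \<tau> k)"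
      unfolding kr by (rule two_hubs_not_extremal[OF c(4)])
    ultimately show ?thesis
      unfolding admissible_iff[OF t n] k_def[symmetric] \<tau>_def[symmetric]
      using sigma_signed_graph[of 1 \<tau> r] sigma_unbalanced[OF c(2), of 1 r]
        sigma_tC3_free[OF c(1), of 1 r]
      by (simp only: simp_thms)
  qed
qed

definition second_gain :: "nat \<Rightarrow> nat \<Rightarrow> real \<Rightarrow> real" where
  "second_gain n k m = (if k \<le> 1 \<or> n \<le> 2 * k + 2 then gain m 0 (real k + 1) else gain m 1 (real k - 1))"

text \<open>
The lower bound \<open>n - 2\<close> comes from the test value \<open>m = n - 1\<close>, at which the gain is at least 1.
It ensures that the comparisons of gains apply to a maximal graph.
\<close>

lemma second_extremal_index:
  assumes k: "k + 4 \<le> n" and n: "9 \<le> n"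
  shows "real n - 2 \<le> index (second_extremal n k)"
    "real n - 1 \<le> m \<Longrightarrow> m < real n - 2 + second_gain n k m \<Longrightarrow> m - 1 < index (second_extremal n k)"
proof -
  have one: "1 \<le> gain (real n - 1) 0 (real k + 1)"
  proof -
    have "3 \<le> real n - 1" "0 \<le> real k + 1" "(real k + 1) + 2 \<le> real n - 1" using k n by linarith+
    note g = gain_one_sided(1,2)[OF this]
    show ?thesis unfolding g(2) using g(1) by simp
  qed
  have g1: "1 \<le> second_gain n k (real n - 1)"
  proof (cases "k \<le> 1 \<or> n \<le> 2 * k + 2")
    case False
    then have "gain (real n - 1) 0 (real k + 1) < gain (real n - 1) 1 (real k - 1)"
      by (intro gain_crossover_upper) auto
    then show ?thesis using False one by (simp add: second_gain_def)
  qed (use one in \<open>simp add: second_gain_def\<close>)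
  have key: "m - 1 \<le> index (second_extremal n k)"
      "m < real n - 2 + second_gain n k m \<Longrightarrow> m - 1 < index (second_extremal n k)"
    if m: "real n - 1 \<le> m" "m \<le> real n - 2 + second_gain n k m" for m
  proof -
    have m3: "3 \<le> m" using m(1) n by linarith
    define P where "P \<longleftrightarrow> k \<le> 1 \<or> n \<le> 2 * k + 2"
    \<comment> \<open>both forms of the graph have \<open>s + \<tau> + r = n - 2\<close>\<close>
    define s \<tau> r where "s = (if P then 0 else 1::nat)"
      and "\<tau> = (if P then n - 3 - k else n - 2 - k)" and "r = (if P then k + 1 else k - 1)"
    have "real r = (if P then real k + 1 else real k - 1)" by (auto simp: r_def P_def of_nat_diff)
    then have H: "second_extremal n k = Sigma_graph s \<tau> r" "second_gain n k m = gain m s r"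
      unfolding second_extremal_def second_gain_def P_def[symmetric] s_def \<tau>_def r_def by simp_all
    have "s + \<tau> + r = n - 2" "s + r + 3 \<le> n"
      using k by (auto simp: s_def \<tau>_def r_def P_def)
    then have nat: "real (s + \<tau> + r) = real n - 2" "real s + real r + 2 \<le> m"
      using k m(1) by linarith+
    note test = sigma_index_from_test_value[of m s r \<tau>, OF m3 nat(2), unfolded nat(1)]
    show "m - 1 \<le> index (second_extremal n k)" unfolding H(1) using test(1) m(2) H(2) by simp
    assume "m < real n - 2 + second_gain n k m"
    then show "m - 1 < index (second_extremal n k)" unfolding H(1) using test(2) m(2) H(2) by simp
  qed
  show "real n - 2 \<le> index (second_extremal n k)"
    using key(1)[of "real n - 1"] g1 by simp
  show "m - 1 < index (second_extremal n k)" if "real n - 1 \<le> m" "m < real n - 2 + second_gain n k m"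
    using key(2)[of m] that by simp
qed

section \<open>Graphs of maximum index\<close>

text \<open>
Switching preserves the product of the entries along a triangle, because the sign of each vertex enters twice.
\<close>

lemma negative_triples_bounded:
  assumes G: "signed_graph \<Gamma>" and free: "tC3_free t \<Gamma>" and F: "finite F"
    and neg: "\<And>X. X \<in> F \<Longrightarrow> negative_triple (verts \<Gamma>) (adj_entry (switch U \<Gamma>)) X"
  shows "card F < t"
proof (rule ccontr)
  assume "\<not> card F < t"
  then obtain F' where F': "F' \<subseteq> F" "card F' = t" using obtain_subset_with_card_n[of t F] by auto
  define g where "g X = {e. e \<subseteq> X \<and> card e = 2}" for X :: "'a set"
  have g: "g X \<in> unbalanced_triangles \<Gamma>" "\<Union> (g X) = X" if XF: "X \<in> F" for X
  proof -
    obtain p q r where X: "X = {p, q, r}" "p \<noteq> q" "q \<noteq> r" "p \<noteq> r" "X \<subseteq> verts \<Gamma>"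
      and prod: "adj_entry (switch U \<Gamma>) p q * adj_entry (switch U \<Gamma>) q r * adj_entry (switch U \<Gamma>) p r = -1"
      using neg[OF XF] by (auto simp: negative_triple_def)
    have gX: "g X = cycle_edges [p, q, r]"
    proof -
      have "e \<in> g X \<longleftrightarrow> e = {p, q} \<or> e = {q, r} \<or> e = {p, r}" for e
      proof
        assume "e \<in> g X"
        then have "e \<subseteq> X" "card e = 2" by (simp_all add: g_def)
        then obtain b c where "e = {b, c}" "b \<noteq> c" "b \<in> X" "c \<in> X" unfolding card_2_iff by blast
        then show "e = {p, q} \<or> e = {q, r} \<or> e = {p, r}" unfolding X(1) by auto
      next
        assume "e = {p, q} \<or> e = {q, r} \<or> e = {p, r}"
        then show "e \<in> g X" unfolding g_def X(1) using X(2-4) by (elim disjE) simp_all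
      qed
      then show ?thesis unfolding cycle_edges_triangle by blast
    qed
    have V: "p \<in> verts \<Gamma>" "q \<in> verts \<Gamma>" "r \<in> verts \<Gamma>" using X by auto
    have "adj_entry \<Gamma> p q * adj_entry \<Gamma> q r * adj_entry \<Gamma> p r
      = adj_entry (switch U \<Gamma>) p q * adj_entry (switch U \<Gamma>) q r * adj_entry (switch U \<Gamma>) p r"
      unfolding adj_entry_switch[OF G V(1,2)] adj_entry_switch[OF G V(2,3)] adj_entry_switch[OF G V(1,3)]
      by (simp add: unit_sign_def)
    then have "negative_cycle \<Gamma> [p, q, r]"
      unfolding negative_triangle_iff[OF G] using prod X by simp
    then show "g X \<in> unbalanced_triangles \<Gamma>"
      unfolding gX unbalanced_triangles_def by (intro CollectI exI[of _ "[p, q, r]"]) simp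
    have "\<Union> (cycle_edges [p, q, r]) = X" unfolding cycle_edges_triangle X(1) by auto
    then show "\<Union> (g X) = X" unfolding gX .
  qed
  have "inj_on g F'"
  proof (rule inj_onI)
    fix X Y assume XY: "X \<in> F'" "Y \<in> F'" "g X = g Y"
    have "X = \<Union> (g X)" using g(2) F'(1) XY(1) by blast
    also have "\<dots> = \<Union> (g Y)" unfolding XY(3) ..
    also have "\<dots> = Y" using g(2) F'(1) XY(2) by blast
    finally show "X = Y" .
  qed
  then have "card (g ` F') = t" using F'(2) by (simp add: card_image)
  moreover have "g ` F' \<subseteq> unbalanced_triangles \<Gamma>" using g(1) F'(1) by auto
  ultimately show False using free by (auto simp: tC3_free_def)
qed

text \<open>
If the second best graph had total weight greater than 1 at \<open>m = index \<Gamma> + 1\<close>, its index would exceed that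
of \<open>\<Gamma>\<close>. So its total weight is at most 1, which is the hypothesis under which the structure of the
switched graph was determined.
\<close>

lemma extremal_structure:
  fixes \<Gamma> :: "'a sgraph"
  assumes t: "3 \<le> t" and n: "9 \<le> n" and adm: "admissible n t \<Gamma>"
    and max: "\<And>\<Delta> :: nat sgraph. admissible n t \<Delta> \<Longrightarrow> index \<Delta> \<le> index \<Gamma>"
  shows "switching_isomorphic \<Gamma> (second_extremal n (n - 1 - t))"
proof -
  define k where "k = n - 1 - t"
  have k4: "k + 4 \<le> n" using t n by (simp add: k_def)
  define V where "V = verts \<Gamma>"
  have G: "signed_graph \<Gamma>" and cV: "card V = n" and unb: "\<not> balanced \<Gamma>" and free: "tC3_free t \<Gamma>"
    and notext: "\<not> switching_isomorphic \<Gamma> (Sigma_graph 0 (n - 2 - k) k)"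
    using adm unfolding admissible_iff[OF t n] k_def[symmetric] V_def by auto
  have fV: "finite V" using G by (simp add: signed_graph_def V_def)
  have "V \<noteq> {}" using cV n by auto
  then obtain x0 where x0: "\<exists>v\<in>V. x0 v \<noteq> 0"
    "\<And>v. v \<in> V \<Longrightarrow> (\<Sum>w\<in>V. adj_entry \<Gamma> v w * x0 w) = index \<Gamma> * x0 v"
    using index_eigenvector[OF G] unfolding V_def by blast
  define m where "m = index \<Gamma> + 1"
  have "index (second_extremal n k) \<le> index \<Gamma>"
    using max[OF second_extremal_admissible[OF t n]] by (simp add: k_def)
  then have m_ge: "real n - 1 \<le> m" and m_max: "real n - 2 + second_gain n k m \<le> m"
    using second_extremal_index(1)[OF k4 n] second_extremal_index(2)[OF k4 n, of m]
    unfolding m_def by linarith+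
  define U where "U = {v \<in> V. x0 v < 0}"
  define \<Gamma>' where "\<Gamma>' = switch U \<Gamma>"
  have G': "signed_graph \<Gamma>'" unfolding \<Gamma>'_def by (rule signed_graph_switch[OF G])
  have V': "verts \<Gamma>' = V" by (simp add: \<Gamma>'_def V_def)
  define a where "a = adj_entry \<Gamma>'"
  have a: "a v w = unit_sign U v * unit_sign U w * adj_entry \<Gamma> v w" if "v \<in> V" "w \<in> V" for v w
    unfolding a_def \<Gamma>'_def using that G by (intro adj_entry_switch) (auto simp: V_def)
  have sx: "unit_sign U v * \<bar>x0 v\<bar> = x0 v" "\<bar>x0 v\<bar> = unit_sign U v * x0 v" if "v \<in> V" for v
    using that by (auto simp: unit_sign_def U_def)
  define c where "c = (\<Sum>v\<in>V. \<bar>x0 v\<bar>)"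
  have c: "0 < c" unfolding c_def using x0(1) fV by (auto intro: sum_pos2)
  define x where "x v = \<bar>x0 v\<bar> / c" for v
  have eig: "(\<Sum>w\<in>V. a v w * x w) = (m - 1) * x v" if v: "v \<in> V" for v
  proof -
    have "(\<Sum>w\<in>V. a v w * x w) = (\<Sum>w\<in>V. (unit_sign U v / c) * (adj_entry \<Gamma> v w * x0 w))"
    proof (rule sum.cong[OF refl])
      fix w assume w: "w \<in> V"
      have "a v w * x w = unit_sign U v * adj_entry \<Gamma> v w * (unit_sign U w * \<bar>x0 w\<bar>) / c"
        using a[OF v w] by (simp add: x_def)
      then show "a v w * x w = (unit_sign U v / c) * (adj_entry \<Gamma> v w * x0 w)"
        unfolding sx(1)[OF w] by simp
    qed
    also have "\<dots> = (unit_sign U v / c) * (index \<Gamma> * x0 v)"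
      unfolding sum_distrib_left[symmetric] x0(2)[OF v] ..
    also have "\<dots> = (m - 1) * x v" unfolding x_def sx(2)[OF v] by (simp add: m_def)
    finally show ?thesis .
  qed
  have core: "few_negative_triangles V a x m t k"
  proof
    show "finite V" "9 \<le> card V" "real (card V) - 1 \<le> m" "3 \<le> t" "k = card V - 1 - t"
      using fV cV n m_ge t by (simp_all add: k_def)
    show "a v w = a w v" for v w unfolding a_def by (rule adj_entry_sym)
    show "a v w \<in> {-1, 0, 1}" for v w unfolding a_def by (rule adj_entry_values[OF G'])
    show "0 \<le> x v" for v using c by (simp add: x_def)
    show "sum x V = 1" using c by (simp add: x_def sum_divide_distrib[symmetric] c_def)
    show "(\<Sum>w\<in>V - {v}. a v w * x w) = (m - 1) * x v" if "v \<in> V" for v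
    proof -
      have "a v v = 0" unfolding a_def by (rule adj_entry_loop[OF G'])
      then show ?thesis using eig[OF that] that fV by (simp add: sum.remove)
    qed
    show "card F < t" if "finite F" "\<And>X. X \<in> F \<Longrightarrow> negative_triple V a X" for F
      using negative_triples_bounded[OF G free that(1)] that(2) unfolding V_def a_def \<Gamma>'_def by blast
    show "\<exists>u\<in>V. \<exists>u'\<in>V. u \<noteq> u' \<and> a u u' = -1"
    proof (rule ccontr)
      assume no: "\<not> (\<exists>u\<in>V. \<exists>u'\<in>V. u \<noteq> u' \<and> a u u' = -1)"
      have "0 \<le> a v w" if "v \<in> V" "w \<in> V" for v w
        using no that adj_entry_values[OF G', of v w] adj_entry_loop[OF G', of v]
        unfolding a_def by fastforce
      then have "balanced \<Gamma>"
        using a unfolding V_def by (intro balancedI[OF G, of "unit_sign U"]) (auto simp: unit_sign_def)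
      then show False using unb by simp
    qed
    show "card R \<noteq> k" if "shaped V a u u' {} R" for u u' R
    proof
      assume "card R = k"
      then have "sg_isomorphic (Sigma_graph 0 (n - 2 - k) k) \<Gamma>'"
        using that G' V' cV k4 unfolding shaped_def a_def
        by (intro sigma_isomorphic[of _ u u' "{}" R]) auto
      then show False
        using notext switching_isomorphicI[of _ U \<Gamma>] unfolding \<Gamma>'_def U_def V_def by blast
    qed
  qed
  have "sg_isomorphic (second_extremal n k) \<Gamma>'"
  proof (cases "k \<le> 1 \<or> n \<le> 2 * k + 2")
    case True
    then obtain u u' R where "shaped V a u u' {} R" "card R = k + 1"
      using few_negative_triangles.extremal_one_hub[OF core] m_max cV by (auto simp: second_gain_def)
    then have "sg_isomorphic (Sigma_graph 0 (n - 3 - k) (k + 1)) \<Gamma>'"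
      using G' V' cV k4 unfolding shaped_def a_def
      by (intro sigma_isomorphic[of _ u u' "{}" R]) auto
    then show ?thesis using True by (simp add: second_extremal_def)
  next
    case False
    then obtain u u' S R where "shaped V a u u' S R" "card S = 1" "card R = k - 1"
      using few_negative_triangles.extremal_two_hubs[OF core] m_max cV by (auto simp: second_gain_def)
    then have "sg_isomorphic (Sigma_graph 1 (n - 2 - k) (k - 1)) \<Gamma>'"
      using G' V' cV k4 False unfolding shaped_def a_def
      by (intro sigma_isomorphic[of _ u u' S R]) auto
    then show ?thesis using False by (simp add: second_extremal_def)
  qed
  then show ?thesis
    unfolding k_def[symmetric] \<Gamma>'_def by (rule switching_isomorphicI) (auto simp: U_def V_def)
qed

theorem theorem2:
  fixes n t :: nat and \<Gamma> :: "'a sgraph"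
  assumes "t \<ge> 3" and "n \<ge> 9"
    and "admissible n t \<Gamma>"
    and "\<forall>\<Delta> :: nat sgraph. admissible n t \<Delta> \<longrightarrow> index \<Delta> \<le> index \<Gamma>"
  shows "(3 \<le> t \<and> t \<le> n div 2 \<longrightarrow> switching_isomorphic \<Gamma> (Gamma_graph n t)) \<and>
    (n div 2 + 1 \<le> t \<and> t \<le> n - 3 \<longrightarrow>
       switching_isomorphic \<Gamma> (Sigma_graph 1 (t - 1) (n - t - 2))) \<and>
    (t = n - 2 \<longrightarrow> switching_isomorphic \<Gamma> (Gamma_graph n (n - 2))) \<and>
    (t \<ge> n - 1 \<longrightarrow> switching_isomorphic \<Gamma> (Gamma_graph n (n - 1)))"
proof -
  define k where "k = n - 1 - t"
  have iso: "switching_isomorphic \<Gamma> (second_extremal n k)"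
    unfolding k_def using assms by (intro extremal_structure) auto
  have one: "switching_isomorphic \<Gamma> (Gamma_graph n (n - 1 - k))" if "k \<le> 1 \<or> n \<le> 2 * k + 2"
  proof -
    have "k + 4 \<le> n" using assms(1,2) by (simp add: k_def)
    then have "n - 1 - k - 2 = n - 3 - k" "n - (n - 1 - k) = k + 1" by auto
    then have "Gamma_graph n (n - 1 - k) = Sigma_graph 0 (n - 3 - k) (k + 1)"
      using Gamma_graph_eq_sigma[of "n - 1 - k" n] \<open>k + 4 \<le> n\<close> by simp
    then show ?thesis using iso that by (simp add: second_extremal_def)
  qed
  show ?thesis
  proof (intro conjI impI)
    assume *: "3 \<le> t \<and> t \<le> n div 2"
    then have "n \<le> 2 * k + 2" "n - 1 - k = t" using assms(2) unfolding k_def by linarith+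
    then show "switching_isomorphic \<Gamma> (Gamma_graph n t)" using one by simp
  next
    assume *: "n div 2 + 1 \<le> t \<and> t \<le> n - 3"
    then have "\<not> (k \<le> 1 \<or> n \<le> 2 * k + 2)" "n - 2 - k = t - 1" "k - 1 = n - t - 2"
      using assms(2) unfolding k_def by linarith+
    then show "switching_isomorphic \<Gamma> (Sigma_graph 1 (t - 1) (n - t - 2))"
      using iso by (simp add: second_extremal_def)
  next
    assume "t = n - 2"
    then have "k = 1" "n - 1 - k = n - 2" using assms(2) unfolding k_def by linarith+
    then show "switching_isomorphic \<Gamma> (Gamma_graph n (n - 2))" using one by simp
  next
    assume "t \<ge> n - 1"
    then have "k = 0" "n - 1 - k = n - 1" using assms(2) unfolding k_def by linarith+
    then show "switching_isomorphic \<Gamma> (Gamma_graph n (n - 1))" using one by simp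
  qed
qed

end
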